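(* Let $f:\mathbb{R}^d\to\mathbb{R}$ be $L$-smooth with optimal value $f^*$, let $\mathcal{K}=\mathbb{R}^d$, suppose $\|\nabla F(x;\xi)-\nabla f(x)\|\le\mathcal{V}$ for every $x$ and $\xi\sim\mathcal D$, and let $\mathcal{A}$ be a $(\delta,\kappa_\delta)$-robust aggregation rule. Put $\gamma=2\kappa_\delta+\frac1m$, $\Delta_1=f(x_1)-f^*$, $C=\sqrt{8\log(16m^2T)}$, and run Algorithm 2 with Option 1 (see the context) for $T$ rounds from $x_1\in\mathbb R^d$ with fixed learning rate $\eta=\min\left\{\frac{\sqrt{\Delta_1}}{3C\mathcal V\sqrt{L\gamma T\log T}},\frac1L\right\}$. Let $\tau_d$ be the set of dynamic rounds. Then the asymptotic convergence rate is $$\frac1T\sum_{t=1}^T\mathbb{E}\|\nabla f(x_t)\|^2\in\tilde{\mathcal O}\left(\mathcal V\sqrt{\frac{L\Delta_1\gamma}{T}}+\mathcal V^2\gamma\frac{|\tau_d|}{T}\right).$$ Thus the algorithm can withstand $|\tau_d|\in\tilde{\mathcal O}(\sqrt{T/\gamma})$ dynamic rounds (omitting the dependence on $L,\Delta_1,\mathcal V$) while matching the static convergence rate, i.e. the rate $\tilde{\mathcal O}\left(\mathcal V\sqrt{L\Delta_1\gamma/T}\right)$ obtained when $\tau_d=\emptyset$. Concretely, when $\kappa_\delta\in\mathcal O(\delta)$, this rate becomes $\tilde{\mathcal O}\left(\mathcal V\sqrt{L\Delta_1(\delta+1/m)/T}\right)$.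
   Context: $\|\cdot\|$ is the Euclidean norm, $[m]=\{1,\dots,m\}$, $\log$ is the base-2 logarithm. $\mathcal O(\cdot)$ hides numerical constants and $\tilde{\mathcal O}(\cdot)$ additionally omits poly-logarithmic factors (in $m$ and $T$); the rates are asymptotic in $T$, i.e. terms of lower order in $T$ are dropped. In the definition of $\eta$, the first term is read as $+\infty$ if its denominator is zero. Problem: minimize $f(x)=\mathbb{E}_{\xi\sim\mathcal{D}}[F(x;\xi)]$, where $\mathbb{E}_{\xi\sim\mathcal D}[\nabla F(x;\xi)]=\nabla f(x)$. $f$ is $L$-smooth: $f(y)\le f(x)+\nabla f(x)^\top(y-x)+\frac L2\|y-x\|^2$ for all $x,y$. Robust aggregation: $\mathcal{A}:(\mathbb{R}^d)^m\to\mathbb{R}^d$ is $(\delta,\kappa_\delta)$-robust ($\delta<1/2$, $\kappa_\delta\ge0$) if for any $g_1,\dots,g_m$ and any $S\subseteq[m]$ with $|S|=(1-\delta)m$, $\|\mathcal{A}(g_1,\dots,g_m)-\bar g_S\|^2\le\frac{\kappa_\delta}{|S|}\sum_{i\in S}\|g_i-\bar g_S\|^2$, where $\bar g_S=\frac1{|S|}\sum_{i\in S}g_i$. Dynamic Byzantine workers: there are $m$ workers. In round $t$, at the $k$-th gradient computation ($1\le k\le 2^{J_t}$, with $J_t$ as below), $\mathcal G_t^k\subseteq[m]$ is the set of honest workers, $|\mathcal G_t^k|=(1-\delta)m$, $\delta<1/2$; the other workers are Byzantine. The set of static rounds is $\tau_s=\{t\in[T]:\mathcal G_t^1=\dots=\mathcal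 G_t^{2^{J_t}}\}$, and the set of dynamic rounds is $\tau_d=[T]\setminus\tau_s$. Algorithm 2, Option 1. For $t=1,\dots,T$: draw $J_t\sim\mathrm{Geom}(1/2)$ ($\mathbb{P}(J_t=j)=2^{-j}$, $j\ge1$). For $k=1,\dots,2^{J_t}$, worker $i$ sends $g_{t,i}^k=\nabla F(x_t;\xi_{t,i}^k)$ if $i\in\mathcal G_t^k$, where the $\xi_{t,i}^k$ are fresh i.i.d. samples from $\mathcal D$, and sends an arbitrary vector $g_{t,i}^k$ otherwise. For $j\in\{0,J_t-1,J_t\}$ let $\bar g_{t,i}^j=2^{-j}\sum_{k=1}^{2^j}g_{t,i}^k$ and $\widehat g_t^{\,j}=\mathcal A(\bar g_{t,1}^j,\dots,\bar g_{t,m}^j)$. Define the event $\mathcal E_t=\{\|\widehat g_t^{\,J_t}-\widehat g_t^{\,J_t-1}\|\le(1+\sqrt2)\sqrt{\gamma}\,C\mathcal V/\sqrt{2^{J_t}}\}$. Set $g_t=\widehat g_t^{\,0}+2^{J_t}(\widehat g_t^{\,J_t}-\widehat g_t^{\,J_t-1})$ if $J_t\le\lfloor\log T\rfloor$ and $\mathcal E_t$ holds, and $g_t=\widehat g_t^{\,0}$ otherwise. Update $x_{t+1}=\Pi_{\mathcal K}(x_t-\eta g_t)$ with $\Pi_{\mathcal K}$ the Euclidean projection (the identity when $\mathcal K=\mathbb R^d$).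
   Formalization: The honest sets and Byzantine vectors of round t may be adaptive but must not depend on J_t beyond k ≤ 2^{J_t} (otherwise the static rate fails); random |τ_d| enters through its expectation; the aggregation rule and the stochastic gradients are assumed measurable. *)

theory Defs
  imports "HOL-Probability.Probability" "HOL-Library.Landau_Symbols"
begin

text \<open>
  Conventions. The space \<open>\<real>\<^sup>d\<close> is a type \<open>'a::euclidean_space\<close>, the set of workers \<open>[m]\<close> is a
  finite type \<open>'m\<close>, so \<open>m = CARD('m)\<close>, and a tuple \<open>(g\<^sub>1,\<dots>,g\<^sub>m)\<close> is a vector of type \<open>'a^'m\<close>.
  Rounds \<open>t\<close> and gradient computations \<open>k\<close> are counted from 1.
\<close>

definition smooth :: "real \<Rightarrow> ('a::euclidean_space \<Rightarrow> real) \<Rightarrow> ('a \<Rightarrow> 'a) \<Rightarrow> bool" where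
  "smooth L f gf \<longleftrightarrow> (\<forall>x. GDERIV f x :> gf x) \<and>
     (\<forall>x y. f y \<le> f x + gf x \<bullet> (y - x) + L / 2 * (norm (y - x))\<^sup>2)"

definition subset_mean :: "'a::euclidean_space ^ 'm \<Rightarrow> 'm::finite set \<Rightarrow> 'a" where
  "subset_mean g S = (1 / real (card S)) *\<^sub>R (\<Sum>i\<in>S. g $ i)"

definition robust :: "real \<Rightarrow> real \<Rightarrow> ('a::euclidean_space ^ 'm::finite \<Rightarrow> 'a) \<Rightarrow> bool" where
  "robust \<delta> \<kappa> A \<longleftrightarrow> \<delta> < 1 / 2 \<and> 0 \<le> \<kappa> \<and>
     (\<forall>g S. real (card S) = (1 - \<delta>) * real CARD('m) \<longrightarrow>
        (norm (A g - subset_mean g S))\<^sup>2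
          \<le> \<kappa> / real (card S) * (\<Sum>i\<in>S. (norm (g $ i - subset_mean g S))\<^sup>2))"

definition Cconst :: "nat \<Rightarrow> nat \<Rightarrow> real" where
  "Cconst m T = sqrt (8 * log 2 (16 * (real m)\<^sup>2 * real T))"

text \<open>The case distinction reads the first term of the minimum as \<open>+\<infinity>\<close> if its denominator is zero.\<close>

definition learning_rate :: "real \<Rightarrow> real \<Rightarrow> real \<Rightarrow> real \<Rightarrow> nat \<Rightarrow> nat \<Rightarrow> real" where
  "learning_rate L V \<gamma> \<Delta> m T =
     (let den = 3 * Cconst m T * V * sqrt (L * \<gamma> * real T * log 2 (real T))
      in if den = 0 then 1 / L else min (sqrt \<Delta> / den) (1 / L))"

text \<open>
  One round. The argument \<open>g k i\<close> is the vector sent by worker \<open>i\<close> at the \<open>k\<close>-th gradient computation.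
\<close>

definition level_aggregate ::
  "('a::euclidean_space ^ 'm::finite \<Rightarrow> 'a) \<Rightarrow> (nat \<Rightarrow> 'm \<Rightarrow> 'a) \<Rightarrow> nat \<Rightarrow> 'a" where
  "level_aggregate A g j = A (\<chi> i. (1 / 2 ^ j) *\<^sub>R (\<Sum>k = 1..2 ^ j. g k i))"

definition mlmc_estimate ::
  "('a::euclidean_space ^ 'm::finite \<Rightarrow> 'a) \<Rightarrow> real \<Rightarrow> real \<Rightarrow> nat \<Rightarrow> nat \<Rightarrow> (nat \<Rightarrow> 'm \<Rightarrow> 'a) \<Rightarrow> 'a" where
  "mlmc_estimate A V \<gamma> T J g =
     (let a = level_aggregate A g in
      if int J \<le> \<lfloor>log 2 (real T)\<rfloor> \<and>
         norm (a J - a (J - 1)) \<le> (1 + sqrt 2) * sqrt \<gamma> * Cconst CARD('m) T * V / sqrt (2 ^ J)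
      then a 0 + 2 ^ J *\<^sub>R (a J - a (J - 1))
      else a 0)"

text \<open>
  The random environment of \<open>T\<close> rounds: levels \<open>J t\<close>, samples \<open>\<xi> t k i\<close>, honest sets \<open>G t k\<close> and
  vectors \<open>B t k i\<close> sent by the Byzantine workers. \<open>H t k\<close> is the information available immediately
  before the samples of computation \<open>k\<close> of round \<open>t\<close> are drawn. Both \<open>G\<close> and \<open>B\<close> may be randomised
  and may depend on the whole past; \<open>B t k\<close> may also depend on the samples \<open>\<xi> t k\<close> of all workers.

  The level \<open>J t\<close> is random only to the server: a worker asked for its \<open>k\<close>-th gradient learns nothing
  about \<open>J t\<close> beyond \<open>k \<le> 2 ^ J t\<close>. This is expressed by letting \<open>\<xi>\<close>, \<open>G\<close>, \<open>B\<close> be defined for all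
  \<open>k \<ge> 1\<close>, although the algorithm reads only \<open>k \<le> 2 ^ J t\<close>, and by taking \<open>J t\<close> independent of
  every \<open>H t k\<close>; from round \<open>t + 1\<close> on, \<open>J t\<close> is public.
\<close>

locale dynamic_workers = prob_space M
  for M :: "'w measure" +
  fixes D :: "'x measure"
    and \<delta> :: real
    and T :: nat
    and H :: "nat \<Rightarrow> nat \<Rightarrow> 'w measure"
    and J :: "nat \<Rightarrow> 'w \<Rightarrow> nat"
    and \<xi> :: "nat \<Rightarrow> nat \<Rightarrow> 'm::finite \<Rightarrow> 'w \<Rightarrow> 'x"
    and G :: "nat \<Rightarrow> nat \<Rightarrow> 'w \<Rightarrow> 'm set"
    and B :: "nat \<Rightarrow> nat \<Rightarrow> 'm \<Rightarrow> 'w \<Rightarrow> 'a::euclidean_space"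
  assumes info_sub: "\<lbrakk>1 \<le> t; 1 \<le> k\<rbrakk> \<Longrightarrow> subalgebra M (H t k)"
    and info_step: "\<lbrakk>1 \<le> t; 1 \<le> k\<rbrakk> \<Longrightarrow> sets (H t k) \<subseteq> sets (H t (Suc k))"
    and info_round: "\<lbrakk>1 \<le> t; 1 \<le> k\<rbrakk> \<Longrightarrow> sets (H t k) \<subseteq> sets (H (Suc t) 1)"
    and level_known: "t \<in> {1..T} \<Longrightarrow> J t \<in> measurable (H (Suc t) 1) (count_space UNIV)"
    and honest_known:
      "\<lbrakk>t \<in> {1..T}; 1 \<le> k\<rbrakk> \<Longrightarrow> G t k \<in> measurable (H t k) (count_space UNIV)"
    and sample_known: "\<lbrakk>t \<in> {1..T}; 1 \<le> k\<rbrakk> \<Longrightarrow> \<xi> t k i \<in> measurable (H t (Suc k)) D"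
    and byzantine_known:
      "\<lbrakk>t \<in> {1..T}; 1 \<le> k\<rbrakk> \<Longrightarrow> B t k i \<in> borel_measurable (H t (Suc k))"
    and sample_distr:
      "\<lbrakk>t \<in> {1..T}; 1 \<le> k\<rbrakk> \<Longrightarrow>
         distr M (Pi\<^sub>M UNIV (\<lambda>_. D)) (\<lambda>\<omega> i. \<xi> t k i \<omega>) = Pi\<^sub>M UNIV (\<lambda>_. D)"
    and sample_fresh:
      "\<lbrakk>t \<in> {1..T}; 1 \<le> k\<rbrakk> \<Longrightarrow>
         indep_set (sets (H t k))
           (sets (vimage_algebra (space M) (\<lambda>\<omega> i. \<xi> t k i \<omega>) (Pi\<^sub>M UNIV (\<lambda>_. D))))"
    and level_distr:
      "\<lbrakk>t \<in> {1..T}; 1 \<le> j\<rbrakk> \<Longrightarrow> prob {\<omega> \<in> space M. J t \<omega> = j} = 1 / 2 ^ j"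
    and level_fresh:
      "\<lbrakk>t \<in> {1..T}; 1 \<le> k\<rbrakk> \<Longrightarrow> indep_set (sets (H t k)) (sets (vimage_algebra (space M) (J t) (count_space UNIV)))"
    and honest_card:
      "\<lbrakk>t \<in> {1..T}; \<omega> \<in> space M; k \<in> {1..2 ^ J t \<omega>}\<rbrakk> \<Longrightarrow>
         real (card (G t k \<omega>)) = (1 - \<delta>) * real CARD('m)"

text \<open>Since \<open>J t\<close> is random, so are the sets of static and dynamic rounds.\<close>

definition static_rounds ::
  "nat \<Rightarrow> (nat \<Rightarrow> 'w \<Rightarrow> nat) \<Rightarrow> (nat \<Rightarrow> nat \<Rightarrow> 'w \<Rightarrow> 'm set) \<Rightarrow> 'w \<Rightarrow> nat set" where
  "static_rounds T J G \<omega> = {t \<in> {1..T}. \<forall>k \<in> {1..2 ^ J t \<omega>}. G t k \<omega> = G t 1 \<omega>}"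

definition dynamic_rounds ::
  "nat \<Rightarrow> (nat \<Rightarrow> 'w \<Rightarrow> nat) \<Rightarrow> (nat \<Rightarrow> nat \<Rightarrow> 'w \<Rightarrow> 'm set) \<Rightarrow> 'w \<Rightarrow> nat set" where
  "dynamic_rounds T J G \<omega> = {1..T} - static_rounds T J G \<omega>"

definition sent_vector ::
  "('a \<Rightarrow> 'x \<Rightarrow> 'a) \<Rightarrow> 'a::euclidean_space \<Rightarrow> (nat \<Rightarrow> 'm \<Rightarrow> 'x) \<Rightarrow> (nat \<Rightarrow> 'm set) \<Rightarrow> (nat \<Rightarrow> 'm \<Rightarrow> 'a)
     \<Rightarrow> nat \<Rightarrow> 'm \<Rightarrow> 'a" where
  "sent_vector gF x \<xi> G B k i = (if i \<in> G k then gF x (\<xi> k i) else B k i)"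

text \<open>
  The iterates \<open>x t\<close> of the algorithm; the projection is absent because the domain is the whole space.
\<close>

locale dynamic_run = dynamic_workers M D \<delta> T H J \<xi> G B
  for M :: "'w measure" and D :: "'x measure" and \<delta> :: real and T :: nat
    and H :: "nat \<Rightarrow> nat \<Rightarrow> 'w measure"
    and J :: "nat \<Rightarrow> 'w \<Rightarrow> nat"
    and \<xi> :: "nat \<Rightarrow> nat \<Rightarrow> 'm::finite \<Rightarrow> 'w \<Rightarrow> 'x"
    and G :: "nat \<Rightarrow> nat \<Rightarrow> 'w \<Rightarrow> 'm set"
    and B :: "nat \<Rightarrow> nat \<Rightarrow> 'm \<Rightarrow> 'w \<Rightarrow> 'a::euclidean_space" +
  fixes gF :: "'a \<Rightarrow> 'x \<Rightarrow> 'a"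
    and A :: "'a ^ 'm \<Rightarrow> 'a"
    and V :: real
    and \<gamma> :: real
    and \<eta> :: real
    and x1 :: 'a
    and x :: "nat \<Rightarrow> 'w \<Rightarrow> 'a"
  assumes start: "\<omega> \<in> space M \<Longrightarrow> x 1 \<omega> = x1"
    and update:
      "\<lbrakk>t \<in> {1..T}; \<omega> \<in> space M\<rbrakk> \<Longrightarrow>
         x (Suc t) \<omega> = x t \<omega> - \<eta> *\<^sub>R
           mlmc_estimate A V \<gamma> T (J t \<omega>)
             (sent_vector gF (x t \<omega>) (\<lambda>k i. \<xi> t k i \<omega>) (\<lambda>k. G t k \<omega>) (\<lambda>k i. B t k i \<omega>))"

text \<open>
  The factor hidden by \<open>\<O>~\<close>: a numerical constant times a power of \<open>log (m T)\<close>. Its values are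
  explicit because constants quantified inside a statement could depend on the types \<open>'a\<close> and \<open>'m\<close>,
  that is, on \<open>d\<close> and \<open>m\<close>.
\<close>

definition hidden_factor :: "nat \<Rightarrow> nat \<Rightarrow> real" where
  "hidden_factor m T = 10 ^ 5 * (log 2 (real m * real T))\<^sup>2"

text \<open>
  A remainder \<open>r\<close> of lower order in \<open>T\<close> than the rate. If \<open>V > 0\<close> it has to vanish for large \<open>T\<close>;
  if \<open>V = 0\<close> the stated rate is 0 and only terms of lower order than \<open>1 / \<surd>T\<close> are left.
\<close>

definition lower_order :: "real \<Rightarrow> (nat \<Rightarrow> real) \<Rightarrow> bool" where
  "lower_order V r \<longleftrightarrow> r \<in> o(\<lambda>T. 1 / sqrt (real T)) \<and>
     (0 < V \<longrightarrow> (\<forall>\<^sub>F T in sequentially. r T = 0))"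

definition mean_sq_gradient ::
  "'w measure \<Rightarrow> ('a::euclidean_space \<Rightarrow> 'a) \<Rightarrow> nat \<Rightarrow> (nat \<Rightarrow> 'w \<Rightarrow> 'a) \<Rightarrow> real" where
  "mean_sq_gradient M gf T x =
     1 / real T * (\<Sum>t = 1..T. (\<integral>\<omega>. (norm (gf (x t \<omega>)))\<^sup>2 \<partial>M))"

definition expected_dynamic ::
  "'w measure \<Rightarrow> nat \<Rightarrow> (nat \<Rightarrow> 'w \<Rightarrow> nat) \<Rightarrow> (nat \<Rightarrow> nat \<Rightarrow> 'w \<Rightarrow> 'm set) \<Rightarrow> real" where
  "expected_dynamic M T J G = (\<integral>\<omega>. real (card (dynamic_rounds T J G \<omega>)) \<partial>M)"

end

theory Submission
  imports Defs "HOL-Real_Asymp.Real_Asymp"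
begin

text \<open>
  Since the level \<open>J t\<close> is independent of everything else in round \<open>t\<close>, the estimate \<open>g\<^sub>t\<close> has
  the same mean as \<open>b = a\<^sub>0 + \<Sum>\<^sub>j (a\<^sub>j - a\<^sub>j\<^sub>-\<^sub>1) 1[filter passes]\<close>, where \<open>a\<^sub>j\<close> aggregates
  means of \<open>2\<^sup>j\<close> gradients. Vector concentration (Hoeffding's lemma in the directions of a finite net
  of the sphere) shows that, outside an event of probability about \<open>T\<^sup>-\<^sup>3\<^sup>/\<^sup>4\<close>, as long as the honest set
  stays constant up to level \<open>j\<close> we have \<open>\<parallel>a\<^sub>j - \<nabla>f\<parallel> \<le> s 2\<^sup>-\<^sup>j\<^sup>/\<^sup>2\<close> with \<open>s = \<surd>\<gamma> C V\<close>; then the filter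
  passes and the sum telescopes. If \<open>N\<close> is the first level at which the honest set has changed, the
  filter bounds all later terms by a geometric series, so \<open>\<parallel>b - \<nabla>f\<parallel>\<^sup>2 = O(s\<^sup>2 2\<^sup>-\<^sup>N)\<close>. As the
  round is dynamic exactly if \<open>J t \<ge> N\<close>, which has probability of order \<open>2\<^sup>-\<^sup>N\<close>, the squared bias
  is of order \<open>s\<^sup>2 (P(t \<in> \<tau>\<^sub>d) + 1/T)\<close> even for adaptive adversaries. The filter also bounds the second
  moment of the corrections by \<open>s\<^sup>2 log T\<close>, and the descent lemma for smooth functions yields the
  rate. The dependence of the net on the dimension only affects how large \<open>T\<close> has to be.
\<close>

subsection \<open>Independence, nets and smooth functions\<close>

text \<open>The numbers come from the budget of the bad event. On it only a bound polylogarithmic in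
  \<open>T\<close> is available for the squared bias, so its probability has to be o(T^(-1/2)). In a
  fixed direction the value of C yields the exponent \<open>log 2 (16 * m^2 * T)\<close>; the net
  costs a factor (3/4)^2 = 9/16, and after conversion to natural logarithms at most T^(-3/4) is
  left, up to the size of the union bound. Quantities are attached to fixed levels \<open>j\<close>,
  never to \<open>J t\<close>: what level \<open>j\<close> reads is known at
  \<open>H t (Suc (2 ^ j))\<close>, and the level is independent of the information at each such
  fixed time. Only \<open>level_sum_expectation\<close> puts \<open>J t\<close> back.
  \<open>hidden_factor\<close> may depend neither on the dimension nor on \<kappa>,
  \<open>L\<close>, \<Delta>. Such constants are absorbed by a spare power of
  \<open>log 2 T\<close>, which is why the bounds hold for large \<open>T\<close> only. Two cases
  need their own argument: for \<open>V = 0\<close> the step size stays \<open>1 / L\<close>, and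
  for \<Delta> = 0 it is 0.\<close>

text \<open>A net point \<open>u\<close> within 1/4 of w = v / |v| satisfies u . w = 1 - (w - u) . w
  \<ge> 3/4. A norm bound is thus reduced to scalar tails in finitely many directions, whose number
  depends on the space alone.\<close>

lemma finite_sphere_net:
  "\<exists>N. finite N \<and> N \<subseteq> sphere 0 1 \<and> (\<forall>v::'a::euclidean_space. \<exists>u\<in>N. 3 / 4 * norm v \<le> u \<bullet> v)"
proof -
  have "\<exists>N. finite N \<and> N \<subseteq> sphere 0 1 \<and> sphere (0::'a) 1 \<subseteq> (\<Union>u\<in>N. ball u (1/4))"
    using seq_compact_imp_totally_bounded[of "sphere (0::'a) 1"] compact_imp_seq_compact[of "sphere (0::'a) 1"]
    by (auto dest!: spec[of _ "1/4"])
  then obtain N where N: "finite N" "N \<subseteq> sphere (0::'a) 1" "sphere (0::'a) 1 \<subseteq> (\<Union>u\<in>N. ball u (1/4))"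
    by blast
  have unit: "\<exists>u\<in>N. 3 / 4 \<le> u \<bullet> w" if "norm w = 1" for w :: 'a
  proof -
    have "w \<in> sphere 0 1" using that by simp
    then have "w \<in> (\<Union>u\<in>N. ball u (1/4))" by (rule subsetD[OF N(3)])
    then obtain u where u: "u \<in> N" "dist u w < 1 / 4" by auto
    have "(w - u) \<bullet> w \<le> norm (w - u) * norm w" by (rule norm_cauchy_schwarz)
    then have "w \<bullet> w - u \<bullet> w \<le> 1 / 4"
      using u that by (simp add: inner_diff_left dist_norm norm_minus_commute)
    moreover have "w \<bullet> w = 1" using that by (simp add: norm_eq_1)
    ultimately show ?thesis using u(1) by (intro bexI[of _ u]) auto
  qed
  have "\<exists>u\<in>N. 3 / 4 * norm v \<le> u \<bullet> v" for v :: 'a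
  proof (cases "v = 0")
    case True
    \<comment> \<open>For \<open>v = 0\<close> any net point serves; the unit vector only shows that
      the net is nonempty.\<close>
    obtain w :: 'a where "norm w = 1" using vector_choose_size[of 1] by auto
    with unit[of w] True show ?thesis by auto
  next
    case False
    with unit[of "v /\<^sub>R norm v"] obtain u where "u \<in> N" "3 / 4 \<le> u \<bullet> (v /\<^sub>R norm v)" by auto
    with False show ?thesis by (intro bexI[of _ u]) (auto simp: field_simps)
  qed
  with N show ?thesis by blast
qed

context prob_space
begin

lemma distr_pair_subalgebra:
  assumes F: "subalgebra M F" and X: "X \<in> measurable F K" and Y: "Y \<in> measurable M N"
    and ind: "indep_set (sets F) (sets (vimage_algebra (space M) Y N))"
  shows "distr M K X \<Otimes>\<^sub>M distr M N Y = distr M (K \<Otimes>\<^sub>M N) (\<lambda>\<omega>. (X \<omega>, Y \<omega>))"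
proof (rule pair_measure_eqI)
  have X'[measurable]: "X \<in> measurable M K" by (rule measurable_from_subalg[OF F X])
  note Y[measurable]
  interpret X: prob_space "distr M K X" by (rule prob_space_distr[OF X'])
  interpret Y: prob_space "distr M N Y" by (rule prob_space_distr[OF Y])
  show "sigma_finite_measure (distr M K X)" "sigma_finite_measure (distr M N Y)"
    by unfold_locales
  show "sets (distr M K X \<Otimes>\<^sub>M distr M N Y) = sets (distr M (K \<Otimes>\<^sub>M N) (\<lambda>\<omega>. (X \<omega>, Y \<omega>)))"
    by (simp cong: sets_pair_measure_cong)
  fix A B assume "A \<in> sets (distr M K X)" "B \<in> sets (distr M N Y)"
  then have AB[measurable]: "A \<in> sets K" "B \<in> sets N" by auto
  have "X -` A \<inter> space M \<in> sets F"
    using measurable_sets[OF X AB(1)] F by (simp add: subalgebra_def)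
  moreover have "Y -` B \<inter> space M \<in> sets (vimage_algebra (space M) Y N)"
    using AB(2) Y by (subst sets_vimage_algebra2) (auto simp: measurable_def)
  ultimately have "prob ((X -` A \<inter> space M) \<inter> (Y -` B \<inter> space M)) =
      prob (X -` A \<inter> space M) * prob (Y -` B \<inter> space M)"
    by (rule indep_setD[OF ind])
  moreover have "(\<lambda>\<omega>. (X \<omega>, Y \<omega>)) -` (A \<times> B) \<inter> space M = (X -` A \<inter> space M) \<inter> (Y -` B \<inter> space M)"
    by auto
  ultimately show "emeasure (distr M K X) A * emeasure (distr M N Y) B =
      emeasure (distr M (K \<Otimes>\<^sub>M N) (\<lambda>\<omega>. (X \<omega>, Y \<omega>))) (A \<times> B)"
    by (simp add: emeasure_distr emeasure_eq_measure ennreal_mult'')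
qed

text \<open>Fubini in place of conditional expectations: the past \<open>X\<close> is held fixed
  while the fresh \<open>Y\<close> is integrated out. Independence is asked of the whole
  \<sigma>-algebra \<open>F\<close>, since an adaptive past has no fixed list of variables;
  nonnegative integrals spare all integrability questions.\<close>

lemma nn_integral_freeze:
  assumes F: "subalgebra M F" and X: "X \<in> measurable F K" and Y: "Y \<in> measurable M N"
    and ind: "indep_set (sets F) (sets (vimage_algebra (space M) Y N))"
    and h: "h \<in> borel_measurable (K \<Otimes>\<^sub>M N)"
  shows "(\<integral>\<^sup>+\<omega>. h (X \<omega>, Y \<omega>) \<partial>M) = (\<integral>\<^sup>+\<omega>. (\<integral>\<^sup>+y. h (X \<omega>, y) \<partial>distr M N Y) \<partial>M)"
proof -
  have X'[measurable]: "X \<in> measurable M K" by (rule measurable_from_subalg[OF F X])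
  note Y[measurable] h[measurable]
  interpret Y: prob_space "distr M N Y" by (rule prob_space_distr[OF Y])
  have h'[measurable]: "h \<in> borel_measurable (K \<Otimes>\<^sub>M distr M N Y)"
    using h by (simp cong: measurable_cong_sets)
  have "(\<integral>\<^sup>+\<omega>. h (X \<omega>, Y \<omega>) \<partial>M) = (\<integral>\<^sup>+p. h p \<partial>distr M (K \<Otimes>\<^sub>M N) (\<lambda>\<omega>. (X \<omega>, Y \<omega>)))"
    by (subst nn_integral_distr) auto
  also have "\<dots> = (\<integral>\<^sup>+p. h p \<partial>(distr M K X \<Otimes>\<^sub>M distr M N Y))"
    by (simp add: distr_pair_subalgebra[OF F X Y ind])
  also have "\<dots> = (\<integral>\<^sup>+z. (\<integral>\<^sup>+y. h (z, y) \<partial>distr M N Y) \<partial>distr M K X)"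
    by (rule Y.nn_integral_fst[symmetric]) (use h in \<open>simp cong: measurable_cong_sets\<close>)
  also have "\<dots> = (\<integral>\<^sup>+\<omega>. (\<integral>\<^sup>+y. h (X \<omega>, y) \<partial>distr M N Y) \<partial>M)"
    by (rule nn_integral_distr) (auto intro!: Y.borel_measurable_nn_integral_fst)
  finally show ?thesis .
qed

text \<open>The exceptional null set may vary with \<open>z\<close>, so uncountably many of them are
  involved; freezing the indicator of the failure set shows that they still have total mass
  0.\<close>

lemma AE_freeze:
  assumes F: "subalgebra M F" and X: "X \<in> measurable F K" and Y: "Y \<in> measurable M N"
    and ind: "indep_set (sets F) (sets (vimage_algebra (space M) Y N))"
    and P: "Measurable.pred (K \<Otimes>\<^sub>M N) P"
    and AE: "\<And>z. z \<in> space K \<Longrightarrow> AE y in distr M N Y. P (z, y)"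
  shows "AE \<omega> in M. P (X \<omega>, Y \<omega>)"
proof -
  have X'[measurable]: "X \<in> measurable M K" by (rule measurable_from_subalg[OF F X])
  note Y[measurable] P[measurable]
  have "(\<integral>\<^sup>+\<omega>. indicator {p\<in>space (K \<Otimes>\<^sub>M N). \<not> P p} (X \<omega>, Y \<omega>) \<partial>M) =
      (\<integral>\<^sup>+\<omega>. (\<integral>\<^sup>+y. indicator {p\<in>space (K \<Otimes>\<^sub>M N). \<not> P p} (X \<omega>, y) \<partial>distr M N Y) \<partial>M)"
    by (rule nn_integral_freeze[OF F X Y ind]) measurable
  also have "\<dots> = (\<integral>\<^sup>+\<omega>. 0 \<partial>M)"
  proof (rule nn_integral_cong)
    fix \<omega> assume "\<omega> \<in> space M"
    then have z: "X \<omega> \<in> space K" using X' by (auto simp: measurable_def)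
    have "(\<integral>\<^sup>+y. indicator {p\<in>space (K \<Otimes>\<^sub>M N). \<not> P p} (X \<omega>, y) \<partial>distr M N Y) =
        (\<integral>\<^sup>+y. 0 \<partial>distr M N Y)"
      using AE[OF z] by (intro nn_integral_cong_AE) (auto simp: indicator_def)
    then show "(\<integral>\<^sup>+y. indicator {p\<in>space (K \<Otimes>\<^sub>M N). \<not> P p} (X \<omega>, y) \<partial>distr M N Y) = 0" by simp
  qed
  finally have "AE \<omega> in M. indicator {p\<in>space (K \<Otimes>\<^sub>M N). \<not> P p} (X \<omega>, Y \<omega>) = (0::ennreal)"
    by (simp add: nn_integral_0_iff_AE)
  then show ?thesis
    using AE_space
  proof eventually_elim
    case (elim \<omega>)
    have "(X \<omega>, Y \<omega>) \<in> space (K \<Otimes>\<^sub>M N)"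
      using elim(2) X' Y by (auto simp: measurable_def space_pair_measure)
    with elim(1) show ?case by (auto simp: indicator_def split: if_splits)
  qed
qed

end

lemma borel_measurable_vec_lambda:
  fixes f :: "'m::finite \<Rightarrow> 'w \<Rightarrow> 'a::euclidean_space"
  assumes [measurable]: "\<And>i. f i \<in> borel_measurable M"
  shows "(\<lambda>\<omega>. \<chi> i. f i \<omega>) \<in> borel_measurable M"
  by (subst borel_measurable_euclidean_space) (auto simp: Basis_vec_def inner_axis)

text \<open>A gradient step of size \<open>1 / L\<close> lowers \<open>f\<close> by at least |gf
  x|^2 / (2L), and it cannot end below the infimum.\<close>

lemma smooth_gradient_bound:
  assumes "smooth L f gf" "L > 0" "bdd_below (range f)"
  shows "(norm (gf x))\<^sup>2 \<le> 2 * L * (f x - (INF y. f y))"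
proof -
  have "(INF y. f y) \<le> f (x - (1 / L) *\<^sub>R gf x)"
    using assms(3) by (intro cINF_lower) auto
  also have "\<dots> \<le> f x + gf x \<bullet> (- (1 / L) *\<^sub>R gf x) + L / 2 * (norm (- (1 / L) *\<^sub>R gf x))\<^sup>2"
    using assms(1) unfolding smooth_def by (metis (no_types, lifting) add_diff_cancel_left' scaleR_minus_left uminus_add_conv_diff add.commute)
  also have "\<dots> = f x - (norm (gf x))\<^sup>2 / (2 * L)"
    using assms(2) by (simp add: power_mult_distrib field_simps power2_norm_eq_inner) (simp add: power2_eq_square)
  finally show ?thesis using assms(2) by (simp add: field_simps)
qed

lemma smooth_continuous_on: "smooth L f gf \<Longrightarrow> continuous_on UNIV f"
  unfolding smooth_def gderiv_def
  by (auto intro!: continuous_at_imp_continuous_on has_derivative_continuous)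

text \<open>Polarisation with the term |v|^2 / 2 dropped.\<close>

lemma inner_decomposition:
  fixes u v :: "'a::real_inner"
  shows "(norm u)\<^sup>2 / 2 - (norm (v - u))\<^sup>2 / 2 \<le> u \<bullet> v"
proof -
  have "(norm (v - u))\<^sup>2 = (norm v)\<^sup>2 + (norm u)\<^sup>2 - 2 * (u \<bullet> v)"
    by (simp add: power2_norm_eq_inner inner_diff_left inner_diff_right inner_commute)
  then show ?thesis by (smt (verit) field_sum_of_halves zero_le_power2)
qed

text \<open>The mean minimises the sum of squared distances, so the spread around it in
  \<open>robust\<close> may be measured from \<open>z\<close> instead; the factors 2 come from (a +
  b)^2 \<le> 2 a^2 + 2 b^2. \<open>E\<close> and \<open>E'\<close> are kept apart because the mean
  concentrates better than a single vector by a factor of order m, whence the summand 1/m of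
  \<gamma>.\<close>

lemma robust_deviation:
  fixes g :: "'a::euclidean_space ^ 'm::finite"
  assumes rob: "robust \<delta> \<kappa> A" and card: "real (card S) = (1 - \<delta>) * real CARD('m)"
    and E: "\<And>i. i \<in> S \<Longrightarrow> (norm (g $ i - z))\<^sup>2 \<le> E"
    and E': "(norm (subset_mean g S - z))\<^sup>2 \<le> E'"
  shows "(norm (A g - z))\<^sup>2 \<le> 2 * \<kappa> * E + 2 * E'"
proof -
  define \<mu> where "\<mu> = subset_mean g S"
  have \<delta>: "\<delta> < 1 / 2" and \<kappa>: "0 \<le> \<kappa>" using rob by (auto simp: robust_def)
  then have S: "real (card S) > 0" unfolding card by simp
  have \<mu>: "(\<Sum>i\<in>S. g $ i) = real (card S) *\<^sub>R \<mu>"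
    using S by (simp add: \<mu>_def subset_mean_def)
  have "(\<Sum>i\<in>S. (norm (g $ i - z))\<^sup>2) =
      (\<Sum>i\<in>S. (norm (g $ i - \<mu>))\<^sup>2 + 2 * ((g $ i - \<mu>) \<bullet> (\<mu> - z)) + (norm (\<mu> - z))\<^sup>2)"
    by (intro sum.cong refl) (simp add: power2_norm_eq_inner algebra_simps inner_commute)
  also have "\<dots> = (\<Sum>i\<in>S. (norm (g $ i - \<mu>))\<^sup>2) + 2 * ((\<Sum>i\<in>S. g $ i - \<mu>) \<bullet> (\<mu> - z)) +
      real (card S) * (norm (\<mu> - z))\<^sup>2"
    by (simp add: sum.distrib sum_distrib_left inner_sum_left)
  also have "(\<Sum>i\<in>S. g $ i - \<mu>) = 0"
    by (simp only: sum_subtractf \<mu> sum_constant_scaleR diff_self)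
  finally have "(\<Sum>i\<in>S. (norm (g $ i - \<mu>))\<^sup>2) \<le> (\<Sum>i\<in>S. (norm (g $ i - z))\<^sup>2)" by simp
  also have "\<dots> \<le> real (card S) * E" by (rule sum_bounded_above) (rule E)
  finally have "\<kappa> / real (card S) * (\<Sum>i\<in>S. (norm (g $ i - \<mu>))\<^sup>2) \<le> \<kappa> / real (card S) * (real (card S) * E)"
    using \<kappa> by (intro mult_left_mono) auto
  then have A: "(norm (A g - \<mu>))\<^sup>2 \<le> \<kappa> * E"
  proof -
    have "(norm (A g - \<mu>))\<^sup>2 \<le> \<kappa> / real (card S) * (\<Sum>i\<in>S. (norm (g $ i - \<mu>))\<^sup>2)"
      using rob card unfolding robust_def \<mu>_def by blast
    also have "\<dots> \<le> \<kappa> / real (card S) * (real (card S) * E)" by fact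
    also have "\<dots> = \<kappa> * E" using S by auto
    finally show ?thesis .
  qed
  have "(norm (A g - z))\<^sup>2 \<le> (norm (A g - \<mu>) + norm (\<mu> - z))\<^sup>2"
    using norm_triangle_ineq[of "A g - \<mu>" "\<mu> - z"] by (intro power_mono) auto
  also have "\<dots> \<le> 2 * (norm (A g - \<mu>))\<^sup>2 + 2 * (norm (\<mu> - z))\<^sup>2"
    using sum_squares_bound[of "norm (A g - \<mu>)" "norm (\<mu> - z)"] by (simp add: power2_sum)
  finally show ?thesis using A E' by (simp add: \<mu>_def)
qed

subsection \<open>Runs of the algorithm\<close>

locale robust_run = dynamic_run M D \<delta> T H J \<xi> G B gF A V \<gamma> \<eta> x1 x
  for M :: "'w measure" and D :: "'x measure" and \<delta> :: real and T :: nat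
    and H :: "nat \<Rightarrow> nat \<Rightarrow> 'w measure"
    and J :: "nat \<Rightarrow> 'w \<Rightarrow> nat"
    and \<xi> :: "nat \<Rightarrow> nat \<Rightarrow> 'm::finite \<Rightarrow> 'w \<Rightarrow> 'x"
    and G :: "nat \<Rightarrow> nat \<Rightarrow> 'w \<Rightarrow> 'm set"
    and B :: "nat \<Rightarrow> nat \<Rightarrow> 'm \<Rightarrow> 'w \<Rightarrow> 'a::euclidean_space"
    and gF :: "'a \<Rightarrow> 'x \<Rightarrow> 'a"
    and A :: "'a ^ 'm \<Rightarrow> 'a"
    and V :: real
    and \<gamma> :: real
    and \<eta> :: real
    and x1 :: 'a
    and x :: "nat \<Rightarrow> 'w \<Rightarrow> 'a" +
  fixes f :: "'a \<Rightarrow> real"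
    and gf :: "'a \<Rightarrow> 'a"
    and L \<kappa> :: real
  assumes prob_D: "prob_space D"
    and gF_measurable: "(\<lambda>(x, s). gF x s) \<in> borel_measurable (borel \<Otimes>\<^sub>M D)"
    and gF_mean: "\<And>x. (\<integral>s. gF x s \<partial>D) = gf x"
    and L_pos: "L > 0"
    and smooth_f: "smooth L f gf"
    and bdd_f: "bdd_below (range f)"
    and gF_bound: "\<And>x. AE s in D. norm (gF x s - gf x) \<le> V"
    and robust_A: "robust \<delta> \<kappa> A"
    and A_measurable[measurable]: "A \<in> borel_measurable borel"
    and gamma_eq: "\<gamma> = 2 * \<kappa> + 1 / real CARD('m)"
begin

sublocale D: prob_space D by (rule prob_D)

lemma gF_measurable_comp [measurable (raw)]:
  assumes "g \<in> borel_measurable N" "h \<in> measurable N D"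
  shows "(\<lambda>\<omega>. gF (g \<omega>) (h \<omega>)) \<in> borel_measurable N"
  using measurable_compose[OF measurable_Pair[OF assms] gF_measurable] by simp

lemma gf_measurable [measurable]: "gf \<in> borel_measurable borel"
proof -
  have "(\<lambda>x. \<integral>s. gF x s \<partial>D) \<in> borel_measurable borel"
    by (rule D.borel_measurable_lebesgue_integral) (rule gF_measurable)
  then show ?thesis by (simp add: gF_mean)
qed

lemma f_measurable [measurable]: "f \<in> borel_measurable borel"
  by (rule borel_measurable_continuous_onI) (rule smooth_continuous_on[OF smooth_f])

lemma V_nonneg: "0 \<le> V"
proof -
  have "AE s in D. 0 \<le> V"
    using gF_bound[of 0] by eventually_elim (auto intro: order_trans[OF norm_ge_zero])
  then show ?thesis by simp
qed

lemma kappa_nonneg: "0 \<le> \<kappa>"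
  using robust_A by (simp add: robust_def)

lemma gamma_pos: "0 < \<gamma>"
  using kappa_nonneg by (simp add: gamma_eq add_nonneg_pos)

lemma delta_lt: "\<delta> < 1 / 2"
  using robust_A by (simp add: robust_def)

section \<open>Adaptedness of the iterates, aggregates and corrections\<close>

lemma info_mono:
  assumes "1 \<le> t" "1 \<le> k" "k \<le> k'"
  shows "sets (H t k) \<subseteq> sets (H t k')"
  using assms(3,1,2)
proof (induction k' rule: dec_induct)
  case (step n)
  then show ?case using info_step[of t n] by auto
qed auto

lemma info_space: "1 \<le> t \<Longrightarrow> 1 \<le> k \<Longrightarrow> space (H t k) = space M"
  using info_sub by (auto simp: subalgebra_def)

lemma measurable_later:
  assumes "g \<in> measurable (H t k) N" "1 \<le> t" "1 \<le> k" "k \<le> k'"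
  shows "g \<in> measurable (H t k') N"
  using assms info_mono[of t k k'] info_space[of t k] info_space[of t k']
  by (auto simp: measurable_def)

lemma measurable_next_round:
  assumes "g \<in> measurable (H t k) N" "1 \<le> t" "1 \<le> k"
  shows "g \<in> measurable (H (Suc t) 1) N"
  using assms info_round[of t k] info_space[of t k] info_space[of "Suc t" 1]
  by (auto simp: measurable_def)

lemma measurable_info:
  assumes "g \<in> measurable (H t k) N" "1 \<le> t" "1 \<le> k"
  shows "g \<in> measurable M N"
  using assms(1) by (rule measurable_from_subalg[OF info_sub[OF assms(2,3)]])

text \<open>Defined for every worker, Byzantine or not, as all of them have samples. Its law
  therefore does not depend on which workers turn out to be honest.\<close>

definition noise :: "nat \<Rightarrow> nat \<Rightarrow> 'm \<Rightarrow> 'w \<Rightarrow> 'a" where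
  "noise t k i \<omega> = gF (x t \<omega>) (\<xi> t k i \<omega>) - gf (x t \<omega>)"

definition sent :: "nat \<Rightarrow> 'w \<Rightarrow> nat \<Rightarrow> 'm \<Rightarrow> 'a" where
  "sent t \<omega> = sent_vector gF (x t \<omega>) (\<lambda>k i. \<xi> t k i \<omega>) (\<lambda>k. G t k \<omega>) (\<lambda>k i. B t k i \<omega>)"

definition agg :: "nat \<Rightarrow> nat \<Rightarrow> 'w \<Rightarrow> 'a" where
  "agg t j \<omega> = level_aggregate A (sent t \<omega>) j"

text \<open>The \<open>s\<close> of the overview; the filter of level \<open>j\<close> accepts
  differences up to \<open>(1 + sqrt 2) * dev / sqrt (2 ^ j)\<close>.\<close>

definition dev :: real where
  "dev = sqrt \<gamma> * Cconst CARD('m) T * V"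

definition jmax :: nat where
  "jmax = nat \<lfloor>log 2 (real T)\<rfloor>"

text \<open>
  For \<open>j = 0\<close> the truncated \<open>j - 1\<close> makes the correction vanish, so the event \<open>J t = 0\<close>, which the
  assumptions do not exclude pointwise, needs no special treatment.
\<close>

definition corr :: "nat \<Rightarrow> nat \<Rightarrow> 'w \<Rightarrow> 'a" where
  "corr t j \<omega> =
     (if j \<le> jmax \<and> norm (agg t j \<omega> - agg t (j - 1) \<omega>) \<le> (1 + sqrt 2) * dev / sqrt (2 ^ j)
      then 2 ^ j *\<^sub>R (agg t j \<omega> - agg t (j - 1) \<omega>) else 0)"

lemma corr_0 [simp]: "corr t 0 \<omega> = 0"
  by (simp add: corr_def)

lemma update_corr:
  assumes "t \<in> {1..T}" "\<omega> \<in> space M"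
  shows "x (Suc t) \<omega> = x t \<omega> - \<eta> *\<^sub>R (agg t 0 \<omega> + corr t (J t \<omega>) \<omega>)"
proof -
  \<comment> \<open>Since \<open>T\<close> is at least 1, \<open>nat\<close> loses nothing in
    \<open>jmax\<close>.\<close>
  have "0 \<le> \<lfloor>log 2 (real T)\<rfloor>" using assms(1) by auto
  then have "int j \<le> \<lfloor>log 2 (real T)\<rfloor> \<longleftrightarrow> j \<le> jmax" for j
    unfolding jmax_def by linarith
  then show ?thesis
    unfolding update[OF assms] mlmc_estimate_def Let_def corr_def agg_def sent_def dev_def
    by (simp add: mult.assoc)
qed

lemma sent_measurable:
  assumes "t \<in> {1..T}" "1 \<le> k" and x: "x t \<in> borel_measurable (H t 1)"
  shows "(\<lambda>\<omega>. sent t \<omega> k i) \<in> borel_measurable (H t (Suc k))"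
proof -
  have [measurable]: "x t \<in> borel_measurable (H t (Suc k))"
    "G t k \<in> measurable (H t (Suc k)) (count_space UNIV)"
    "\<xi> t k i \<in> measurable (H t (Suc k)) D" "B t k i \<in> borel_measurable (H t (Suc k))"
    using measurable_later[OF x] measurable_later[OF honest_known[OF assms(1,2)], of "Suc k"]
      sample_known byzantine_known assms by auto
  show ?thesis unfolding sent_def sent_vector_def by measurable
qed

text \<open>Level \<open>j\<close> reads the first \<open>2 ^ j\<close> computations, whatever the
  value of \<open>J t\<close>. This time index is where \<open>level_fresh\<close> is applied
  later.\<close>

lemma agg_measurable:
  assumes "t \<in> {1..T}" and x: "x t \<in> borel_measurable (H t 1)"
  shows "agg t j \<in> borel_measurable (H t (Suc (2 ^ j)))"
proof -
  have [measurable]: "(\<lambda>\<omega>. sent t \<omega> k i) \<in> borel_measurable (H t (Suc (2 ^ j)))"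
    if "k \<in> {1..2 ^ j}" for k i
    using sent_measurable[OF assms(1) _ x, of k i] that assms(1)
    by (auto intro: measurable_later)
  show ?thesis unfolding agg_def level_aggregate_def
    by (intro measurable_compose[OF _ A_measurable] borel_measurable_vec_lambda) measurable
qed

lemma corr_measurable:
  assumes "t \<in> {1..T}" and x: "x t \<in> borel_measurable (H t 1)"
  shows "corr t j \<in> borel_measurable (H t (Suc (2 ^ j)))"
proof -
  have [measurable]: "agg t j \<in> borel_measurable (H t (Suc (2 ^ j)))"
    "agg t (j - 1) \<in> borel_measurable (H t (Suc (2 ^ j)))"
    using agg_measurable[OF assms] measurable_later[OF agg_measurable[OF assms, of "j - 1"]] assms(1)
    by (auto simp: power_increasing)
  show ?thesis unfolding corr_def by measurable
qed

lemma x_measurable: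
  assumes "1 \<le> t" "t \<le> Suc T"
  shows "x t \<in> borel_measurable (H t 1)"
  using assms
proof (induction t rule: dec_induct)
  case base
  show ?case
    by (rule measurable_cong[THEN iffD2, of _ _ "\<lambda>_. x1"]) (use start in \<open>auto simp: info_space\<close>)
next
  case (step t)
  then have t: "t \<in> {1..T}" and x: "x t \<in> borel_measurable (H t 1)" by auto
  have [measurable]: "x t \<in> borel_measurable (H (Suc t) 1)" "agg t 0 \<in> borel_measurable (H (Suc t) 1)"
    "\<And>j. corr t j \<in> borel_measurable (H (Suc t) 1)" "J t \<in> measurable (H (Suc t) 1) (count_space UNIV)"
    using measurable_next_round[OF x] measurable_next_round[OF agg_measurable[OF t x]]
      measurable_next_round[OF corr_measurable[OF t x]] t level_known by auto
  have "(\<lambda>\<omega>. x t \<omega> - \<eta> *\<^sub>R (agg t 0 \<omega> + corr t (J t \<omega>) \<omega>)) \<in> borel_measurable (H (Suc t) 1)"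
    by measurable
  moreover have "x (Suc t) \<in> borel_measurable (H (Suc t) 1) \<longleftrightarrow>
      (\<lambda>\<omega>. x t \<omega> - \<eta> *\<^sub>R (agg t 0 \<omega> + corr t (J t \<omega>) \<omega>)) \<in> borel_measurable (H (Suc t) 1)"
    by (rule measurable_cong) (simp add: update_corr[OF t] info_space)
  ultimately show ?case by simp
qed

lemma x_measurable_M [measurable]: "t \<in> {1..Suc T} \<Longrightarrow> x t \<in> borel_measurable M"
  using x_measurable[of t] by (auto intro: measurable_info)

lemma agg_measurable_M [measurable]: "t \<in> {1..T} \<Longrightarrow> agg t j \<in> borel_measurable M"
  using x_measurable[of t] agg_measurable[of t j] by (auto intro!: measurable_info)

lemma corr_measurable_M [measurable]: "t \<in> {1..T} \<Longrightarrow> corr t j \<in> borel_measurable M"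
  using x_measurable[of t] corr_measurable[of t j] by (auto intro!: measurable_info)

lemma J_measurable [measurable]: "t \<in> {1..T} \<Longrightarrow> J t \<in> measurable M (count_space UNIV)"
  by (rule measurable_info[OF level_known]) auto

lemma noise_measurable:
  assumes "t \<in> {1..T}" "1 \<le> k"
  shows "noise t k i \<in> borel_measurable (H t (Suc k))"
proof -
  have [measurable]: "x t \<in> borel_measurable (H t (Suc k))" "\<xi> t k i \<in> measurable (H t (Suc k)) D"
    using measurable_later[OF x_measurable[of t], of "Suc k"] sample_known[of t k i] assms by auto
  show ?thesis unfolding noise_def by measurable
qed

lemma noise_measurable_M [measurable]: "t \<in> {1..T} \<Longrightarrow> 1 \<le> k \<Longrightarrow> noise t k i \<in> borel_measurable M"
  using noise_measurable[of t k i] by (auto intro!: measurable_info)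

lemma samples_measurable:
  assumes "t \<in> {1..T}" "1 \<le> k"
  shows "(\<lambda>\<omega> i. \<xi> t k i \<omega>) \<in> measurable M (Pi\<^sub>M UNIV (\<lambda>_. D))"
proof (rule measurable_PiM_single')
  have \<xi>: "\<xi> t k i \<in> measurable M D" for i
    by (rule measurable_info[OF sample_known[OF assms]]) (use assms in auto)
  then show "\<xi> t k i \<in> measurable M D" for i .
  show "(\<lambda>\<omega> i. \<xi> t k i \<omega>) \<in> space M \<rightarrow> (\<Pi>\<^sub>E i\<in>UNIV. space D)"
    using measurable_space[OF \<xi>] by auto
qed

section \<open>Boundedness and exponential moments of the noise\<close>

text \<open>The hypothesis holds almost surely for each fixed point, but the iterate is random;
  freezing it is legitimate because the samples of computation \<open>k\<close> are fresh.\<close>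

lemma noise_bound:
  assumes "t \<in> {1..T}" "1 \<le> k"
  shows "AE \<omega> in M. \<forall>i. norm (noise t k i \<omega>) \<le> V"
proof -
  have "AE \<omega> in M. (\<lambda>(z, y). \<forall>i. norm (gF z (y i) - gf z) \<le> V) (x t \<omega>, (\<lambda>i. \<xi> t k i \<omega>))"
  proof (rule AE_freeze[OF info_sub _ samples_measurable[OF assms] sample_fresh[OF assms]])
    show "x t \<in> measurable (H t k) borel"
      using measurable_later[OF x_measurable[of t], of k] assms by auto
    show "Measurable.pred (borel \<Otimes>\<^sub>M Pi\<^sub>M UNIV (\<lambda>_. D)) (\<lambda>(z, y). \<forall>i::'m. norm (gF z (y i) - gf z) \<le> V)"
    proof -
      have [measurable]: "(\<lambda>p. snd p i) \<in> measurable (borel \<Otimes>\<^sub>M Pi\<^sub>M UNIV (\<lambda>_. D)) D" for i :: 'm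
        by (rule measurable_compose[OF measurable_snd measurable_component_singleton]) simp
      have [measurable]: "(\<lambda>p. gF (fst p) (snd p i)) \<in> borel_measurable (borel \<Otimes>\<^sub>M Pi\<^sub>M UNIV (\<lambda>_. D))" for i :: 'm
        by (rule gF_measurable_comp) measurable
      have "Measurable.pred (borel \<Otimes>\<^sub>M Pi\<^sub>M UNIV (\<lambda>_. D))
          (\<lambda>p. \<forall>i\<in>(UNIV::'m set). norm (gF (fst p) (snd p i) - gf (fst p)) \<le> V)"
        by (rule pred_intros_finite(3)) auto
      then show ?thesis by (simp add: split_beta)
    qed
    fix z :: 'a
    have "AE y in Pi\<^sub>M UNIV (\<lambda>_::'m. D). \<forall>i\<in>UNIV. norm (gF z (y i) - gf z) \<le> V"
      by (intro AE_finite_allI AE_PiM_component[where M = "\<lambda>_. D", OF _ _ gF_bound] prob_D) auto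
    then show "AE y in distr M (Pi\<^sub>M UNIV (\<lambda>_. D)) (\<lambda>\<omega> i. \<xi> t k i \<omega>).
        case (z, y) of (z, y) \<Rightarrow> \<forall>i. norm (gF z (y i) - gf z) \<le> V"
      unfolding sample_distr[OF assms] by simp
  qed (use assms in auto)
  then show ?thesis by (simp add: noise_def)
qed

text \<open>Hoeffding's lemma for a centred variable in an interval of length 2V: the exponent is
  l^2 (2V)^2 / 8.\<close>

lemma sample_mgf:
  assumes "norm w = 1" "l > 0"
  shows "(\<integral>\<^sup>+s. ennreal (exp (l * (w \<bullet> (gF z s - gf z)))) \<partial>D) \<le> ennreal (exp (l\<^sup>2 * V\<^sup>2 / 2))"
proof -
  have [measurable]: "gF z \<in> borel_measurable D" by measurable
  interpret I: interval_bounded_random_variable D "\<lambda>s. w \<bullet> (gF z s - gf z)" "- V" V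
  proof
    show "AE s in D. w \<bullet> (gF z s - gf z) \<in> {- V..V}"
      using gF_bound[of z]
    proof eventually_elim
      case (elim s)
      have "\<bar>w \<bullet> (gF z s - gf z)\<bar> \<le> norm w * norm (gF z s - gf z)" by (rule Cauchy_Schwarz_ineq2)
      with elim assms(1) show ?case by auto
    qed
  qed measurable
  have int: "integrable D (gF z)"
  proof (rule D.integrable_const_bound[of _ "V + norm (gf z)"])
    show "AE s in D. norm (gF z s) \<le> V + norm (gf z)"
      using gF_bound[of z] by eventually_elim (smt (verit) norm_triangle_sub)
  qed measurable
  have "(\<integral>s. w \<bullet> (gF z s - gf z) \<partial>D) = w \<bullet> (\<integral>s. gF z s - gf z \<partial>D)"
    by (rule integral_inner_right) (use int in auto)
  also have "\<dots> = 0"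
    using int by (simp add: gF_mean D.prob_space)
  finally show ?thesis
    using I.Hoeffdings_lemma_nn_integral_0[OF assms(2)] by (simp add: power_mult_distrib mult.commute)
qed

text \<open>Each further computation contributes samples that are independent of the past and of
  each other, hence one factor \<open>sample_mgf\<close> per worker in \<open>S\<close>. Honest sets
  and Byzantine vectors do not occur: within a round the noise depends only on \<open>x t\<close>
  and the samples, so an adaptive adversary cannot influence this sum.\<close>

lemma noise_mgf:
  assumes t: "t \<in> {1..T}" and w: "norm w = 1" and l: "l > 0"
  shows "(\<integral>\<^sup>+\<omega>. ennreal (exp (l * (w \<bullet> (\<Sum>k = 1..n. \<Sum>i\<in>S. noise t k i \<omega>)))) \<partial>M)
    \<le> ennreal (exp (l\<^sup>2 * V\<^sup>2 / 2 * real (card S * n)))"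
proof (induction n)
  case 0
  show ?case by (simp add: emeasure_space_1)
next
  case (Suc n)
  define W where "W \<omega> = w \<bullet> (\<Sum>k = 1..n. \<Sum>i\<in>S. noise t k i \<omega>)" for \<omega>
  define X where "X \<omega> = (W \<omega>, x t \<omega>)" for \<omega>
  \<comment> \<open>The factors 1 extend the product to all workers, so that the product formula on
    \<open>Pi\<^sub>M UNIV\<close> applies.\<close>
  define h where "h = (\<lambda>((p, z), y). ennreal (exp (l * p)) *
    (\<Prod>i\<in>UNIV. if i \<in> S then ennreal (exp (l * (w \<bullet> (gF z (y i) - gf z)))) else 1))"
  have k: "1 \<le> Suc n" by simp
  have [measurable]: "noise t k i \<in> borel_measurable (H t (Suc n))" if "k \<in> {1..n}" for k i
    using noise_measurable[OF t, of k i] that t by (auto intro: measurable_later)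
  have [measurable]: "x t \<in> borel_measurable (H t (Suc n))"
    using measurable_later[OF x_measurable[of t], of "Suc n"] t by auto
  have X: "X \<in> measurable (H t (Suc n)) (borel \<Otimes>\<^sub>M borel)"
    unfolding X_def W_def by measurable
  have h: "h \<in> borel_measurable ((borel \<Otimes>\<^sub>M borel) \<Otimes>\<^sub>M Pi\<^sub>M UNIV (\<lambda>_. D))"
  proof -
    have [measurable]: "(\<lambda>p. snd p i) \<in> measurable ((borel \<Otimes>\<^sub>M borel) \<Otimes>\<^sub>M Pi\<^sub>M UNIV (\<lambda>_. D)) D" for i :: 'm
      by (rule measurable_compose[OF measurable_snd measurable_component_singleton]) simp
    have [measurable]: "(\<lambda>p. gF (snd (fst p)) (snd p i)) \<in>
        borel_measurable ((borel \<Otimes>\<^sub>M borel) \<Otimes>\<^sub>M Pi\<^sub>M UNIV (\<lambda>_. D))" for i :: 'm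
      by (rule gF_measurable_comp) measurable
    have [measurable]: "(\<lambda>p. if i \<in> S then ennreal (exp (l * (w \<bullet> (gF (snd (fst p)) (snd p i) - gf (snd (fst p)))))) else 1)
        \<in> borel_measurable ((borel \<Otimes>\<^sub>M borel) \<Otimes>\<^sub>M Pi\<^sub>M UNIV (\<lambda>_. D))" for i :: 'm
      by (cases "i \<in> S") simp_all
    show ?thesis unfolding h_def split_beta by measurable
  qed
  have W: "W \<in> borel_measurable (H t (Suc n))"
    unfolding W_def by measurable
  interpret PD: product_sigma_finite "\<lambda>_::'m. D" by standard
  have "(\<integral>\<^sup>+\<omega>. ennreal (exp (l * (w \<bullet> (\<Sum>k = 1..Suc n. \<Sum>i\<in>S. noise t k i \<omega>)))) \<partial>M) =
      (\<integral>\<^sup>+\<omega>. h (X \<omega>, (\<lambda>i. \<xi> t (Suc n) i \<omega>)) \<partial>M)"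
  proof (rule nn_integral_cong)
    fix \<omega>
    have "(\<Prod>i\<in>UNIV. if i \<in> S then ennreal (exp (l * (w \<bullet> noise t (Suc n) i \<omega>))) else 1) =
        (\<Prod>i\<in>S. ennreal (exp (l * (w \<bullet> noise t (Suc n) i \<omega>))))"
      by (simp add: prod.If_cases)
    also have "\<dots> = ennreal (exp (l * (w \<bullet> (\<Sum>i\<in>S. noise t (Suc n) i \<omega>))))"
      by (simp add: prod_ennreal inner_sum_right sum_distrib_left exp_sum)
    finally show "ennreal (exp (l * (w \<bullet> (\<Sum>k = 1..Suc n. \<Sum>i\<in>S. noise t k i \<omega>)))) =
        h (X \<omega>, (\<lambda>i. \<xi> t (Suc n) i \<omega>))"
      unfolding h_def X_def prod.case noise_def[symmetric]
      by (simp add: W_def inner_add_right ring_distribs exp_add ennreal_mult)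
  qed
  also have "\<dots> = (\<integral>\<^sup>+\<omega>. (\<integral>\<^sup>+y. h (X \<omega>, y) \<partial>Pi\<^sub>M UNIV (\<lambda>_. D)) \<partial>M)"
    using nn_integral_freeze[OF info_sub X samples_measurable[OF t k] sample_fresh[OF t k] h] t
    by (simp add: sample_distr[OF t k])
  also have "\<dots> \<le> (\<integral>\<^sup>+\<omega>. ennreal (exp (l * W \<omega>)) * ennreal (exp (l\<^sup>2 * V\<^sup>2 / 2 * card S)) \<partial>M)"
  proof (rule nn_integral_mono)
    fix \<omega>
    have [measurable]: "(\<lambda>y. gF (x t \<omega>) (y i)) \<in> borel_measurable (Pi\<^sub>M UNIV (\<lambda>_. D))" for i :: 'm
      by (rule gF_measurable_comp) (auto intro: measurable_component_singleton)
    have [measurable]: "(\<lambda>y. if i \<in> S then ennreal (exp (l * (w \<bullet> (gF (x t \<omega>) (y i) - gf (x t \<omega>))))) else 1)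
        \<in> borel_measurable (Pi\<^sub>M UNIV (\<lambda>_. D))" for i :: 'm
      by (cases "i \<in> S") simp_all
    have "(\<integral>\<^sup>+y. h (X \<omega>, y) \<partial>Pi\<^sub>M UNIV (\<lambda>_. D)) = ennreal (exp (l * W \<omega>)) *
        (\<integral>\<^sup>+y. (\<Prod>i\<in>UNIV. if i \<in> S then ennreal (exp (l * (w \<bullet> (gF (x t \<omega>) (y i) - gf (x t \<omega>))))) else 1)
          \<partial>Pi\<^sub>M UNIV (\<lambda>_. D))"
      by (simp add: h_def X_def nn_integral_cmult)
    also have "(\<integral>\<^sup>+y. (\<Prod>i\<in>UNIV. if i \<in> S then ennreal (exp (l * (w \<bullet> (gF (x t \<omega>) (y i) - gf (x t \<omega>))))) else 1)
          \<partial>Pi\<^sub>M UNIV (\<lambda>_. D)) =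
        (\<Prod>i\<in>(UNIV::'m set). \<integral>\<^sup>+s. (if i \<in> S then ennreal (exp (l * (w \<bullet> (gF (x t \<omega>) s - gf (x t \<omega>))))) else 1) \<partial>D)"
      by (rule PD.product_nn_integral_prod) auto
    also have "\<dots> \<le> (\<Prod>i\<in>(UNIV::'m set). if i \<in> S then ennreal (exp (l\<^sup>2 * V\<^sup>2 / 2)) else 1)"
      by (intro prod_mono_ennreal) (use sample_mgf[OF w l] D.emeasure_space_1 in auto)
    also have "\<dots> = ennreal (exp (l\<^sup>2 * V\<^sup>2 / 2 * card S))"
      using exp_of_nat_mult[of "card S" "l\<^sup>2 * V\<^sup>2 / 2"]
      by (simp add: prod.If_cases ennreal_power mult.commute)
    finally show "(\<integral>\<^sup>+y. h (X \<omega>, y) \<partial>Pi\<^sub>M UNIV (\<lambda>_. D)) \<le>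
        ennreal (exp (l * W \<omega>)) * ennreal (exp (l\<^sup>2 * V\<^sup>2 / 2 * card S))"
      by (simp add: mult_left_mono)
  qed
  also have "\<dots> = (\<integral>\<^sup>+\<omega>. ennreal (exp (l * W \<omega>)) \<partial>M) * ennreal (exp (l\<^sup>2 * V\<^sup>2 / 2 * card S))"
  proof (rule nn_integral_multc)
    have [measurable]: "W \<in> borel_measurable M" using W t by (auto intro: measurable_info)
    show "(\<lambda>\<omega>. ennreal (exp (l * W \<omega>))) \<in> borel_measurable M" by measurable
  qed
  also have "\<dots> \<le> ennreal (exp (l\<^sup>2 * V\<^sup>2 / 2 * real (card S * n))) * ennreal (exp (l\<^sup>2 * V\<^sup>2 / 2 * card S))"
    using Suc.IH by (intro mult_right_mono) (auto simp: W_def)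
  also have "\<dots> = ennreal (exp (l\<^sup>2 * V\<^sup>2 / 2 * real (card S * Suc n)))"
    by (subst ennreal_mult[symmetric]) (simp_all add: exp_add[symmetric] ring_distribs)
  finally show ?case .
qed

subsection \<open>Concentration\<close>

text \<open>The factor 1/2 in the threshold pays for the honest workers being known only to exceed
  m/2 in number, see \<open>agg_static\<close>. In one direction the tail exponent is then C^2 / 8,
  that is \<open>log 2 (16 * m^2 * T)\<close>.\<close>

definition level_bad :: "nat \<Rightarrow> nat \<Rightarrow> 'm set \<Rightarrow> 'w \<Rightarrow> bool" where
  "level_bad t j S \<omega> \<longleftrightarrow> Cconst CARD('m) T * V / 2 * sqrt (real (card S * 2 ^ j)) <
     norm (\<Sum>k = 1..2 ^ j. \<Sum>i\<in>S. noise t k i \<omega>)"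

text \<open>
  The honest set is itself random and adaptive; asking for concentration over every fixed \<open>S\<close>
  avoids conditioning on it.
\<close>

definition bad :: "nat \<Rightarrow> 'w \<Rightarrow> bool" where
  "bad t \<omega> \<longleftrightarrow> (\<exists>j\<in>{..jmax}. \<exists>S\<in>{S. S \<noteq> {}}. level_bad t j S \<omega>)"

lemma noise_tail:
  assumes t: "t \<in> {1..T}" and w: "norm w = 1" and "V > 0" "c > 0" "S \<noteq> {}" "n > 0"
  shows "prob {\<omega> \<in> space M. c \<le> w \<bullet> (\<Sum>k = 1..n. \<Sum>i\<in>S. noise t k i \<omega>)}
    \<le> exp (- c\<^sup>2 / (2 * V\<^sup>2 * real (card S * n)))"
proof -
  define N where "N = real (card S * n)"
  have N: "N > 0" using assms by (simp add: N_def card_gt_0_iff)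
  \<comment> \<open>The minimiser of \<open>- l * c + l^2 * V^2 / 2 * N\<close>, as usual in
    Chernoff's method.\<close>
  define l where "l = c / (V\<^sup>2 * N)"
  have l: "l > 0" using assms N by (simp add: l_def)
  define W where "W \<omega> = w \<bullet> (\<Sum>k = 1..n. \<Sum>i\<in>S. noise t k i \<omega>)" for \<omega>
  have [measurable]: "W \<in> borel_measurable M" unfolding W_def using t by measurable
  have eq: "{\<omega> \<in> space M. c \<le> W \<omega>} =
      {\<omega> \<in> space M. 1 \<le> ennreal (exp (- l * c)) * ennreal (exp (l * W \<omega>))}"
  proof -
    have "1 \<le> ennreal (exp (- l * c)) * ennreal (exp (l * W \<omega>)) \<longleftrightarrow> c \<le> W \<omega>" for \<omega>
    proof -
      have "ennreal (exp (- l * c)) * ennreal (exp (l * W \<omega>)) = ennreal (exp (- l * c + l * W \<omega>))"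
        by (subst ennreal_mult[symmetric]) (simp_all only: exp_add exp_ge_zero)
      moreover have "1 \<le> ennreal (exp (- l * c + l * W \<omega>)) \<longleftrightarrow> l * c \<le> l * W \<omega>"
        by (subst ennreal_1[symmetric], subst ennreal_le_iff) auto
      ultimately show ?thesis using l by simp
    qed
    then show ?thesis by simp
  qed
  have "emeasure M {\<omega> \<in> space M. c \<le> W \<omega>} \<le>
      ennreal (exp (- l * c)) * (\<integral>\<^sup>+\<omega>. ennreal (exp (l * W \<omega>)) * indicator (space M) \<omega> \<partial>M)"
    unfolding eq by (rule nn_integral_Markov_inequality) measurable
  also have "(\<integral>\<^sup>+\<omega>. ennreal (exp (l * W \<omega>)) * indicator (space M) \<omega> \<partial>M) =
      (\<integral>\<^sup>+\<omega>. ennreal (exp (l * W \<omega>)) \<partial>M)"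
    by (rule nn_integral_cong) simp
  also have "\<dots> \<le> ennreal (exp (l\<^sup>2 * V\<^sup>2 / 2 * N))"
    unfolding W_def N_def by (rule noise_mgf[OF t w l])
  also have "ennreal (exp (- l * c)) * ennreal (exp (l\<^sup>2 * V\<^sup>2 / 2 * N)) =
      ennreal (exp (- l * c + l\<^sup>2 * V\<^sup>2 / 2 * N))"
    by (subst ennreal_mult[symmetric]) (simp_all only: exp_add exp_ge_zero)
  also have "- l * c + l\<^sup>2 * V\<^sup>2 / 2 * N = - c\<^sup>2 / (2 * V\<^sup>2 * N)"
    using N assms by (simp add: l_def field_simps power2_eq_square)
  finally show ?thesis
    by (simp add: emeasure_eq_measure W_def N_def mult_left_mono)
qed

lemma level_bad_measurable [measurable]:
  "t \<in> {1..T} \<Longrightarrow> Measurable.pred M (level_bad t j S)"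
  unfolding level_bad_def by measurable

lemma bad_measurable [measurable]: "t \<in> {1..T} \<Longrightarrow> Measurable.pred M (bad t)"
  unfolding bad_def by (intro pred_intros_finite) auto

lemma level_bad_prob:
  assumes t: "t \<in> {1..T}" and "V > 0" "S \<noteq> {}" and U: "finite U" "U \<subseteq> sphere 0 1"
    "\<And>v::'a. \<exists>u\<in>U. 3 / 4 * norm v \<le> u \<bullet> v"
  shows "prob {\<omega> \<in> space M. level_bad t j S \<omega>} \<le>
    real (card U) * exp (- (9 / 16 * log 2 (16 * (real CARD('m))\<^sup>2 * real T)))"
proof -
  define l where "l = log 2 (16 * (real CARD('m))\<^sup>2 * real T)"
  have "1 * 1 \<le> (real CARD('m))\<^sup>2 * real T"
    using t by (intro mult_mono) (auto simp: one_le_power)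
  then have l: "l > 0" by (simp add: l_def mult.assoc)
  define N where "N = real (card S * 2 ^ j)"
  have N: "N > 0" using assms by (simp add: N_def card_gt_0_iff)
  define C where "C = Cconst CARD('m) T"
  have C: "C > 0" "C\<^sup>2 = 8 * l"
    using l by (simp_all add: C_def Cconst_def l_def)
  \<comment> \<open>A long sum has, along some net direction, at least 3/4 of its length; squared,
    this is the 9/16 of the exponent.\<close>
  define c where "c = 3 / 4 * (C * V / 2 * sqrt N)"
  have c: "c > 0" using C N assms by (simp add: c_def)
  define W where "W \<omega> = (\<Sum>k = 1..2 ^ j. \<Sum>i\<in>S. noise t k i \<omega>)" for \<omega>
  have [measurable]: "W \<in> borel_measurable M" unfolding W_def using t by measurable
  have "prob {\<omega> \<in> space M. level_bad t j S \<omega>} \<le> prob (\<Union>u\<in>U. {\<omega> \<in> space M. c \<le> u \<bullet> W \<omega>})"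
  proof (rule finite_measure_mono)
    show "{\<omega> \<in> space M. level_bad t j S \<omega>} \<subseteq> (\<Union>u\<in>U. {\<omega> \<in> space M. c \<le> u \<bullet> W \<omega>})"
    proof
      fix \<omega> assume "\<omega> \<in> {\<omega> \<in> space M. level_bad t j S \<omega>}"
      then have \<omega>: "\<omega> \<in> space M" "C * V / 2 * sqrt N \<le> norm (W \<omega>)"
        by (auto simp: level_bad_def W_def C_def N_def)
      obtain u where "u \<in> U" "3 / 4 * norm (W \<omega>) \<le> u \<bullet> W \<omega>" using U(3) by blast
      moreover from this \<omega> have "c \<le> u \<bullet> W \<omega>" by (simp add: c_def)
      ultimately show "\<omega> \<in> (\<Union>u\<in>U. {\<omega> \<in> space M. c \<le> u \<bullet> W \<omega>})" using \<omega>(1) by blast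
    qed
  qed (use U(1) in auto)
  also have "\<dots> \<le> (\<Sum>u\<in>U. prob {\<omega> \<in> space M. c \<le> u \<bullet> W \<omega>})"
    by (rule measure_UNION_le) (use U(1) in auto)
  also have "\<dots> \<le> (\<Sum>u\<in>U. exp (- c\<^sup>2 / (2 * V\<^sup>2 * N)))"
    unfolding W_def N_def using U(2)
    by (intro sum_mono noise_tail[OF t]) (use assms c in auto)
  also have "- c\<^sup>2 / (2 * V\<^sup>2 * N) = - (9 / 16 * l)"
  proof -
    have "c\<^sup>2 = 9 / 64 * (C\<^sup>2 * V\<^sup>2 * N)"
      using N by (simp add: c_def power_mult_distrib power_divide)
    also have "\<dots> = 9 / 16 * l * (2 * V\<^sup>2 * N)" unfolding C(2) by simp
    finally show ?thesis using N assms(2) by (simp add: field_simps)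
  qed
  finally show ?thesis by (simp add: l_def)
qed

text \<open>A union bound over levels and fewer than 2^m sets. The factor 2^m is affordable because
  m stays fixed while \<open>T\<close> grows.\<close>

lemma bad_prob:
  assumes t: "t \<in> {1..T}" and "V > 0" and U: "finite U" "U \<subseteq> sphere 0 1"
    "\<And>v::'a. \<exists>u\<in>U. 3 / 4 * norm v \<le> u \<bullet> v"
  shows "prob {\<omega> \<in> space M. bad t \<omega>} \<le> (real jmax + 1) * 2 ^ CARD('m) * real (card U) *
    exp (- (9 / 16 * log 2 (16 * (real CARD('m))\<^sup>2 * real T)))"
    (is "_ \<le> _ * ?p")
proof -
  have "{\<omega> \<in> space M. bad t \<omega>} =
      (\<Union>j\<in>{..jmax}. \<Union>S\<in>{S. S \<noteq> {}}. {\<omega> \<in> space M. level_bad t j S \<omega>})"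
    by (auto simp: bad_def)
  also have "prob \<dots> \<le> (\<Sum>j\<in>{..jmax}. prob (\<Union>S\<in>{S. S \<noteq> {}}. {\<omega> \<in> space M. level_bad t j S \<omega>}))"
    by (rule measure_UNION_le) (use t in auto)
  also have "\<dots> \<le> (\<Sum>j\<in>{..jmax}. \<Sum>S\<in>{S. S \<noteq> {}}. prob {\<omega> \<in> space M. level_bad t j S \<omega>})"
    by (intro sum_mono measure_UNION_le) (use t in auto)
  also have "\<dots> \<le> (\<Sum>j\<in>{..jmax}. \<Sum>S\<in>{S. S \<noteq> ({}::'m set)}. real (card U) * ?p)"
    by (intro sum_mono level_bad_prob assms) auto
  also have "\<dots> = (real jmax + 1) * (real (card {S. S \<noteq> ({}::'m set)}) * (real (card U) * ?p))"
    by simp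
  also have "\<dots> \<le> (real jmax + 1) * (2 ^ CARD('m) * (real (card U) * ?p))"
  proof -
    have "card {S. S \<noteq> ({}::'m set)} \<le> card (Pow (UNIV :: 'm set))" by (rule card_mono) auto
    also have "\<dots> = 2 ^ CARD('m)" by (rule card_Pow) simp
    finally have "real (card {S. S \<noteq> ({}::'m set)}) \<le> real (2 ^ CARD('m))"
      by (rule of_nat_mono)
    then have "real (card {S. S \<noteq> ({}::'m set)}) \<le> 2 ^ CARD('m)" by simp
    then show ?thesis by (intro mult_left_mono mult_right_mono) auto
  qed
  finally show ?thesis by (simp add: mult.assoc)
qed

section \<open>Consequences of the independence of the level\<close>

text \<open>\<open>honest_card\<close> speaks only of computations that are read. But
  \<open>G t k\<close> is known without the level, so a violation of positive probability would also
  occur together with \<open>J t = k\<close>, and then computation \<open>k\<close> is read since k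
  < 2^k.\<close>

lemma honest_card_AE:
  assumes t: "t \<in> {1..T}" and k: "1 \<le> k"
  shows "AE \<omega> in M. real (card (G t k \<omega>)) = (1 - \<delta>) * real CARD('m)"
proof -
  define E where "E = {\<omega> \<in> space M. real (card (G t k \<omega>)) \<noteq> (1 - \<delta>) * real CARD('m)}"
  have "k < 2 ^ k" by (rule less_exp)
  have "E = G t k -` {S. real (card S) \<noteq> (1 - \<delta>) * real CARD('m)} \<inter> space (H t k)"
    using t k by (auto simp: E_def info_space)
  also have "\<dots> \<in> sets (H t k)" by (rule measurable_sets[OF honest_known[OF t k]]) simp
  finally have E: "E \<in> sets (H t k)" .
  have "{\<omega> \<in> space M. J t \<omega> = k} = J t -` {k} \<inter> space M" by auto
  also have "\<dots> \<in> sets (vimage_algebra (space M) (J t) (count_space UNIV))"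
    by (rule in_vimage_algebra) simp
  finally have "prob (E \<inter> {\<omega> \<in> space M. J t \<omega> = k}) = prob E * prob {\<omega> \<in> space M. J t \<omega> = k}"
    by (rule indep_setD[OF level_fresh[OF t k] E])
  moreover have "E \<inter> {\<omega> \<in> space M. J t \<omega> = k} = {}"
    using honest_card[OF t, of _ k] \<open>k < 2 ^ k\<close> k by (auto simp: E_def)
  ultimately have "prob E = 0" using level_distr[OF t k] by simp
  moreover have "E \<in> sets M" using E info_sub[of t k] t k by (auto simp: subalgebra_def)
  ultimately show ?thesis
    by (subst AE_iff_measurable[OF _ refl]) (auto simp: E_def emeasure_eq_measure)
qed

text \<open>Independence factorises the expectation. The factor 1 / 2^j is what the weight
  \<open>2 ^ j\<close> in \<open>corr\<close> is designed to cancel.\<close>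

lemma level_expectation:
  fixes h :: "'w \<Rightarrow> real"
  assumes t: "t \<in> {1..T}" and k: "1 \<le> k" and j: "1 \<le> j"
    and h: "h \<in> borel_measurable (H t k)" and int: "integrable M h"
  shows "(\<integral>\<omega>. indicator {\<omega> \<in> space M. J t \<omega> = j} \<omega> * h \<omega> \<partial>M) = (\<integral>\<omega>. h \<omega> \<partial>M) / 2 ^ j"
proof -
  define E where "E = {\<omega> \<in> space M. J t \<omega> = j}"
  have [measurable]: "E \<in> sets M" unfolding E_def using t by measurable
  have hM: "h \<in> borel_measurable M" using h t k by (auto intro: measurable_info)
  have "indep_var borel (indicator E :: _ \<Rightarrow> real) borel h"
    unfolding indep_var_eq
  proof (intro conjI)
    have ind: "indep_set (sets (vimage_algebra (space M) (J t) (count_space UNIV))) (sets (H t k))"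
      using level_fresh[OF t k] unfolding indep_sets2_eq by (metis Int_commute mult.commute)
    have "sigma_sets (space M) {indicator E -` A \<inter> space M |A. A \<in> sets (borel :: real measure)} \<subseteq>
        sets (vimage_algebra (space M) (J t) (count_space UNIV))"
    proof -
      have "indicator E -` A \<inter> space M \<in> sets (vimage_algebra (space M) (J t) (count_space UNIV))"
        for A :: "real set"
      proof -
        have "indicator E -` A \<inter> space M = J t -` {i. indicator {j} i \<in> A} \<inter> space M"
          by (auto simp: E_def indicator_def)
        also have "\<dots> \<in> sets (vimage_algebra (space M) (J t) (count_space UNIV))"
          by (rule in_vimage_algebra) simp
        finally show ?thesis .
      qed
      then have "{indicator E -` A \<inter> space M |A. A \<in> sets (borel :: real measure)} \<subseteq>
          sets (vimage_algebra (space M) (J t) (count_space UNIV))"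
        by auto
      then show ?thesis
        using sets.sigma_sets_subset[of _ "vimage_algebra (space M) (J t) (count_space UNIV)"] by simp
    qed
    moreover have "sigma_sets (space M) {h -` A \<inter> space M |A. A \<in> sets borel} \<subseteq> sets (H t k)"
    proof -
      have "{h -` A \<inter> space M |A. A \<in> sets borel} \<subseteq> sets (H t k)"
        using measurable_sets[OF h] t k by (auto simp: info_space)
      then show ?thesis
        using sets.sigma_sets_subset[of _ "H t k"] t k by (simp add: info_space)
    qed
    ultimately show "indep_set
        (sigma_sets (space M) {indicator E -` A \<inter> space M |A. A \<in> sets (borel :: real measure)})
        (sigma_sets (space M) {h -` A \<inter> space M |A. A \<in> sets borel})"
      using ind unfolding indep_sets2_eq by blast
  qed (use hM in auto)
  then have "(\<integral>\<omega>. indicator E \<omega> * h \<omega> \<partial>M) = (\<integral>\<omega>. indicator E \<omega> \<partial>M) * (\<integral>\<omega>. h \<omega> \<partial>M)"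
  proof (rule indep_var_lebesgue_integral)
    show "integrable M (indicator E :: _ \<Rightarrow> real)"
      by (rule integrable_const_bound[of _ 1]) (auto simp: indicator_def)
  qed (rule int)
  moreover have "(\<integral>\<omega>. indicator E \<omega> \<partial>M) = 1 / (2 ^ j :: real)"
    using level_distr[OF t j] by (simp add: E_def[symmetric])
  ultimately show ?thesis by (simp add: E_def)
qed

subsection \<open>Bias of the estimate\<close>

text \<open>Refers to a fixed level and is therefore known at time \<open>Suc (2 ^ j)\<close>,
  independently of \<open>J t\<close>. The round itself is static exactly if
  \<open>stat t (J t \<omega>) \<omega>\<close>.\<close>

definition stat :: "nat \<Rightarrow> nat \<Rightarrow> 'w \<Rightarrow> bool" where
  "stat t j \<omega> \<longleftrightarrow> (\<forall>k\<in>{1..2 ^ j}. G t k \<omega> = G t 1 \<omega>)"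

text \<open>
  \<open>avg t jmax\<close> is the mean of the estimate of round \<open>t\<close> over the level \<open>J t\<close> alone.
\<close>

definition avg :: "nat \<Rightarrow> nat \<Rightarrow> 'w \<Rightarrow> 'a" where
  "avg t n \<omega> = agg t 0 \<omega> + (\<Sum>j = 1..n. (1 / 2 ^ j) *\<^sub>R corr t j \<omega>)"

lemma stat_0 [simp]: "stat t 0 \<omega>"
  by (simp add: stat_def)

lemma stat_mono: "stat t j \<omega> \<Longrightarrow> i \<le> j \<Longrightarrow> stat t i \<omega>"
  unfolding stat_def by (meson atLeastAtMost_iff order_trans power_increasing one_le_numeral)

lemma Cconst_nonneg: "0 \<le> Cconst CARD('m) T"
proof (cases "T = 0")
  case False
  then have "1 * 1 \<le> (real CARD('m))\<^sup>2 * real T"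
    by (intro mult_mono) (auto simp: one_le_power)
  then show ?thesis by (simp add: Cconst_def mult.assoc)
\<comment> \<open>For \<open>T = 0\<close> the default value \<open>ln 0 = 0\<close> makes C
  vanish.\<close>
qed (simp add: Cconst_def log_def)

lemma dev_nonneg: "0 \<le> dev"
  using gamma_pos V_nonneg Cconst_nonneg by (simp add: dev_def)

text \<open>While the honest set does not change, the average of an honest worker is the true
  gradient plus averaged noise. After a change a worker's average may mix honest and Byzantine
  vectors, and nothing of the kind can be said.\<close>

lemma agg_deviation:
  assumes stat: "stat t j \<omega>" and card: "real (card (G t 1 \<omega>)) = (1 - \<delta>) * real CARD('m)"
    and E: "\<And>i. (norm ((\<Sum>k = 1..2 ^ j. noise t k i \<omega>) /\<^sub>R 2 ^ j))\<^sup>2 \<le> E"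
    and E': "(norm ((\<Sum>k = 1..2 ^ j. \<Sum>i\<in>G t 1 \<omega>. noise t k i \<omega>) /\<^sub>R (real (card (G t 1 \<omega>)) * 2 ^ j)))\<^sup>2 \<le> E'"
  shows "(norm (agg t j \<omega> - gf (x t \<omega>)))\<^sup>2 \<le> 2 * \<kappa> * E + 2 * E'"
proof -
  define S where "S = G t 1 \<omega>"
  define n :: real where "n = 2 ^ j"
  have n: "n > 0" by (simp add: n_def)
  define g :: "'a ^ 'm" where "g = (\<chi> i. (1 / 2 ^ j) *\<^sub>R (\<Sum>k = 1..2 ^ j. sent t \<omega> k i))"
  have S: "real (card S) > 0" using card delta_lt by (simp add: S_def)
  have g: "g $ i = gf (x t \<omega>) + (\<Sum>k = 1..2 ^ j. noise t k i \<omega>) /\<^sub>R n" if "i \<in> S" for i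
  proof -
    have "(\<Sum>k = 1..2 ^ j. sent t \<omega> k i) = (\<Sum>k = 1..2 ^ j. gf (x t \<omega>) + noise t k i \<omega>)"
    proof (rule sum.cong)
      fix k :: nat assume "k \<in> {1..2 ^ j}"
      with stat have "G t k \<omega> = S" unfolding stat_def S_def by blast
      with that have "i \<in> G t k \<omega>" by simp
      then show "sent t \<omega> k i = gf (x t \<omega>) + noise t k i \<omega>"
        by (simp add: sent_def sent_vector_def noise_def)
    qed simp
    also have "\<dots> = n *\<^sub>R gf (x t \<omega>) + (\<Sum>k = 1..2 ^ j. noise t k i \<omega>)"
      by (simp add: sum.distrib n_def sum_constant_scaleR)
    finally have "g $ i = (1 / n) *\<^sub>R (n *\<^sub>R gf (x t \<omega>) + (\<Sum>k = 1..2 ^ j. noise t k i \<omega>))"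
      by (simp add: g_def n_def)
    then show ?thesis using n by (simp only: scaleR_add_right scaleR_scaleR) (simp add: divide_inverse)
  qed
  define v where "v i = (\<Sum>k = 1..2 ^ j. noise t k i \<omega>)" for i
  have "subset_mean g S = (1 / real (card S)) *\<^sub>R (\<Sum>i\<in>S. gf (x t \<omega>) + v i /\<^sub>R n)"
    unfolding subset_mean_def using g by (simp add: v_def)
  also have "(\<Sum>i\<in>S. gf (x t \<omega>) + v i /\<^sub>R n) = real (card S) *\<^sub>R gf (x t \<omega>) + (\<Sum>i\<in>S. v i) /\<^sub>R n"
    by (simp only: sum.distrib sum_constant_scaleR scaleR_sum_right)
  also have "(1 / real (card S)) *\<^sub>R \<dots> = gf (x t \<omega>) + (\<Sum>i\<in>S. v i) /\<^sub>R (real (card S) * n)"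
  proof -
    have "(1 / s) *\<^sub>R (s *\<^sub>R gf (x t \<omega>) + w /\<^sub>R n) = gf (x t \<omega>) + w /\<^sub>R (s * n)" if "s > 0" for s w
      using that by (simp add: scaleR_add_right divide_inverse)
    from this[OF S] show ?thesis .
  qed
  also have "(\<Sum>i\<in>S. v i) = (\<Sum>i\<in>S. \<Sum>k = 1..2 ^ j. noise t k i \<omega>)" by (simp only: v_def)
  also have "(\<Sum>i\<in>S. \<Sum>k = 1..2 ^ j. noise t k i \<omega>) = (\<Sum>k = 1..2 ^ j. \<Sum>i\<in>S. noise t k i \<omega>)"
    by (rule sum.swap)
  finally have "(norm (subset_mean g S - gf (x t \<omega>)))\<^sup>2 \<le> E'"
    using E' by (simp add: S_def n_def)
  moreover have "(norm (g $ i - gf (x t \<omega>)))\<^sup>2 \<le> E" if "i \<in> S" for i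
    using E[of i] g[OF that] by (simp add: n_def)
  ultimately have "(norm (A g - gf (x t \<omega>)))\<^sup>2 \<le> 2 * \<kappa> * E + 2 * E'"
    by (intro robust_deviation[OF robust_A card[folded S_def]])
  then show ?thesis by (simp add: agg_def level_aggregate_def g_def)
qed

text \<open>With c = C V and n = 2^j, a single average has squared error at most c^2 / n. The honest
  mean over s workers has at most c^2 / (4 s n) \<le> c^2 / (2 m n), because s > m/2. Then 2\<kappa>
  c^2 / n + 2 c^2 / (2 m n) = \<gamma> c^2 / n, which is where \<gamma> gets its form.\<close>

lemma agg_static:
  assumes T: "T > 0" and stat: "stat t j \<omega>" and card: "real (card (G t 1 \<omega>)) = (1 - \<delta>) * real CARD('m)"
    and good: "\<not> bad t \<omega>" and j: "j \<le> jmax"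
  shows "norm (agg t j \<omega> - gf (x t \<omega>)) \<le> dev / sqrt (2 ^ j)"
proof -
  define s where "s = real (card (G t 1 \<omega>))"
  define n :: real where "n = 2 ^ j"
  define c where "c = Cconst CARD('m) T * V"
  have n: "n > 0" by (simp add: n_def)
  have c0: "0 \<le> c" unfolding c_def using V_nonneg Cconst_nonneg by simp
  have "(1 - \<delta>) * real CARD('m) > 1 / 2 * real CARD('m)"
    using delta_lt by (intro mult_strict_right_mono) auto
  then have s: "s > real CARD('m) / 2" using card by (simp add: s_def)
  then have s0: "s > 0" "G t 1 \<omega> \<noteq> {}" by (auto simp: s_def)
  have bound: "norm (\<Sum>k = 1..2 ^ j. \<Sum>i\<in>S. noise t k i \<omega>) \<le> c / 2 * sqrt (real (card S) * n)"
    if "S \<noteq> {}" for S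
    using good j that by (auto simp: bad_def level_bad_def c_def n_def not_less)
  have 1: "(norm ((\<Sum>k = 1..2 ^ j. noise t k i \<omega>) /\<^sub>R 2 ^ j))\<^sup>2 \<le> c\<^sup>2 / n" for i
  proof -
    have "(norm (\<Sum>k = 1..2 ^ j. noise t k i \<omega>))\<^sup>2 \<le> (c / 2 * sqrt n)\<^sup>2"
      using bound[of "{i}"] by (intro power_mono) auto
    also have "\<dots> \<le> c\<^sup>2 * n" using n by (simp add: power_mult_distrib power_divide)
    finally have "(norm (\<Sum>k = 1..2 ^ j. noise t k i \<omega>))\<^sup>2 / n\<^sup>2 \<le> c\<^sup>2 * n / n\<^sup>2"
      by (rule divide_right_mono) simp
    moreover have "c\<^sup>2 * n / n\<^sup>2 = c\<^sup>2 / n" using n by (simp add: power2_eq_square)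
    moreover have "norm ((\<Sum>k = 1..2 ^ j. noise t k i \<omega>) /\<^sub>R n) = norm (\<Sum>k = 1..2 ^ j. noise t k i \<omega>) / n"
      using n by (simp add: divide_inverse_commute)
    ultimately show ?thesis by (simp only: n_def[symmetric] power_divide)
  qed
  have 2: "(norm ((\<Sum>k = 1..2 ^ j. \<Sum>i\<in>G t 1 \<omega>. noise t k i \<omega>) /\<^sub>R (s * 2 ^ j)))\<^sup>2 \<le> c\<^sup>2 / (2 * real CARD('m) * n)"
  proof -
    have "(norm (\<Sum>k = 1..2 ^ j. \<Sum>i\<in>G t 1 \<omega>. noise t k i \<omega>))\<^sup>2 \<le> (c / 2 * sqrt (s * n))\<^sup>2"
      using bound[OF s0(2)] by (intro power_mono) (auto simp: s_def)
    also have "\<dots> = c\<^sup>2 / 4 * (s * n)" using n s0 by (simp add: power_mult_distrib power_divide)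
    finally have "(norm (\<Sum>k = 1..2 ^ j. \<Sum>i\<in>G t 1 \<omega>. noise t k i \<omega>))\<^sup>2 / (s * n)\<^sup>2 \<le> c\<^sup>2 / 4 * (s * n) / (s * n)\<^sup>2"
      by (rule divide_right_mono) simp
    also have "\<dots> = c\<^sup>2 / (4 * s * n)" using n s0 by (simp add: power2_eq_square)
    also have "\<dots> \<le> c\<^sup>2 / (2 * real CARD('m) * n)"
      using n s s0 by (intro divide_left_mono mult_right_mono mult_pos_pos) auto
    finally have "(norm (\<Sum>k = 1..2 ^ j. \<Sum>i\<in>G t 1 \<omega>. noise t k i \<omega>))\<^sup>2 / (s * n)\<^sup>2 \<le> c\<^sup>2 / (2 * real CARD('m) * n)" .
    moreover have "norm ((\<Sum>k = 1..2 ^ j. \<Sum>i\<in>G t 1 \<omega>. noise t k i \<omega>) /\<^sub>R (s * n)) =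
        norm (\<Sum>k = 1..2 ^ j. \<Sum>i\<in>G t 1 \<omega>. noise t k i \<omega>) / (s * n)"
      unfolding norm_scaleR using n s0 by (simp add: divide_inverse_commute)
    ultimately show ?thesis by (simp only: n_def[symmetric] power_divide)
  qed
  have "(norm (agg t j \<omega> - gf (x t \<omega>)))\<^sup>2 \<le> 2 * \<kappa> * (c\<^sup>2 / n) + 2 * (c\<^sup>2 / (2 * real CARD('m) * n))"
    by (rule agg_deviation[OF stat card 1 2[unfolded s_def]])
  also have "\<dots> = (sqrt \<gamma>)\<^sup>2 * c\<^sup>2 / n"
  proof -
    have "(sqrt \<gamma>)\<^sup>2 = 2 * \<kappa> + 1 / real CARD('m)" using gamma_pos by (simp add: gamma_eq)
    then show ?thesis using n by (simp add: add_divide_distrib ring_distribs)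
  qed
  also have "\<dots> = (dev / sqrt n)\<^sup>2"
    using n by (simp add: dev_def c_def power_mult_distrib power_divide)
  finally have "norm (agg t j \<omega> - gf (x t \<omega>)) \<le> dev / sqrt n"
    by (rule power2_le_imp_le) (use dev_nonneg n in simp)
  then show ?thesis by (simp add: n_def)
qed

text \<open>A single computation is static trivially, so this holds on the bad event too. The bound
  is not of order \<gamma> V^2; it is used only with a small factor, either the probability of the
  bad event or L \<eta>^2.\<close>

lemma agg_0_bound:
  assumes card: "real (card (G t 1 \<omega>)) = (1 - \<delta>) * real CARD('m)"
    and noise: "\<forall>i. norm (noise t 1 i \<omega>) \<le> V"
  shows "(norm (agg t 0 \<omega> - gf (x t \<omega>)))\<^sup>2 \<le> (2 * \<kappa> + 2) * V\<^sup>2"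
proof -
  define s where "s = real (card (G t 1 \<omega>))"
  have s: "s > 0" using card delta_lt by (simp add: s_def)
  have "norm (\<Sum>i\<in>G t 1 \<omega>. noise t 1 i \<omega>) \<le> s * V"
    unfolding s_def by (rule sum_norm_bound) (use noise in auto)
  then have "(norm (\<Sum>i\<in>G t 1 \<omega>. noise t 1 i \<omega>) / s)\<^sup>2 \<le> V\<^sup>2"
    using s by (intro power_mono) (auto simp: field_simps)
  then have mean: "(norm ((\<Sum>i\<in>G t 1 \<omega>. noise t 1 i \<omega>) /\<^sub>R s))\<^sup>2 \<le> V\<^sup>2"
    using s by (simp add: divide_inverse_commute)
  have "(norm (noise t 1 i \<omega>))\<^sup>2 \<le> V\<^sup>2" for i
    using noise by (intro power_mono) auto
  then have "(norm (agg t 0 \<omega> - gf (x t \<omega>)))\<^sup>2 \<le> 2 * \<kappa> * V\<^sup>2 + 2 * V\<^sup>2"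
    by (intro agg_deviation card) (use mean in \<open>auto simp: s_def\<close>)
  then show ?thesis by (simp add: algebra_simps)
qed

lemma corr_bound: "norm (corr t j \<omega>) \<le> (1 + sqrt 2) * dev * sqrt (2 ^ j)"
proof (cases "j \<le> jmax \<and> norm (agg t j \<omega> - agg t (j - 1) \<omega>) \<le> (1 + sqrt 2) * dev / sqrt (2 ^ j)")
  case True
  then have "norm (corr t j \<omega>) = 2 ^ j * norm (agg t j \<omega> - agg t (j - 1) \<omega>)"
    by (simp add: corr_def)
  also have "\<dots> \<le> 2 ^ j * ((1 + sqrt 2) * dev / sqrt (2 ^ j))"
    using True by (intro mult_left_mono) auto
  also have "\<dots> = (1 + sqrt 2) * dev * (2 ^ j / sqrt (2 ^ j))" by simp
  also have "2 ^ j / sqrt (2 ^ j) = sqrt (2 ^ j :: real)" by (rule real_div_sqrt) simp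
  finally show ?thesis .
next
  case False
  then show ?thesis using dev_nonneg by (auto simp: corr_def)
qed

lemma corr_beyond [simp]: "j > jmax \<Longrightarrow> corr t j \<omega> = 0"
  by (simp add: corr_def)

lemma corr_scaled_bound: "norm ((1 / 2 ^ j) *\<^sub>R corr t j \<omega>) \<le> (1 + sqrt 2) * dev / sqrt (2 ^ j)"
proof -
  have "norm ((1 / 2 ^ j) *\<^sub>R corr t j \<omega>) \<le> (1 / 2 ^ j) * ((1 + sqrt 2) * dev * sqrt (2 ^ j))"
    using corr_bound[of t j \<omega>] by (simp add: divide_right_mono)
  also have "\<dots> = (1 + sqrt 2) * dev * (sqrt (2 ^ j) / 2 ^ j)" by simp
  also have "sqrt (2 ^ j) / 2 ^ j = 1 / sqrt (2 ^ j :: real)" by (simp add: field_simps)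
  finally show ?thesis by simp
qed

text \<open>Through the true gradient, consecutive aggregates differ by at most
  \<open>dev / sqrt (2 ^ Suc n) + dev / sqrt (2 ^ n)\<close>, which is exactly the filter's
  threshold at level \<open>Suc n\<close>: this is the origin of 1 + sqrt 2. All differences are
  therefore accepted and the sum telescopes.\<close>

lemma avg_static:
  assumes "T > 0" "real (card (G t 1 \<omega>)) = (1 - \<delta>) * real CARD('m)" "\<not> bad t \<omega>"
    and "n \<le> jmax" "stat t n \<omega>"
  shows "avg t n \<omega> = agg t n \<omega>"
  using assms(4,5)
proof (induction n)
  case 0
  show ?case by (simp add: avg_def)
next
  case (Suc n)
  note st = agg_static[OF assms(1) _ assms(2,3)]
  have n: "stat t n \<omega>" using stat_mono[OF Suc.prems(2)] by simp
  have "norm (agg t (Suc n) \<omega> - agg t n \<omega>) \<le>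
      norm (agg t (Suc n) \<omega> - gf (x t \<omega>)) + norm (agg t n \<omega> - gf (x t \<omega>))"
    using norm_triangle_ineq4[of "agg t (Suc n) \<omega> - gf (x t \<omega>)" "agg t n \<omega> - gf (x t \<omega>)"] by simp
  also have "\<dots> \<le> dev / sqrt (2 ^ Suc n) + dev / sqrt (2 ^ n)"
    using st[OF Suc.prems(2)] st[OF n] Suc.prems by (intro add_mono) auto
  also have "\<dots> = (1 + sqrt 2) * dev / sqrt (2 ^ Suc n)"
    by (simp add: real_sqrt_mult field_simps)
  finally have "corr t (Suc n) \<omega> = 2 ^ Suc n *\<^sub>R (agg t (Suc n) \<omega> - agg t n \<omega>)"
    using Suc.prems(1) by (simp add: corr_def)
  moreover have "avg t (Suc n) \<omega> = avg t n \<omega> + (1 / 2 ^ Suc n) *\<^sub>R corr t (Suc n) \<omega>"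
    by (simp add: avg_def)
  ultimately show ?case using Suc.IH[OF _ n] Suc.prems(1) by simp
qed

text \<open>The invariant carries the tail of the geometric series as a negative term.\<close>

lemma avg_deviation:
  assumes "T > 0" "real (card (G t 1 \<omega>)) = (1 - \<delta>) * real CARD('m)" "\<not> bad t \<omega>"
    and "l \<le> n" "n \<le> jmax" "stat t l \<omega>"
  shows "norm (avg t n \<omega> - gf (x t \<omega>)) \<le> dev * (7 / sqrt (2 ^ l) - 6 / sqrt (2 ^ n))"
  using assms(4,5)
proof (induction n rule: dec_induct)
  case base
  have "avg t l \<omega> = agg t l \<omega>" using base assms by (intro avg_static) auto
  moreover have "dev * (7 / sqrt (2 ^ l) - 6 / sqrt (2 ^ l)) = dev / sqrt (2 ^ l)"
    by (simp add: diff_divide_distrib[symmetric])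
  ultimately show ?case using agg_static[OF assms(1,6,2,3)] base by simp
next
  case (step n)
  have "avg t (Suc n) \<omega> = avg t n \<omega> + (1 / 2 ^ Suc n) *\<^sub>R corr t (Suc n) \<omega>"
    by (simp add: avg_def)
  then have "norm (avg t (Suc n) \<omega> - gf (x t \<omega>)) \<le>
      norm (avg t n \<omega> - gf (x t \<omega>)) + norm ((1 / 2 ^ Suc n) *\<^sub>R corr t (Suc n) \<omega>)"
    using norm_triangle_ineq[of "avg t n \<omega> - gf (x t \<omega>)" "(1 / 2 ^ Suc n) *\<^sub>R corr t (Suc n) \<omega>"]
    by (simp only: add_diff_eq diff_add_eq)
  also have "\<dots> \<le> dev * (7 / sqrt (2 ^ l) - 6 / sqrt (2 ^ n)) + (1 + sqrt 2) * dev / sqrt (2 ^ Suc n)"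
    using step by (intro add_mono corr_scaled_bound) auto
  also have "\<dots> = dev * (7 / sqrt (2 ^ l) - 6 / sqrt (2 ^ n) + (1 + sqrt 2) / sqrt (2 ^ Suc n))"
    by (simp only: ring_distribs times_divide_eq_right mult.commute)
  also have "\<dots> \<le> dev * (7 / sqrt (2 ^ l) - 6 / sqrt (2 ^ Suc n))"
  proof (rule mult_left_mono[OF _ dev_nonneg])
    \<comment> \<open>A tail coefficient c survives the induction step if c + 1 + sqrt 2 \<le> c
      sqrt 2, i.e. c \<ge> (1 + sqrt 2)^2, which lies between 5 and 6. With c = 6 this reads 7 \<le>
      5 sqrt 2, and 7 = 6 + 1 fits the base case.\<close>
    have "7 / 5 \<le> sqrt 2" by (rule real_le_rsqrt) (simp add: power2_eq_square)
    then have "6 + (1 + sqrt 2) \<le> 6 * sqrt 2" by simp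
    then have "(6 + (1 + sqrt 2)) / sqrt (2 ^ Suc n) \<le> (6 * sqrt 2) / sqrt (2 ^ Suc n)"
      by (rule divide_right_mono) simp
    moreover have "(6 * sqrt 2) / sqrt (2 ^ Suc n) = 6 / sqrt (2 ^ n)"
      by (simp add: real_sqrt_mult)
    moreover have "(6 + (1 + sqrt 2)) / sqrt (2 ^ Suc n) = 6 / sqrt (2 ^ Suc n) + (1 + sqrt 2) / sqrt (2 ^ Suc n)"
      by (rule add_divide_distrib)
    ultimately show "7 / sqrt (2 ^ l) - 6 / sqrt (2 ^ n) + (1 + sqrt 2) / sqrt (2 ^ Suc n) \<le>
        7 / sqrt (2 ^ l) - 6 / sqrt (2 ^ Suc n)"
      by linarith
  qed
  finally show ?case .
qed

text \<open>If the last static level l is below \<open>jmax\<close>, then level l + 1 is not static,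
  and its summand already gives 1 / 2^l = 2 / 2^(l + 1). Stating the bound as a sum over all
  non-static levels makes it linear in indicators, so that its expectation needs no law of
  l.\<close>

lemma avg_good:
  assumes "T > 0" "real (card (G t 1 \<omega>)) = (1 - \<delta>) * real CARD('m)" "\<not> bad t \<omega>"
  shows "(norm (avg t jmax \<omega> - gf (x t \<omega>)))\<^sup>2 \<le>
    49 * dev\<^sup>2 * (1 / 2 ^ jmax + 2 * (\<Sum>j = 1..jmax. (if stat t j \<omega> then 0 else 1) / 2 ^ j))"
proof -
  \<comment> \<open>The maximum exists because level 0 always qualifies.\<close>
  define l where "l = Max {j \<in> {..jmax}. stat t j \<omega>}"
  have fin: "finite {j \<in> {..jmax}. stat t j \<omega>}" "{j \<in> {..jmax}. stat t j \<omega>} \<noteq> {}"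
    using stat_0 by (auto intro!: exI[of _ 0])
  have l: "l \<le> jmax" "stat t l \<omega>" using Max_in[OF fin] by (auto simp: l_def)
  have "norm (avg t jmax \<omega> - gf (x t \<omega>)) \<le> dev * (7 / sqrt (2 ^ l) - 6 / sqrt (2 ^ jmax))"
    by (rule avg_deviation[OF assms l(1) order_refl l(2)])
  also have "\<dots> \<le> dev * (7 / sqrt (2 ^ l))"
    using dev_nonneg by (intro mult_left_mono) auto
  finally have "(norm (avg t jmax \<omega> - gf (x t \<omega>)))\<^sup>2 \<le> (dev * (7 / sqrt (2 ^ l)))\<^sup>2"
    by (rule power_mono) simp
  also have "\<dots> = 49 * dev\<^sup>2 * (1 / 2 ^ l)"
    by (simp add: power_mult_distrib power_divide)
  also have "1 / 2 ^ l \<le> 1 / 2 ^ jmax + 2 * (\<Sum>j = 1..jmax. (if stat t j \<omega> then 0 else 1) / 2 ^ j :: real)"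
  proof (cases "l = jmax")
    case True
    then show ?thesis by (simp add: sum_nonneg)
  next
    case False
    have "\<not> stat t (Suc l) \<omega>"
    proof
      assume "stat t (Suc l) \<omega>"
      then have "Suc l \<in> {j \<in> {..jmax}. stat t j \<omega>}" using False l by simp
      from Max_ge[OF fin(1) this] show False by (simp only: l_def[symmetric])
    qed
    then have "1 / 2 ^ Suc l = (if stat t (Suc l) \<omega> then 0 else 1) / (2 ^ Suc l :: real)" by simp
    also have "\<dots> \<le> (\<Sum>j = 1..jmax. (if stat t j \<omega> then 0 else 1) / 2 ^ j)"
      using False l by (intro member_le_sum) auto
    finally have "1 / 2 ^ Suc l \<le> (\<Sum>j = 1..jmax. (if stat t j \<omega> then 0 else 1) / 2 ^ j :: real)" .
    moreover have "1 / 2 ^ l = 2 * (1 / 2 ^ Suc l :: real)" "0 \<le> (1 / 2 ^ jmax :: real)" by simp_all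
    ultimately show ?thesis by linarith
  qed
  finally show ?thesis by (simp add: mult_left_mono)
qed

text \<open>For the bad event: the filter keeps each of the \<open>jmax\<close> summands below
  \<open>3 * dev\<close> whatever the adversary does.\<close>

lemma avg_crude:
  assumes card: "real (card (G t 1 \<omega>)) = (1 - \<delta>) * real CARD('m)"
    and noise: "\<forall>i. norm (noise t 1 i \<omega>) \<le> V"
  shows "(norm (avg t jmax \<omega> - gf (x t \<omega>)))\<^sup>2 \<le> 2 * ((2 * \<kappa> + 2) * V\<^sup>2) + 18 * (real jmax)\<^sup>2 * dev\<^sup>2"
proof -
  let ?d = "\<Sum>j = 1..jmax. (1 / 2 ^ j) *\<^sub>R corr t j \<omega>"
  have "norm ?d \<le> of_nat (card {1..jmax}) * (3 * dev)"
  proof (rule sum_norm_bound)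
    fix j
    have "sqrt 2 \<le> 2" by (rule real_le_lsqrt) auto
    then have "(1 + sqrt 2) * dev / sqrt (2 ^ j) \<le> 3 * dev / 1"
      using dev_nonneg by (intro frac_le mult_right_mono) auto
    then show "norm ((1 / 2 ^ j) *\<^sub>R corr t j \<omega>) \<le> 3 * dev"
      using corr_scaled_bound[of j t \<omega>] by simp
  qed
  then have "(norm ?d)\<^sup>2 \<le> (real jmax * (3 * dev))\<^sup>2" by (intro power_mono) auto
  then have d: "(norm ?d)\<^sup>2 \<le> 9 * (real jmax)\<^sup>2 * dev\<^sup>2" by (simp add: power_mult_distrib)
  have "(norm (avg t jmax \<omega> - gf (x t \<omega>)))\<^sup>2 \<le> (norm (agg t 0 \<omega> - gf (x t \<omega>)) + norm ?d)\<^sup>2"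
    using norm_triangle_ineq[of "agg t 0 \<omega> - gf (x t \<omega>)" ?d]
    by (intro power_mono) (auto simp: avg_def algebra_simps)
  also have "\<dots> \<le> 2 * (norm (agg t 0 \<omega> - gf (x t \<omega>)))\<^sup>2 + 2 * (norm ?d)\<^sup>2"
    using sum_squares_bound[of "norm (agg t 0 \<omega> - gf (x t \<omega>))" "norm ?d"] by (simp add: power2_sum)
  finally show ?thesis using d agg_0_bound[OF assms] by simp
qed

subsection \<open>Moments\<close>

lemma f_bounded: "\<exists>b. \<forall>z. norm z \<le> R \<longrightarrow> \<bar>f z\<bar> \<le> b"
proof -
  have "bounded (f ` cball 0 R)"
    using smooth_continuous_on[OF smooth_f]
    by (intro compact_imp_bounded compact_continuous_image) (auto intro: continuous_on_subset)
  then obtain b where "\<forall>y\<in>f ` cball 0 R. norm y \<le> b" unfolding bounded_iff by blast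
  then show ?thesis by (intro exI[of _ b]) auto
qed

text \<open>Continuity of \<open>gf\<close> is not invoked: \<open>f\<close> is bounded on balls by
  compactness, and \<open>smooth_gradient_bound\<close> transfers this to the gradient.\<close>

lemma gf_bounded: "\<exists>b. \<forall>z. norm z \<le> R \<longrightarrow> norm (gf z) \<le> b"
proof -
  obtain b where b: "\<And>z. norm z \<le> R \<Longrightarrow> \<bar>f z\<bar> \<le> b" using f_bounded by blast
  have "norm (gf z) \<le> sqrt (2 * L * (b - (INF y. f y)))" if "norm z \<le> R" for z
  proof (rule real_le_rsqrt)
    have "(norm (gf z))\<^sup>2 \<le> 2 * L * (f z - (INF y. f y))"
      by (rule smooth_gradient_bound[OF smooth_f L_pos bdd_f])
    also have "\<dots> \<le> 2 * L * (b - (INF y. f y))"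
      using b[OF that] L_pos by (intro mult_left_mono) auto
    finally show "(norm (gf z))\<^sup>2 \<le> 2 * L * (b - (INF y. f y))" .
  qed
  then show ?thesis by blast
qed

lemma regular_AE:
  assumes "t \<in> {1..T}"
  shows "AE \<omega> in M. real (card (G t 1 \<omega>)) = (1 - \<delta>) * real CARD('m) \<and> (\<forall>i. norm (noise t 1 i \<omega>) \<le> V)"
  using honest_card_AE[OF assms, of 1] noise_bound[OF assms, of 1] by auto

lemma agg_0_AE:
  assumes "t \<in> {1..T}"
  shows "AE \<omega> in M. (norm (agg t 0 \<omega> - gf (x t \<omega>)))\<^sup>2 \<le> (2 * \<kappa> + 2) * V\<^sup>2"
  using regular_AE[OF assms] by eventually_elim (rule agg_0_bound, auto)

lemma corr_uniform_bound: "norm (corr t j \<omega>) \<le> (1 + sqrt 2) * dev * sqrt (2 ^ jmax)"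
proof (cases "j \<le> jmax")
  case True
  have "norm (corr t j \<omega>) \<le> (1 + sqrt 2) * dev * sqrt (2 ^ j)" by (rule corr_bound)
  also have "\<dots> \<le> (1 + sqrt 2) * dev * sqrt (2 ^ jmax)"
    using True dev_nonneg by (intro mult_left_mono) (auto intro: power_increasing)
  finally show ?thesis .
next
  case False
  then show ?thesis using dev_nonneg by simp
qed

text \<open>Serves integrability only; the radius may grow with \<open>t\<close> in any way. Each
  step is bounded because the noise is, and because the filter and the truncation at
  \<open>jmax\<close> bound the corrections.\<close>

lemma x_bounded:
  assumes "1 \<le> t" "t \<le> Suc T"
  shows "\<exists>R. AE \<omega> in M. norm (x t \<omega>) \<le> R"
  using assms
proof (induction t rule: dec_induct)
  case base
  show ?case by (rule exI[of _ "norm x1"], rule AE_I2) (use start in auto)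
next
  case (step t)
  then have t: "t \<in> {1..T}" by auto
  from step obtain R where R: "AE \<omega> in M. norm (x t \<omega>) \<le> R" by auto
  obtain b where b: "\<And>z. norm z \<le> R \<Longrightarrow> norm (gf z) \<le> b" using gf_bounded by blast
  define c where "c = b + sqrt ((2 * \<kappa> + 2) * V\<^sup>2) + (1 + sqrt 2) * dev * sqrt (2 ^ jmax)"
  have "AE \<omega> in M. norm (x (Suc t) \<omega>) \<le> R + \<bar>\<eta>\<bar> * c"
    using R agg_0_AE[OF t] AE_space
  proof eventually_elim
    case (elim \<omega>)
    have "norm (agg t 0 \<omega> - gf (x t \<omega>)) \<le> sqrt ((2 * \<kappa> + 2) * V\<^sup>2)"
      using elim(2) by (rule real_le_rsqrt)
    moreover have "norm (agg t 0 \<omega>) \<le> norm (gf (x t \<omega>)) + norm (agg t 0 \<omega> - gf (x t \<omega>))"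
      by (rule norm_triangle_sub)
    ultimately have "norm (agg t 0 \<omega>) \<le> b + sqrt ((2 * \<kappa> + 2) * V\<^sup>2)"
      using b[OF elim(1)] by linarith
    then have "norm (agg t 0 \<omega> + corr t (J t \<omega>) \<omega>) \<le> c"
      unfolding c_def by (rule norm_triangle_mono) (rule corr_uniform_bound)
    then have "norm (\<eta> *\<^sub>R (agg t 0 \<omega> + corr t (J t \<omega>) \<omega>)) \<le> \<bar>\<eta>\<bar> * c"
      unfolding norm_scaleR by (rule mult_left_mono) simp
    then show ?case
      unfolding update_corr[OF t elim(3)]
      using norm_triangle_ineq4[of "x t \<omega>" "\<eta> *\<^sub>R (agg t 0 \<omega> + corr t (J t \<omega>) \<omega>)"] elim(1) by linarith
  qed
  then show ?case by blast
qed

lemma gradient_bounded: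
  assumes "t \<in> {1..Suc T}"
  shows "\<exists>b. AE \<omega> in M. norm (gf (x t \<omega>)) \<le> b"
proof -
  obtain R where R: "AE \<omega> in M. norm (x t \<omega>) \<le> R" using x_bounded[of t] assms by auto
  obtain b where b: "\<And>z. norm z \<le> R \<Longrightarrow> norm (gf z) \<le> b" using gf_bounded by blast
  have "AE \<omega> in M. norm (gf (x t \<omega>)) \<le> b" using R by eventually_elim (rule b)
  then show ?thesis by blast
qed

lemma integrable_gradient:
  assumes t: "t \<in> {1..Suc T}"
  shows "integrable M (\<lambda>\<omega>. (norm (gf (x t \<omega>)))\<^sup>2)"
proof -
  note x_measurable_M[OF t, measurable]
  obtain b where b: "AE \<omega> in M. norm (gf (x t \<omega>)) \<le> b" using gradient_bounded[OF t] by blast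
  show ?thesis
  proof (rule integrable_const_bound[of _ "b\<^sup>2"])
    show "AE \<omega> in M. norm ((norm (gf (x t \<omega>)))\<^sup>2) \<le> b\<^sup>2"
      using b by eventually_elim (auto intro: power_mono)
  qed measurable
qed

lemma integrable_objective:
  assumes t: "t \<in> {1..Suc T}"
  shows "integrable M (\<lambda>\<omega>. f (x t \<omega>))"
proof -
  note x_measurable_M[OF t, measurable]
  obtain R where R: "AE \<omega> in M. norm (x t \<omega>) \<le> R" using x_bounded[of t] t by auto
  obtain b where b: "\<And>z. norm z \<le> R \<Longrightarrow> \<bar>f z\<bar> \<le> b" using f_bounded by blast
  show ?thesis
  proof (rule integrable_const_bound[of _ b])
    show "AE \<omega> in M. norm (f (x t \<omega>)) \<le> b"
      using R by eventually_elim (use b in auto)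
  qed measurable
qed

lemma integrable_inner_gradient:
  fixes h :: "'w \<Rightarrow> 'a"
  assumes t: "t \<in> {1..T}" and h [measurable]: "h \<in> borel_measurable M" and c: "AE \<omega> in M. norm (h \<omega>) \<le> c"
  shows "integrable M (\<lambda>\<omega>. gf (x t \<omega>) \<bullet> h \<omega>)"
proof -
  have t': "t \<in> {1..Suc T}" using t by auto
  note x_measurable_M[OF t', measurable]
  obtain b where b: "AE \<omega> in M. norm (gf (x t \<omega>)) \<le> b" using gradient_bounded[OF t'] by blast
  show ?thesis
  proof (rule integrable_const_bound[of _ "b * c"])
    show "AE \<omega> in M. norm (gf (x t \<omega>) \<bullet> h \<omega>) \<le> b * c"
      using b c
    proof eventually_elim
      case (elim \<omega>)
      have "norm (gf (x t \<omega>) \<bullet> h \<omega>) \<le> norm (gf (x t \<omega>)) * norm (h \<omega>)"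
        unfolding real_norm_def by (rule Cauchy_Schwarz_ineq2)
      also have "\<dots> \<le> b * c" using elim norm_ge_zero order_trans by (blast intro: mult_mono)
      finally show ?case .
    qed
  qed measurable
qed

section \<open>Averaging over the random level\<close>

text \<open>As \<open>h\<close> vanishes outside \<open>{1..jmax}\<close>, a finite sum over the
  level suffices, and the null event \<open>J t = 0\<close> contributes nothing.\<close>

lemma level_sum_expectation:
  fixes h :: "nat \<Rightarrow> 'w \<Rightarrow> real"
  assumes t: "t \<in> {1..T}" and h: "\<And>j. h j \<in> borel_measurable (H t (Suc (2 ^ j)))"
    and int: "\<And>j. integrable M (h j)" and zero: "\<And>j \<omega>. j \<notin> {1..jmax} \<Longrightarrow> h j \<omega> = 0"
  shows "integrable M (\<lambda>\<omega>. h (J t \<omega>) \<omega>)"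
    and "(\<integral>\<omega>. h (J t \<omega>) \<omega> \<partial>M) = (\<Sum>j = 1..jmax. (\<integral>\<omega>. h j \<omega> \<partial>M) / 2 ^ j)"
proof -
  have [measurable]: "{\<omega> \<in> space M. J t \<omega> = j} \<in> sets M" for j
    using t by measurable
  have eq: "h (J t \<omega>) \<omega> = (\<Sum>j = 1..jmax. indicator {\<omega> \<in> space M. J t \<omega> = j} \<omega> * h j \<omega>)"
    if "\<omega> \<in> space M" for \<omega>
  proof -
    have "(\<Sum>j = 1..jmax. indicator {\<omega> \<in> space M. J t \<omega> = j} \<omega> * h j \<omega>) =
        (\<Sum>j = 1..jmax. if J t \<omega> = j then h j \<omega> else 0)"
      using that by (intro sum.cong) auto
    also have "\<dots> = h (J t \<omega>) \<omega>"
      using zero[of "J t \<omega>" \<omega>] by (simp add: sum.delta')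
    finally show ?thesis by simp
  qed
  have int': "integrable M (\<lambda>\<omega>. indicator {\<omega> \<in> space M. J t \<omega> = j} \<omega> * h j \<omega>)" for j
    using integrable_mult_indicator[OF _ int, of "{\<omega> \<in> space M. J t \<omega> = j}" j] by simp
  then have "integrable M (\<lambda>\<omega>. \<Sum>j = 1..jmax. indicator {\<omega> \<in> space M. J t \<omega> = j} \<omega> * h j \<omega>)"
    by (intro Bochner_Integration.integrable_sum)
  then show "integrable M (\<lambda>\<omega>. h (J t \<omega>) \<omega>)"
    by (rule Bochner_Integration.integrable_cong[THEN iffD2, rotated -1]) (use eq in auto)
  have "(\<integral>\<omega>. h (J t \<omega>) \<omega> \<partial>M) =
      (\<integral>\<omega>. (\<Sum>j = 1..jmax. indicator {\<omega> \<in> space M. J t \<omega> = j} \<omega> * h j \<omega>) \<partial>M)"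
    by (rule Bochner_Integration.integral_cong) (use eq in auto)
  also have "\<dots> = (\<Sum>j = 1..jmax. \<integral>\<omega>. indicator {\<omega> \<in> space M. J t \<omega> = j} \<omega> * h j \<omega> \<partial>M)"
    by (rule Bochner_Integration.integral_sum) (rule int')
  also have "\<dots> = (\<Sum>j = 1..jmax. (\<integral>\<omega>. h j \<omega> \<partial>M) / 2 ^ j)"
    by (intro sum.cong refl level_expectation[OF t _ _ h int]) auto
  finally show "(\<integral>\<omega>. h (J t \<omega>) \<omega> \<partial>M) = (\<Sum>j = 1..jmax. (\<integral>\<omega>. h j \<omega> \<partial>M) / 2 ^ j)" .
qed

lemma avg_measurable [measurable]: "t \<in> {1..T} \<Longrightarrow> avg t n \<in> borel_measurable M"
  unfolding avg_def by measurable

lemma corr_J_measurable [measurable]: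
  "t \<in> {1..T} \<Longrightarrow> (\<lambda>\<omega>. corr t (J t \<omega>) \<omega>) \<in> borel_measurable M"
  by (rule measurable_compose_countable[OF corr_measurable_M J_measurable])

text \<open>The passage from \<open>g\<^sub>t\<close> to its level average. The gradient at
  \<open>x t\<close> is known from the start of the round, so its inner product with a
  level-\<open>j\<close> correction is still independent of \<open>J t\<close>.\<close>

lemma inner_corr:
  assumes t: "t \<in> {1..T}"
  shows "(\<integral>\<omega>. gf (x t \<omega>) \<bullet> corr t (J t \<omega>) \<omega> \<partial>M) =
    (\<integral>\<omega>. gf (x t \<omega>) \<bullet> (\<Sum>j = 1..jmax. (1 / 2 ^ j) *\<^sub>R corr t j \<omega>) \<partial>M)"
proof -
  have int: "integrable M (\<lambda>\<omega>. gf (x t \<omega>) \<bullet> corr t j \<omega>)" for j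
    by (rule integrable_inner_gradient[OF t corr_measurable_M[OF t], of _ "(1 + sqrt 2) * dev * sqrt (2 ^ jmax)"])
       (rule AE_I2, rule corr_uniform_bound)
  have meas: "(\<lambda>\<omega>. gf (x t \<omega>) \<bullet> corr t j \<omega>) \<in> borel_measurable (H t (Suc (2 ^ j)))" for j
  proof -
    have x: "x t \<in> borel_measurable (H t 1)" using x_measurable[of t] t by simp
    have [measurable]: "x t \<in> borel_measurable (H t (Suc (2 ^ j)))"
      using measurable_later[OF x] t by simp
    note corr_measurable[OF t x, measurable]
    show ?thesis by measurable
  qed
  have "(\<integral>\<omega>. gf (x t \<omega>) \<bullet> corr t (J t \<omega>) \<omega> \<partial>M) =
      (\<Sum>j = 1..jmax. (\<integral>\<omega>. gf (x t \<omega>) \<bullet> corr t j \<omega> \<partial>M) / 2 ^ j)"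
  proof (rule level_sum_expectation(2)[OF t, of "\<lambda>j \<omega>. gf (x t \<omega>) \<bullet> corr t j \<omega>"])
    show "gf (x t \<omega>) \<bullet> corr t j \<omega> = 0" if "j \<notin> {1..jmax}" for j \<omega>
      using that by (cases "j = 0") auto
  qed (rule meas int)+
  also have "\<dots> = (\<integral>\<omega>. (\<Sum>j = 1..jmax. (gf (x t \<omega>) \<bullet> corr t j \<omega>) / 2 ^ j) \<partial>M)"
    using int by (simp add: Bochner_Integration.integral_sum)
  also have "\<dots> = (\<integral>\<omega>. gf (x t \<omega>) \<bullet> (\<Sum>j = 1..jmax. (1 / 2 ^ j) *\<^sub>R corr t j \<omega>) \<partial>M)"
    by (simp add: inner_sum_right)
  finally show ?thesis .
qed

text \<open>An accepted correction of level \<open>j\<close> has square at most (1 + sqrt 2)^2 dev^2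
  2^j \<le> 9 dev^2 2^j, and the level has probability 2^(-j). Every level costs the same, and the
  truncation at \<open>jmax\<close> turns the total into a logarithm.\<close>

lemma corr_second_moment:
  assumes t: "t \<in> {1..T}"
  shows "integrable M (\<lambda>\<omega>. (norm (corr t (J t \<omega>) \<omega>))\<^sup>2)"
    and "(\<integral>\<omega>. (norm (corr t (J t \<omega>) \<omega>))\<^sup>2 \<partial>M) \<le> 9 * real jmax * dev\<^sup>2"
proof -
  have x: "x t \<in> borel_measurable (H t 1)" using x_measurable[of t] t by simp
  have bound: "(norm (corr t j \<omega>))\<^sup>2 \<le> 9 * dev\<^sup>2 * 2 ^ j" for j \<omega>
  proof -
    have "sqrt 2 \<le> 2" by (rule real_le_lsqrt) auto
    then have "(1 + sqrt 2) * dev * sqrt (2 ^ j) \<le> 3 * dev * sqrt (2 ^ j)"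
      using dev_nonneg by (intro mult_right_mono) auto
    with corr_bound[of t j \<omega>] have "norm (corr t j \<omega>) \<le> 3 * dev * sqrt (2 ^ j)" by linarith
    then have "(norm (corr t j \<omega>))\<^sup>2 \<le> (3 * dev * sqrt (2 ^ j))\<^sup>2" by (rule power_mono) simp
    then show ?thesis by (simp add: power_mult_distrib)
  qed
  have int: "integrable M (\<lambda>\<omega>. (norm (corr t j \<omega>))\<^sup>2)" for j
  proof (rule integrable_const_bound[of _ "9 * dev\<^sup>2 * 2 ^ j"])
    show "AE \<omega> in M. norm ((norm (corr t j \<omega>))\<^sup>2) \<le> 9 * dev\<^sup>2 * 2 ^ j"
      using bound by (intro AE_I2) auto
    show "(\<lambda>\<omega>. (norm (corr t j \<omega>))\<^sup>2) \<in> borel_measurable M"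
      using corr_measurable_M[OF t, of j] by measurable
  qed
  have meas: "(\<lambda>\<omega>. (norm (corr t j \<omega>))\<^sup>2) \<in> borel_measurable (H t (Suc (2 ^ j)))" for j
    using corr_measurable[OF t x, of j] by measurable
  have zero: "(norm (corr t j \<omega>))\<^sup>2 = 0" if "j \<notin> {1..jmax}" for j \<omega>
    using that by (cases "j = 0") auto
  note sum = level_sum_expectation[OF t, of "\<lambda>j \<omega>. (norm (corr t j \<omega>))\<^sup>2", OF meas int zero]
  show "integrable M (\<lambda>\<omega>. (norm (corr t (J t \<omega>) \<omega>))\<^sup>2)" by (rule sum(1))
  have "(\<integral>\<omega>. (norm (corr t (J t \<omega>) \<omega>))\<^sup>2 \<partial>M) =
      (\<Sum>j = 1..jmax. (\<integral>\<omega>. (norm (corr t j \<omega>))\<^sup>2 \<partial>M) / 2 ^ j)"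
    by (rule sum(2))
  also have "\<dots> \<le> (\<Sum>j = 1..jmax. 9 * dev\<^sup>2)"
  proof (rule sum_mono)
    fix j
    have "(\<integral>\<omega>. (norm (corr t j \<omega>))\<^sup>2 \<partial>M) \<le> (\<integral>\<omega>. 9 * dev\<^sup>2 * 2 ^ j \<partial>M)"
      by (rule integral_mono[OF int]) (use bound in auto)
    then show "(\<integral>\<omega>. (norm (corr t j \<omega>))\<^sup>2 \<partial>M) / 2 ^ j \<le> 9 * dev\<^sup>2"
      by (simp add: prob_space divide_le_eq)
  qed
  finally show "(\<integral>\<omega>. (norm (corr t (J t \<omega>) \<omega>))\<^sup>2 \<partial>M) \<le> 9 * real jmax * dev\<^sup>2" by simp
qed

section \<open>Static levels and dynamic rounds as events\<close>

lemma stat_measurable: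
  assumes t: "t \<in> {1..T}"
  shows "Measurable.pred (H t (Suc (2 ^ j))) (stat t j)"
proof -
  have G: "G t k \<in> measurable (H t (Suc (2 ^ j))) (count_space UNIV)" if "k \<in> {1..2 ^ j}" for k
    using measurable_later[OF honest_known[OF t, of k]] that t by auto
  have 1: "(1::nat) \<in> {1..2 ^ j}" by simp
  \<comment> \<open>Equality of two random sets is expressed through their common value, which
    ranges over the finite type \<open>'m set\<close>.\<close>
  have "Measurable.pred (H t (Suc (2 ^ j))) (\<lambda>\<omega>. \<forall>k\<in>{1..2 ^ j}. \<exists>S\<in>UNIV. G t 1 \<omega> = S \<and> G t k \<omega> = S)"
    by (intro pred_intros_finite pred_intros_logic pred_count_space_const1 G 1) auto
  then show ?thesis by (simp add: stat_def[abs_def])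
qed

lemma stat_measurable_M: "t \<in> {1..T} \<Longrightarrow> Measurable.pred M (stat t j)"
  using stat_measurable[of t j] by (auto intro: measurable_info)

lemma dynamic_event:
  assumes t: "t \<in> {1..T}"
  shows "{\<omega> \<in> space M. t \<in> dynamic_rounds T J G \<omega>} = {\<omega> \<in> space M. \<not> stat t (J t \<omega>) \<omega>}"
  using t by (auto simp: dynamic_rounds_def static_rounds_def stat_def)

lemma dynamic_event_measurable:
  assumes t: "t \<in> {1..T}"
  shows "{\<omega> \<in> space M. t \<in> dynamic_rounds T J G \<omega>} \<in> sets M"
  unfolding dynamic_event[OF t]
  using measurable_compose_countable[OF stat_measurable_M[OF t] J_measurable[OF t]]
  by (simp add: pred_def[symmetric])

text \<open>By independence the left side is the probability that \<open>J t\<close> lies in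
  \<open>{1..jmax}\<close> and the honest set changes before level \<open>J t\<close> is complete.
  Rounds with a larger \<open>J t\<close> may be dynamic as well, hence the inequality.\<close>

lemma dynamic_prob:
  assumes t: "t \<in> {1..T}"
  shows "(\<Sum>j = 1..jmax. prob {\<omega> \<in> space M. \<not> stat t j \<omega>} / 2 ^ j)
    \<le> prob {\<omega> \<in> space M. t \<in> dynamic_rounds T J G \<omega>}"
proof -
  define h :: "nat \<Rightarrow> 'w \<Rightarrow> real" where
    "h j \<omega> = (if j \<in> {1..jmax} \<and> \<not> stat t j \<omega> then 1 else 0)" for j \<omega>
  note [measurable] = stat_measurable[OF t] stat_measurable_M[OF t] dynamic_event_measurable[OF t]
  have meas: "h j \<in> borel_measurable (H t (Suc (2 ^ j)))" for j
    unfolding h_def by measurable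
  have int: "integrable M (h j)" for j
  proof (rule integrable_const_bound[of _ 1])
    show "AE \<omega> in M. norm (h j \<omega>) \<le> 1" by (rule AE_I2) (simp add: h_def)
    show "h j \<in> borel_measurable M" unfolding h_def by measurable
  qed
  note sum = level_sum_expectation[OF t meas int]
  have "(\<Sum>j = 1..jmax. prob {\<omega> \<in> space M. \<not> stat t j \<omega>} / 2 ^ j) =
      (\<Sum>j = 1..jmax. (\<integral>\<omega>. h j \<omega> \<partial>M) / 2 ^ j)"
  proof (rule sum.cong)
    fix j assume j: "j \<in> {1..jmax}"
    have "(\<integral>\<omega>. h j \<omega> \<partial>M) = (\<integral>\<omega>. indicator {\<omega> \<in> space M. \<not> stat t j \<omega>} \<omega> \<partial>M)"
      using j by (intro Bochner_Integration.integral_cong) (auto simp: h_def indicator_def)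
    also have "\<dots> = prob {\<omega> \<in> space M. \<not> stat t j \<omega>}" by simp
    finally show "prob {\<omega> \<in> space M. \<not> stat t j \<omega>} / 2 ^ j = (\<integral>\<omega>. h j \<omega> \<partial>M) / 2 ^ j" by simp
  qed simp
  also have "\<dots> = (\<integral>\<omega>. h (J t \<omega>) \<omega> \<partial>M)"
    by (rule sum(2)[symmetric]) (auto simp: h_def)
  also have "\<dots> \<le> (\<integral>\<omega>. indicator {\<omega> \<in> space M. t \<in> dynamic_rounds T J G \<omega>} \<omega> \<partial>M)"
  proof (rule integral_mono)
    show "integrable M (\<lambda>\<omega>. h (J t \<omega>) \<omega>)" by (rule sum(1)) (auto simp: h_def)
    show "integrable M (indicat_real {\<omega> \<in> space M. t \<in> dynamic_rounds T J G \<omega>})"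
      by (rule integrable_const_bound[of _ 1]) (auto simp: indicator_def)
    fix \<omega> assume "\<omega> \<in> space M"
    then show "h (J t \<omega>) \<omega> \<le> indicator {\<omega> \<in> space M. t \<in> dynamic_rounds T J G \<omega>} \<omega>"
      unfolding dynamic_event[OF t] by (auto simp: h_def)
  qed
  also have "\<dots> = prob {\<omega> \<in> space M. t \<in> dynamic_rounds T J G \<omega>}" by simp
  finally show ?thesis .
qed

lemma expected_dynamic_eq:
  "expected_dynamic M T J G = (\<Sum>t = 1..T. prob {\<omega> \<in> space M. t \<in> dynamic_rounds T J G \<omega>})"
proof -
  have int: "integrable M (indicat_real {\<omega> \<in> space M. t \<in> dynamic_rounds T J G \<omega>})" if "t \<in> {1..T}" for t
    using dynamic_event_measurable[OF that]
    by (intro integrable_const_bound[of _ 1]) (auto simp: indicator_def)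
  have "expected_dynamic M T J G =
      (\<integral>\<omega>. (\<Sum>t = 1..T. indicator {\<omega> \<in> space M. t \<in> dynamic_rounds T J G \<omega>} \<omega>) \<partial>M)"
    unfolding expected_dynamic_def
  proof (rule Bochner_Integration.integral_cong)
    fix \<omega> assume \<omega>: "\<omega> \<in> space M"
    have "dynamic_rounds T J G \<omega> \<subseteq> {1..T}" by (auto simp: dynamic_rounds_def)
    then have "real (card (dynamic_rounds T J G \<omega>)) = (\<Sum>t = 1..T. indicator (dynamic_rounds T J G \<omega>) t)"
      by (simp add: indicator_def sum.If_cases Int_absorb1)
    also have "\<dots> = (\<Sum>t = 1..T. indicator {\<omega> \<in> space M. t \<in> dynamic_rounds T J G \<omega>} \<omega>)"
      using \<omega> by (intro sum.cong) (auto simp: indicator_def)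
    finally show "real (card (dynamic_rounds T J G \<omega>)) =
        (\<Sum>t = 1..T. indicator {\<omega> \<in> space M. t \<in> dynamic_rounds T J G \<omega>} \<omega>)" .
  qed simp
  also have "\<dots> = (\<Sum>t = 1..T. prob {\<omega> \<in> space M. t \<in> dynamic_rounds T J G \<omega>})"
    using int dynamic_event_measurable by (subst Bochner_Integration.integral_sum) auto
  finally show ?thesis .
qed

subsection \<open>Descent\<close>

definition crude :: real where
  "crude = 2 * ((2 * \<kappa> + 2) * V\<^sup>2) + 18 * (real jmax)\<^sup>2 * dev\<^sup>2"

lemma crude_nonneg: "0 \<le> crude"
  using kappa_nonneg by (simp add: crude_def)

lemma avg_AE:
  assumes t: "t \<in> {1..T}"
  shows "AE \<omega> in M. (norm (avg t jmax \<omega> - gf (x t \<omega>)))\<^sup>2 \<le> crude"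
  using regular_AE[OF t] unfolding crude_def by eventually_elim (rule avg_crude, auto)

lemma integrable_avg_deviation:
  assumes t: "t \<in> {1..T}"
  shows "integrable M (\<lambda>\<omega>. (norm (avg t jmax \<omega> - gf (x t \<omega>)))\<^sup>2)"
proof (rule integrable_const_bound[of _ crude])
  have t': "t \<in> {1..Suc T}" using t by auto
  note x_measurable_M[OF t', measurable] avg_measurable[OF t, measurable]
  show "(\<lambda>\<omega>. (norm (avg t jmax \<omega> - gf (x t \<omega>)))\<^sup>2) \<in> borel_measurable M" by measurable
qed (use avg_AE[OF t] in simp)

lemma avg_bias:
  assumes t: "t \<in> {1..T}"
  shows "(\<integral>\<omega>. (norm (avg t jmax \<omega> - gf (x t \<omega>)))\<^sup>2 \<partial>M) \<le>
    49 * dev\<^sup>2 * (1 / 2 ^ jmax + 2 * prob {\<omega> \<in> space M. t \<in> dynamic_rounds T J G \<omega>}) +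
    prob {\<omega> \<in> space M. bad t \<omega>} * crude"
proof -
  define E where "E j = {\<omega> \<in> space M. \<not> stat t j \<omega>}" for j
  define Bd where "Bd = {\<omega> \<in> space M. bad t \<omega>}"
  \<comment> \<open>A majorant that is linear in indicators and holds both on and off the bad
    event.\<close>
  define h where "h \<omega> = 49 * dev\<^sup>2 * (1 / 2 ^ jmax + 2 * (\<Sum>j = 1..jmax. indicator (E j) \<omega> / 2 ^ j)) +
    indicator Bd \<omega> * crude" for \<omega>
  have [measurable]: "E j \<in> sets M" for j
    unfolding E_def using stat_measurable_M[OF t] by measurable
  have [measurable]: "Bd \<in> sets M"
    unfolding Bd_def using bad_measurable[OF t] by measurable
  have ind: "integrable M (indicator S :: 'w \<Rightarrow> real)" if "S \<in> sets M" for S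
    using that by (intro integrable_const_bound[of _ 1]) (auto simp: indicator_def)
  have int: "integrable M h" unfolding h_def
    by (intro Bochner_Integration.integrable_add integrable_mult_right integrable_mult_left
        Bochner_Integration.integrable_sum integrable_divide ind) auto
  have "(\<integral>\<omega>. (norm (avg t jmax \<omega> - gf (x t \<omega>)))\<^sup>2 \<partial>M) \<le> (\<integral>\<omega>. h \<omega> \<partial>M)"
  proof (rule integral_mono_AE[OF integrable_avg_deviation[OF t] int])
    show "AE \<omega> in M. (norm (avg t jmax \<omega> - gf (x t \<omega>)))\<^sup>2 \<le> h \<omega>"
      using regular_AE[OF t] avg_AE[OF t] AE_space
    proof eventually_elim
      case (elim \<omega>)
      have nn: "0 \<le> 49 * dev\<^sup>2 * (1 / 2 ^ jmax + 2 * (\<Sum>j = 1..jmax. indicator (E j) \<omega> / 2 ^ j))"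
        by (intro mult_nonneg_nonneg add_nonneg_nonneg sum_nonneg) auto
      show ?case
      proof (cases "bad t \<omega>")
        case True
        then have "\<omega> \<in> Bd" using elim(3) by (simp add: Bd_def)
        then show ?thesis using elim(2) nn by (simp add: h_def)
      next
        case False
        then have "\<omega> \<notin> Bd" by (simp add: Bd_def)
        moreover have "(norm (avg t jmax \<omega> - gf (x t \<omega>)))\<^sup>2 \<le>
            49 * dev\<^sup>2 * (1 / 2 ^ jmax + 2 * (\<Sum>j = 1..jmax. (if stat t j \<omega> then 0 else 1) / 2 ^ j))"
          using t elim(1) False by (intro avg_good) auto
        moreover have "(if stat t j \<omega> then 0 else 1) = (indicator (E j) \<omega> :: real)" for j
          using elim(3) by (simp add: E_def)
        ultimately show ?thesis by (simp add: h_def)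
      qed
    qed
  qed
  also have "(\<integral>\<omega>. h \<omega> \<partial>M) =
      49 * dev\<^sup>2 * (1 / 2 ^ jmax + 2 * (\<Sum>j = 1..jmax. prob (E j) / 2 ^ j)) + prob Bd * crude"
  proof -
    have "(\<integral>\<omega>. (\<Sum>j = 1..jmax. indicator (E j) \<omega> / 2 ^ j) \<partial>M) = (\<Sum>j = 1..jmax. prob (E j) / 2 ^ j)"
    proof (subst Bochner_Integration.integral_sum)
      show "integrable M (\<lambda>\<omega>. indicator (E j) \<omega> / 2 ^ j :: real)" for j
        by (intro integrable_divide ind) simp
    qed simp
    moreover have int': "integrable M (\<lambda>\<omega>. \<Sum>j = 1..jmax. indicator (E j) \<omega> / 2 ^ j :: real)"
      by (intro Bochner_Integration.integrable_sum integrable_divide ind) auto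
    moreover have "integrable M (\<lambda>\<omega>. indicator Bd \<omega> * crude)"
      by (intro integrable_mult_left ind) auto
    ultimately show ?thesis
      unfolding h_def by (simp add: prob_space integrable_mult_right)
  qed
  also have "\<dots> \<le> 49 * dev\<^sup>2 * (1 / 2 ^ jmax + 2 * prob {\<omega> \<in> space M. t \<in> dynamic_rounds T J G \<omega>}) + prob Bd * crude"
    using dynamic_prob[OF t] unfolding E_def
    by (intro add_mono mult_left_mono order_refl) auto
  finally show ?thesis by (simp add: Bd_def)
qed

text \<open>The correction at the random level is replaced by its level average in the linear term
  only; in the quadratic term its second moment is used. Splitting the estimate into gradient,
  level-0 error and correction costs a factor 3, so the gradient enters the quadratic term with 3/2
  L \<eta>^2 \<le> \<eta>/4; this fixes 1/6. Against the \<eta>/2 gained by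
  \<open>inner_decomposition\<close>, \<eta>/4 remains.\<close>

lemma descent:
  assumes t: "t \<in> {1..T}" and \<eta>: "0 \<le> \<eta>" "L * \<eta> \<le> 1 / 6"
  shows "\<eta> / 4 * (\<integral>\<omega>. (norm (gf (x t \<omega>)))\<^sup>2 \<partial>M) \<le>
    (\<integral>\<omega>. f (x t \<omega>) \<partial>M) - (\<integral>\<omega>. f (x (Suc t) \<omega>) \<partial>M)
    + \<eta> / 2 * (\<integral>\<omega>. (norm (avg t jmax \<omega> - gf (x t \<omega>)))\<^sup>2 \<partial>M)
    + 3 / 2 * L * \<eta>\<^sup>2 * ((2 * \<kappa> + 2) * V\<^sup>2 + 9 * real jmax * dev\<^sup>2)"
proof -
  have t': "t \<in> {1..Suc T}" "Suc t \<in> {1..Suc T}" using t by auto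
  note [measurable] = x_measurable_M[OF t'(1)] agg_measurable_M[OF t] avg_measurable[OF t] corr_J_measurable[OF t]
  define u where "u \<omega> = gf (x t \<omega>)" for \<omega>
  define a where "a \<omega> = agg t 0 \<omega>" for \<omega>
  define c where "c \<omega> = corr t (J t \<omega>) \<omega>" for \<omega>
  define s where "s \<omega> = (\<Sum>j = 1..jmax. (1 / 2 ^ j) *\<^sub>R corr t j \<omega>)" for \<omega>
  have avg: "avg t jmax \<omega> = a \<omega> + s \<omega>" for \<omega> by (simp add: avg_def a_def s_def)
  obtain b where b: "AE \<omega> in M. norm (u \<omega>) \<le> b" using gradient_bounded[OF t'(1)] by (auto simp: u_def)
  have int_f: "integrable M (\<lambda>\<omega>. f (x t \<omega>))" "integrable M (\<lambda>\<omega>. f (x (Suc t) \<omega>))"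
    using integrable_objective t' by auto
  have int_u: "integrable M (\<lambda>\<omega>. (norm (u \<omega>))\<^sup>2)"
    unfolding u_def by (rule integrable_gradient[OF t'(1)])
  have int_a: "integrable M (\<lambda>\<omega>. (norm (a \<omega> - u \<omega>))\<^sup>2)"
    by (rule integrable_const_bound[of _ "(2 * \<kappa> + 2) * V\<^sup>2"])
       (use agg_0_AE[OF t] in \<open>simp_all add: a_def u_def\<close>)
  have int_c: "integrable M (\<lambda>\<omega>. (norm (c \<omega>))\<^sup>2)"
    unfolding c_def by (rule corr_second_moment(1)[OF t])
  have int_avg: "integrable M (\<lambda>\<omega>. (norm (a \<omega> + s \<omega> - u \<omega>))\<^sup>2)"
    using integrable_avg_deviation[OF t] by (simp add: avg u_def)
  have int_ua: "integrable M (\<lambda>\<omega>. u \<omega> \<bullet> a \<omega>)"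
    unfolding u_def
  proof (rule integrable_inner_gradient[OF t])
    show "a \<in> borel_measurable M" unfolding a_def by measurable
    show "AE \<omega> in M. norm (a \<omega>) \<le> b + sqrt ((2 * \<kappa> + 2) * V\<^sup>2)"
      using b agg_0_AE[OF t]
    proof eventually_elim
      case (elim \<omega>)
      have "norm (a \<omega> - u \<omega>) \<le> sqrt ((2 * \<kappa> + 2) * V\<^sup>2)"
        using elim(2) unfolding a_def u_def by (rule real_le_rsqrt)
      then show ?case using elim(1) norm_triangle_sub[of "a \<omega>" "u \<omega>"] by linarith
    qed
  qed
  have int_uc: "integrable M (\<lambda>\<omega>. u \<omega> \<bullet> c \<omega>)"
    unfolding u_def
  proof (rule integrable_inner_gradient[OF t])
    show "c \<in> borel_measurable M" unfolding c_def by measurable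
    show "AE \<omega> in M. norm (c \<omega>) \<le> (1 + sqrt 2) * dev * sqrt (2 ^ jmax)"
      unfolding c_def by (rule AE_I2) (rule corr_uniform_bound)
  qed
  have int_us: "integrable M (\<lambda>\<omega>. u \<omega> \<bullet> s \<omega>)"
  proof -
    have "integrable M (\<lambda>\<omega>. \<Sum>j = 1..jmax. (u \<omega> \<bullet> corr t j \<omega>) / 2 ^ j)"
      unfolding u_def
      by (intro Bochner_Integration.integrable_sum integrable_divide
          integrable_inner_gradient[OF t corr_measurable_M[OF t], of _ "(1 + sqrt 2) * dev * sqrt (2 ^ jmax)"]
          AE_I2 corr_uniform_bound)
    then show ?thesis by (simp add: s_def inner_sum_right)
  qed
  have path: "f (x (Suc t) \<omega>) \<le> f (x t \<omega>) - \<eta> * (u \<omega> \<bullet> a \<omega> + u \<omega> \<bullet> c \<omega>)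
      + (\<eta> / 4 * (norm (u \<omega>))\<^sup>2 + 3 / 2 * L * \<eta>\<^sup>2 * ((norm (a \<omega> - u \<omega>))\<^sup>2 + (norm (c \<omega>))\<^sup>2))"
    if \<omega>: "\<omega> \<in> space M" for \<omega>
  proof -
    have x': "x (Suc t) \<omega> - x t \<omega> = - \<eta> *\<^sub>R (a \<omega> + c \<omega>)"
      using update_corr[OF t \<omega>] by (simp add: a_def c_def)
    have "f (x (Suc t) \<omega>) \<le> f (x t \<omega>) + u \<omega> \<bullet> (x (Suc t) \<omega> - x t \<omega>) + L / 2 * (norm (x (Suc t) \<omega> - x t \<omega>))\<^sup>2"
      using smooth_f unfolding smooth_def u_def by blast
    also have "\<dots> = f (x t \<omega>) - \<eta> * (u \<omega> \<bullet> a \<omega> + u \<omega> \<bullet> c \<omega>) + L / 2 * \<eta>\<^sup>2 * (norm (a \<omega> + c \<omega>))\<^sup>2"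
      unfolding x' by (simp add: inner_add_right power_mult_distrib)
    also have "L / 2 * \<eta>\<^sup>2 * (norm (a \<omega> + c \<omega>))\<^sup>2 \<le>
        L / 2 * \<eta>\<^sup>2 * (3 * ((norm (u \<omega>))\<^sup>2 + (norm (a \<omega> - u \<omega>))\<^sup>2 + (norm (c \<omega>))\<^sup>2))"
    proof (rule mult_left_mono)
      define p q r where "p = norm (u \<omega>)" and "q = norm (a \<omega> - u \<omega>)" and "r = norm (c \<omega>)"
      have "norm (a \<omega> + c \<omega>) = norm (u \<omega> + (a \<omega> - u \<omega>) + c \<omega>)" by simp
      also have "\<dots> \<le> p + q + r"
        unfolding p_def q_def r_def by (intro norm_triangle_mono order_refl)
      finally have "(norm (a \<omega> + c \<omega>))\<^sup>2 \<le> (p + q + r)\<^sup>2" by (rule power_mono) simp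
      also have "\<dots> = 3 * (p\<^sup>2 + q\<^sup>2 + r\<^sup>2) - (p - q)\<^sup>2 - (q - r)\<^sup>2 - (p - r)\<^sup>2"
        by (simp add: power2_eq_square algebra_simps)
      also have "\<dots> \<le> 3 * (p\<^sup>2 + q\<^sup>2 + r\<^sup>2)"
        using zero_le_power2[of "p - q"] zero_le_power2[of "q - r"] zero_le_power2[of "p - r"] by linarith
      finally show "(norm (a \<omega> + c \<omega>))\<^sup>2 \<le> 3 * ((norm (u \<omega>))\<^sup>2 + (norm (a \<omega> - u \<omega>))\<^sup>2 + (norm (c \<omega>))\<^sup>2)"
        by (simp add: p_def q_def r_def)
    qed (use L_pos in simp)
    also have "\<dots> = 3 / 2 * (L * \<eta>) * \<eta> * (norm (u \<omega>))\<^sup>2 + 3 / 2 * L * \<eta>\<^sup>2 * ((norm (a \<omega> - u \<omega>))\<^sup>2 + (norm (c \<omega>))\<^sup>2)"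
      by (simp add: power2_eq_square algebra_simps)
    also have "3 / 2 * (L * \<eta>) * \<eta> * (norm (u \<omega>))\<^sup>2 \<le> \<eta> / 4 * (norm (u \<omega>))\<^sup>2"
    proof (rule mult_right_mono)
      have "(L * \<eta>) * \<eta> \<le> 1 / 6 * \<eta>" by (rule mult_right_mono[OF \<eta>(2,1)])
      then show "3 / 2 * (L * \<eta>) * \<eta> \<le> \<eta> / 4" by simp
    qed simp
    finally show ?thesis by simp
  qed
  have "(\<integral>\<omega>. f (x (Suc t) \<omega>) \<partial>M) \<le> (\<integral>\<omega>. f (x t \<omega>) - \<eta> * (u \<omega> \<bullet> a \<omega> + u \<omega> \<bullet> c \<omega>)
      + (\<eta> / 4 * (norm (u \<omega>))\<^sup>2 + 3 / 2 * L * \<eta>\<^sup>2 * ((norm (a \<omega> - u \<omega>))\<^sup>2 + (norm (c \<omega>))\<^sup>2)) \<partial>M)"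
  proof (rule integral_mono[OF int_f(2) _ path])
    show "integrable M (\<lambda>\<omega>. f (x t \<omega>) - \<eta> * (u \<omega> \<bullet> a \<omega> + u \<omega> \<bullet> c \<omega>)
      + (\<eta> / 4 * (norm (u \<omega>))\<^sup>2 + 3 / 2 * L * \<eta>\<^sup>2 * ((norm (a \<omega> - u \<omega>))\<^sup>2 + (norm (c \<omega>))\<^sup>2)))"
      by (intro Bochner_Integration.integrable_add Bochner_Integration.integrable_diff
          integrable_mult_right int_f int_ua int_uc int_u int_a int_c)
  qed
  also have "\<dots> = (\<integral>\<omega>. f (x t \<omega>) \<partial>M) - \<eta> * ((\<integral>\<omega>. u \<omega> \<bullet> a \<omega> \<partial>M) + (\<integral>\<omega>. u \<omega> \<bullet> c \<omega> \<partial>M))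
      + (\<eta> / 4 * (\<integral>\<omega>. (norm (u \<omega>))\<^sup>2 \<partial>M) + 3 / 2 * L * \<eta>\<^sup>2 * ((\<integral>\<omega>. (norm (a \<omega> - u \<omega>))\<^sup>2 \<partial>M) + (\<integral>\<omega>. (norm (c \<omega>))\<^sup>2 \<partial>M)))"
    by (simp add: int_f int_ua int_uc int_u int_a int_c)
  also have "(\<integral>\<omega>. u \<omega> \<bullet> c \<omega> \<partial>M) = (\<integral>\<omega>. u \<omega> \<bullet> s \<omega> \<partial>M)"
    unfolding u_def c_def s_def by (rule inner_corr[OF t])
  also have "(\<integral>\<omega>. u \<omega> \<bullet> a \<omega> \<partial>M) + (\<integral>\<omega>. u \<omega> \<bullet> s \<omega> \<partial>M) = (\<integral>\<omega>. u \<omega> \<bullet> (a \<omega> + s \<omega>) \<partial>M)"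
    by (simp add: inner_add_right int_ua int_us)
  finally have main: "(\<integral>\<omega>. f (x (Suc t) \<omega>) \<partial>M) \<le> (\<integral>\<omega>. f (x t \<omega>) \<partial>M) - \<eta> * (\<integral>\<omega>. u \<omega> \<bullet> (a \<omega> + s \<omega>) \<partial>M)
      + (\<eta> / 4 * (\<integral>\<omega>. (norm (u \<omega>))\<^sup>2 \<partial>M) + 3 / 2 * L * \<eta>\<^sup>2 * ((\<integral>\<omega>. (norm (a \<omega> - u \<omega>))\<^sup>2 \<partial>M) + (\<integral>\<omega>. (norm (c \<omega>))\<^sup>2 \<partial>M)))" .
  have "(\<integral>\<omega>. (norm (u \<omega>))\<^sup>2 / 2 - (norm (a \<omega> + s \<omega> - u \<omega>))\<^sup>2 / 2 \<partial>M) \<le> (\<integral>\<omega>. u \<omega> \<bullet> (a \<omega> + s \<omega>) \<partial>M)"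
  proof (rule integral_mono)
    show "integrable M (\<lambda>\<omega>. u \<omega> \<bullet> (a \<omega> + s \<omega>))"
      unfolding inner_add_right using int_ua int_us by (rule Bochner_Integration.integrable_add)
  qed (use int_u int_avg inner_decomposition in auto)
  then have "\<eta> * ((\<integral>\<omega>. (norm (u \<omega>))\<^sup>2 \<partial>M) / 2 - (\<integral>\<omega>. (norm (a \<omega> + s \<omega> - u \<omega>))\<^sup>2 \<partial>M) / 2) \<le>
      \<eta> * (\<integral>\<omega>. u \<omega> \<bullet> (a \<omega> + s \<omega>) \<partial>M)"
    using int_u int_avg by (intro mult_left_mono[OF _ \<eta>(1)]) simp
  moreover have "3 / 2 * L * \<eta>\<^sup>2 * ((\<integral>\<omega>. (norm (a \<omega> - u \<omega>))\<^sup>2 \<partial>M) + (\<integral>\<omega>. (norm (c \<omega>))\<^sup>2 \<partial>M)) \<le>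
      3 / 2 * L * \<eta>\<^sup>2 * ((2 * \<kappa> + 2) * V\<^sup>2 + 9 * real jmax * dev\<^sup>2)"
  proof (intro mult_left_mono add_mono)
    have "(\<integral>\<omega>. (norm (a \<omega> - u \<omega>))\<^sup>2 \<partial>M) \<le> (\<integral>\<omega>. (2 * \<kappa> + 2) * V\<^sup>2 \<partial>M)"
      by (rule integral_mono_AE[OF int_a]) (use agg_0_AE[OF t] in \<open>simp_all add: a_def u_def\<close>)
    then show "(\<integral>\<omega>. (norm (a \<omega> - u \<omega>))\<^sup>2 \<partial>M) \<le> (2 * \<kappa> + 2) * V\<^sup>2" by (simp add: prob_space)
    show "(\<integral>\<omega>. (norm (c \<omega>))\<^sup>2 \<partial>M) \<le> 9 * real jmax * dev\<^sup>2"
      unfolding c_def by (rule corr_second_moment(2)[OF t])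
  qed (use L_pos in simp)
  moreover have "\<eta> * ((\<integral>\<omega>. (norm (u \<omega>))\<^sup>2 \<partial>M) / 2 - (\<integral>\<omega>. (norm (a \<omega> + s \<omega> - u \<omega>))\<^sup>2 \<partial>M) / 2) =
      \<eta> / 2 * (\<integral>\<omega>. (norm (u \<omega>))\<^sup>2 \<partial>M) - \<eta> / 2 * (\<integral>\<omega>. (norm (a \<omega> + s \<omega> - u \<omega>))\<^sup>2 \<partial>M)"
    by (simp add: right_diff_distrib)
  moreover have "(\<integral>\<omega>. (norm (a \<omega> + s \<omega> - u \<omega>))\<^sup>2 \<partial>M) = (\<integral>\<omega>. (norm (avg t jmax \<omega> - gf (x t \<omega>)))\<^sup>2 \<partial>M)"
    by (simp add: avg u_def)
  ultimately show ?thesis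
    using main by (simp add: u_def[symmetric])
qed

lemma objective_sum:
  assumes "T > 0"
  shows "(\<Sum>t = 1..T. (\<integral>\<omega>. f (x t \<omega>) \<partial>M) - (\<integral>\<omega>. f (x (Suc t) \<omega>) \<partial>M)) \<le> f x1 - (INF y. f y)"
proof -
  have "(\<Sum>t = 1..T. (\<integral>\<omega>. f (x t \<omega>) \<partial>M) - (\<integral>\<omega>. f (x (Suc t) \<omega>) \<partial>M)) =
      (\<integral>\<omega>. f (x 1 \<omega>) \<partial>M) - (\<integral>\<omega>. f (x (Suc T) \<omega>) \<partial>M)"
    using sum_Suc_diff[of 1 T "\<lambda>t. - (\<integral>\<omega>. f (x t \<omega>) \<partial>M)"] assms by simp
  also have "(\<integral>\<omega>. f (x 1 \<omega>) \<partial>M) = (\<integral>\<omega>. f x1 \<partial>M)"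
    by (rule Bochner_Integration.integral_cong) (use start in auto)
  also have "\<dots> = f x1" by (simp add: prob_space)
  finally have "(\<Sum>t = 1..T. (\<integral>\<omega>. f (x t \<omega>) \<partial>M) - (\<integral>\<omega>. f (x (Suc t) \<omega>) \<partial>M)) =
      f x1 - (\<integral>\<omega>. f (x (Suc T) \<omega>) \<partial>M)" .
  moreover have "(INF y. f y) \<le> (\<integral>\<omega>. f (x (Suc T) \<omega>) \<partial>M)"
  proof -
    have "(\<integral>\<omega>. (INF y. f y) \<partial>M) \<le> (\<integral>\<omega>. f (x (Suc T) \<omega>) \<partial>M)"
      by (rule integral_mono) (use integrable_objective[of "Suc T"] bdd_f in \<open>auto intro: cINF_lower\<close>)
    then show ?thesis by (simp add: prob_space)
  qed
  ultimately show ?thesis by linarith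
qed

lemma mean_sq_gradient_bound:
  assumes T: "T > 0" and \<eta>: "0 < \<eta>" "L * \<eta> \<le> 1 / 6"
    and p: "\<And>t. t \<in> {1..T} \<Longrightarrow> prob {\<omega> \<in> space M. bad t \<omega>} \<le> p"
  shows "mean_sq_gradient M gf T x \<le> 4 * (f x1 - (INF y. f y)) / (\<eta> * real T)
    + 2 * (49 * dev\<^sup>2 * (1 / 2 ^ jmax + 2 * (expected_dynamic M T J G / real T)) + p * crude)
    + 6 * L * \<eta> * ((2 * \<kappa> + 2) * V\<^sup>2 + 9 * real jmax * dev\<^sup>2)"
proof -
  define g where "g t = (\<integral>\<omega>. (norm (gf (x t \<omega>)))\<^sup>2 \<partial>M)" for t
  define F where "F t = (\<integral>\<omega>. f (x t \<omega>) \<partial>M)" for t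
  define q where "q t = prob {\<omega> \<in> space M. t \<in> dynamic_rounds T J G \<omega>}" for t
  define e where "e = (2 * \<kappa> + 2) * V\<^sup>2 + 9 * real jmax * dev\<^sup>2"
  define Q where "Q = (\<Sum>t = 1..T. q t)"
  have Q: "expected_dynamic M T J G = Q" by (simp add: expected_dynamic_eq Q_def q_def)
  have step: "\<eta> / 4 * g t \<le> F t - F (Suc t) + \<eta> / 2 * (49 * dev\<^sup>2 * (1 / 2 ^ jmax + 2 * q t) + p * crude) + 3 / 2 * L * \<eta>\<^sup>2 * e"
    if t: "t \<in> {1..T}" for t
  proof -
    have "(\<integral>\<omega>. (norm (avg t jmax \<omega> - gf (x t \<omega>)))\<^sup>2 \<partial>M) \<le> 49 * dev\<^sup>2 * (1 / 2 ^ jmax + 2 * q t) + p * crude"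
      using avg_bias[OF t] mult_right_mono[OF p[OF t] crude_nonneg] by (simp add: q_def)
    then have "\<eta> / 2 * (\<integral>\<omega>. (norm (avg t jmax \<omega> - gf (x t \<omega>)))\<^sup>2 \<partial>M) \<le>
        \<eta> / 2 * (49 * dev\<^sup>2 * (1 / 2 ^ jmax + 2 * q t) + p * crude)"
      using \<eta>(1) by (intro mult_left_mono) auto
    with descent[OF t less_imp_le[OF \<eta>(1)] \<eta>(2)] show ?thesis
      unfolding g_def F_def e_def by linarith
  qed
  have "\<eta> / 4 * (\<Sum>t = 1..T. g t) = (\<Sum>t = 1..T. \<eta> / 4 * g t)" by (rule sum_distrib_left)
  also have "\<dots> \<le> (\<Sum>t = 1..T. F t - F (Suc t) + \<eta> / 2 * (49 * dev\<^sup>2 * (1 / 2 ^ jmax + 2 * q t) + p * crude) + 3 / 2 * L * \<eta>\<^sup>2 * e)"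
    by (rule sum_mono) (rule step)
  also have "\<dots> = (\<Sum>t = 1..T. F t - F (Suc t)) + (\<eta> / 2 * (\<Sum>t = 1..T. 49 * dev\<^sup>2 * (1 / 2 ^ jmax + 2 * q t) + p * crude) + real T * (3 / 2 * L * \<eta>\<^sup>2 * e))"
    by (simp only: sum.distrib sum_distrib_left[symmetric] sum_constant card_atLeastAtMost) simp
  also have "(\<Sum>t = 1..T. 49 * dev\<^sup>2 * (1 / 2 ^ jmax + 2 * q t) + p * crude) =
      49 * dev\<^sup>2 * (real T * (1 / 2 ^ jmax) + 2 * Q) + real T * (p * crude)"
    unfolding Q_def by (simp only: sum.distrib sum_distrib_left[symmetric] sum_constant card_atLeastAtMost) simp
  also have "(\<Sum>t = 1..T. F t - F (Suc t)) \<le> f x1 - (INF y. f y)"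
    unfolding F_def by (rule objective_sum[OF T])
  finally have "\<eta> / 4 * (\<Sum>t = 1..T. g t) \<le> f x1 - (INF y. f y) +
      (\<eta> / 2 * (49 * dev\<^sup>2 * (real T * (1 / 2 ^ jmax) + 2 * Q) + real T * (p * crude)) + real T * (3 / 2 * L * \<eta>\<^sup>2 * e))"
    by simp
  then have "(\<eta> / 4 * (\<Sum>t = 1..T. g t)) * (4 / (\<eta> * real T)) \<le> (f x1 - (INF y. f y) +
      (\<eta> / 2 * (49 * dev\<^sup>2 * (real T * (1 / 2 ^ jmax) + 2 * Q) + real T * (p * crude)) + real T * (3 / 2 * L * \<eta>\<^sup>2 * e))) * (4 / (\<eta> * real T))"
    by (rule mult_right_mono) (use \<eta> in simp)
  also have "(\<eta> / 4 * (\<Sum>t = 1..T. g t)) * (4 / (\<eta> * real T)) = mean_sq_gradient M gf T x"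
    using \<eta>(1) T by (simp add: mean_sq_gradient_def g_def)
  also have "(f x1 - (INF y. f y) +
      (\<eta> / 2 * (49 * dev\<^sup>2 * (real T * (1 / 2 ^ jmax) + 2 * Q) + real T * (p * crude)) + real T * (3 / 2 * L * \<eta>\<^sup>2 * e))) * (4 / (\<eta> * real T))
    = 4 * (f x1 - (INF y. f y)) / (\<eta> * real T)
    + 2 * (49 * dev\<^sup>2 * (1 / 2 ^ jmax + 2 * (Q / real T)) + p * crude) + 6 * L * \<eta> * e"
  proof -
    have "(d + (\<eta> / 2 * (k * (real T * j + 2 * Q) + real T * c) + real T * (3 / 2 * L * \<eta>\<^sup>2 * e))) * (4 / (\<eta> * real T))
        = 4 * d / (\<eta> * real T) + 2 * (k * (j + 2 * (Q / real T)) + c) + 6 * L * \<eta> * e" for d k j c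
      using \<eta>(1) T by (simp add: field_simps power2_eq_square)
    then show ?thesis .
  qed
  finally show ?thesis by (simp add: Q e_def)
qed

section \<open>Degenerate cases: no noise, or a start at a minimiser\<close>

text \<open>Without noise the filter threshold is 0, every correction vanishes, and a robust rule
  returns the common honest vector: the run is exact gradient descent. Its step 1/L violates the 1/6
  of \<open>descent\<close>, hence the separate computation.\<close>

lemma mean_sq_gradient_noiseless:
  assumes T: "T > 0" and V: "V = 0" and \<eta>: "\<eta> = 1 / L"
  shows "mean_sq_gradient M gf T x \<le> 2 * L * (f x1 - (INF y. f y)) / real T"
proof -
  have dev: "dev = 0" unfolding dev_def by (simp add: V)
  have step: "(\<integral>\<omega>. (norm (gf (x t \<omega>)))\<^sup>2 \<partial>M) \<le> 2 * L * ((\<integral>\<omega>. f (x t \<omega>) \<partial>M) - (\<integral>\<omega>. f (x (Suc t) \<omega>) \<partial>M))"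
    if t: "t \<in> {1..T}" for t
  proof -
    have t': "t \<in> {1..Suc T}" "Suc t \<in> {1..Suc T}" using t by auto
    note int = integrable_objective[OF t'(1)] integrable_objective[OF t'(2)]
    have "(\<integral>\<omega>. (norm (gf (x t \<omega>)))\<^sup>2 \<partial>M) \<le> (\<integral>\<omega>. 2 * L * (f (x t \<omega>) - f (x (Suc t) \<omega>)) \<partial>M)"
    proof (rule integral_mono_AE[OF integrable_gradient[OF t'(1)]])
      show "integrable M (\<lambda>\<omega>. 2 * L * (f (x t \<omega>) - f (x (Suc t) \<omega>)))"
        using int by simp
      show "AE \<omega> in M. (norm (gf (x t \<omega>)))\<^sup>2 \<le> 2 * L * (f (x t \<omega>) - f (x (Suc t) \<omega>))"
        using agg_0_AE[OF t] AE_space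
      proof eventually_elim
        case (elim \<omega>)
        define u where "u = gf (x t \<omega>)"
        have "corr t (J t \<omega>) \<omega> = 0" using corr_bound[of t "J t \<omega>" \<omega>] dev by simp
        moreover have "agg t 0 \<omega> = u" using elim(1) V by (simp add: u_def)
        ultimately have x': "x (Suc t) \<omega> - x t \<omega> = - (1 / L) *\<^sub>R u"
          using update_corr[OF t elim(2)] by (simp add: \<eta>)
        have "f (x (Suc t) \<omega>) \<le> f (x t \<omega>) + u \<bullet> (x (Suc t) \<omega> - x t \<omega>) + L / 2 * (norm (x (Suc t) \<omega> - x t \<omega>))\<^sup>2"
          using smooth_f unfolding smooth_def u_def by blast
        also have "\<dots> = f (x t \<omega>) - (norm u)\<^sup>2 / L + L / 2 * ((norm u)\<^sup>2 / L\<^sup>2)"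
          unfolding x' using L_pos by (simp add: power_divide power2_norm_eq_inner)
        also have "\<dots> = f (x t \<omega>) - (norm u)\<^sup>2 / (2 * L)"
          using L_pos by (simp add: field_simps power2_eq_square)
        finally show ?case using L_pos by (simp add: u_def field_simps)
      qed
    qed
    also have "\<dots> = 2 * L * ((\<integral>\<omega>. f (x t \<omega>) \<partial>M) - (\<integral>\<omega>. f (x (Suc t) \<omega>) \<partial>M))"
      using int by simp
    finally show ?thesis .
  qed
  have "(\<Sum>t = 1..T. (\<integral>\<omega>. (norm (gf (x t \<omega>)))\<^sup>2 \<partial>M)) \<le>
      (\<Sum>t = 1..T. 2 * L * ((\<integral>\<omega>. f (x t \<omega>) \<partial>M) - (\<integral>\<omega>. f (x (Suc t) \<omega>) \<partial>M)))"
    by (rule sum_mono) (rule step)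
  also have "\<dots> = 2 * L * (\<Sum>t = 1..T. (\<integral>\<omega>. f (x t \<omega>) \<partial>M) - (\<integral>\<omega>. f (x (Suc t) \<omega>) \<partial>M))"
    by (rule sum_distrib_left[symmetric])
  also have "\<dots> \<le> 2 * L * (f x1 - (INF y. f y))"
    using objective_sum[OF T] L_pos by (intro mult_left_mono) auto
  finally show ?thesis by (simp add: mean_sq_gradient_def divide_right_mono)
qed

text \<open>The case \<Delta> = 0, in which the learning rate degenerates to 0 and the iterates
  never leave the minimiser.\<close>

lemma mean_sq_gradient_stationary:
  assumes "\<eta> = 0" and min: "f x1 = (INF y. f y)"
  shows "mean_sq_gradient M gf T x = 0"
proof -
  have x: "\<omega> \<in> space M \<Longrightarrow> x t \<omega> = x1" if "1 \<le> t" "t \<le> Suc T" for t \<omega>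
    using that
  proof (induction t rule: dec_induct)
    case base
    then show ?case using start[of \<omega>] by simp
  next
    case (step t)
    then show ?case using update_corr[of t \<omega>] assms(1) by simp
  qed
  have "gf x1 = 0"
    using smooth_gradient_bound[OF smooth_f L_pos bdd_f, of x1] min by simp
  then have "(\<integral>\<omega>. (norm (gf (x t \<omega>)))\<^sup>2 \<partial>M) = 0" if "t \<in> {1..T}" for t
  proof -
    have "(\<integral>\<omega>. (norm (gf (x t \<omega>)))\<^sup>2 \<partial>M) = (\<integral>\<omega>. 0 \<partial>M)"
      using that x[of t] \<open>gf x1 = 0\<close> by (intro Bochner_Integration.integral_cong) auto
    then show ?thesis by simp
  qed
  then show ?thesis by (simp add: mean_sq_gradient_def)
qed

section \<open>Facts read off a run, and the bound in explicit form\<close>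

text \<open>Nonnegativity is not assumed of \<delta>; it follows from the existence of a run, as no
  honest set exceeds the set of all workers.\<close>

lemma delta_nonneg:
  assumes "T > 0"
  shows "0 \<le> \<delta>"
proof -
  obtain \<omega> where \<omega>: "\<omega> \<in> space M" using not_empty by blast
  have "(1 - \<delta>) * real CARD('m) = real (card (G 1 1 \<omega>))"
    using honest_card[of 1 \<omega> 1] assms \<omega> by simp
  also have "\<dots> \<le> 1 * real CARD('m)" by (simp add: card_mono)
  finally show ?thesis by (simp add: mult_le_cancel_right)
qed

lemma expected_dynamic_nonneg: "0 \<le> expected_dynamic M T J G"
  by (simp add: expected_dynamic_def)

lemma expected_dynamic_static:
  assumes "AE \<omega> in M. dynamic_rounds T J G \<omega> = {}"
  shows "expected_dynamic M T J G = 0"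
proof -
  have "AE \<omega> in M. real (card (dynamic_rounds T J G \<omega>)) = 0"
    using assms by eventually_elim simp
  then show ?thesis unfolding expected_dynamic_def by (rule integral_eq_zero_AE)
qed

lemma jmax_bounds:
  assumes "T > 0"
  shows "real jmax \<le> log 2 (real T)" "1 / 2 ^ jmax \<le> 2 / real T"
proof -
  have nn: "0 \<le> log 2 (real T)" using assms by simp
  then have j: "real jmax = of_int \<lfloor>log 2 (real T)\<rfloor>" by (simp add: jmax_def)
  then show "real jmax \<le> log 2 (real T)" by simp
  have "log 2 (real T) < real (Suc jmax)" using j by linarith
  then have "real T < 2 powr real (Suc jmax)" using assms by (simp add: log_less_iff)
  also have "\<dots> = 2 * 2 ^ jmax" by (subst powr_realpow) auto
  finally show "1 / 2 ^ jmax \<le> 2 / real T" using assms by (simp add: field_simps)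
qed

text \<open>Everything on the right depends on \<open>T\<close> and the problem, with
  \<open>expected_dynamic\<close> as the only trace of the run. Both constants 196 are 2 * 49 * 2,
  one factor 2 coming from 1 / 2^jmax \<le> 2 / T and the other from
  \<open>avg_good\<close>.\<close>

lemma mean_sq_gradient_explicit:
  fixes U :: "'a set"
  assumes T: "T > 0" and V: "V > 0" and \<eta>: "0 < \<eta>" "L * \<eta> \<le> 1 / 6"
    and U: "finite U" "U \<subseteq> sphere 0 1" "\<And>v::'a. \<exists>u\<in>U. 3 / 4 * norm v \<le> u \<bullet> v"
  defines "l \<equiv> log 2 (real T)"
    and "d \<equiv> \<gamma> * (Cconst CARD('m) T)\<^sup>2 * V\<^sup>2"
    and "e \<equiv> (2 * \<kappa> + 2) * V\<^sup>2"
    and "p \<equiv> (log 2 (real T) + 1) * 2 ^ CARD('m) * real (card U) * exp (- (9 / 16 * log 2 (16 * (real CARD('m))\<^sup>2 * real T)))"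
  shows "mean_sq_gradient M gf T x \<le> 4 * (f x1 - (INF y. f y)) / (\<eta> * real T)
    + 196 * d / real T + 196 * d * (expected_dynamic M T J G / real T)
    + 2 * (p * (2 * e + 18 * l\<^sup>2 * d)) + 6 * L * \<eta> * (e + 9 * l * d)"
proof -
  have d: "d = dev\<^sup>2"
    using gamma_pos by (simp add: d_def dev_def power_mult_distrib)
  have j: "real jmax \<le> l" "1 / 2 ^ jmax \<le> 2 / real T"
    using jmax_bounds[OF T] by (auto simp: l_def)
  have d0: "0 \<le> d" by (simp add: d)
  have e0: "0 \<le> e" using kappa_nonneg by (simp add: e_def)
  have p: "prob {\<omega> \<in> space M. bad t \<omega>} \<le> p" if "t \<in> {1..T}" for t
  proof -
    have "(real jmax + 1) * 2 ^ CARD('m) * real (card U) * exp (- (9 / 16 * log 2 (16 * (real CARD('m))\<^sup>2 * real T))) \<le> p"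
      unfolding p_def using j(1) by (intro mult_right_mono) (auto simp: l_def)
    with bad_prob[OF that V U] show ?thesis by linarith
  qed
  have p0: "0 \<le> p" by (rule order_trans[OF measure_nonneg p[of 1]]) (use T in simp)
  have crude: "crude \<le> 2 * e + 18 * l\<^sup>2 * d"
    unfolding crude_def e_def[symmetric] d[symmetric]
    using j(1) d0 by (intro add_mono mult_right_mono mult_left_mono power_mono) auto
  have "mean_sq_gradient M gf T x \<le> 4 * (f x1 - (INF y. f y)) / (\<eta> * real T)
    + 2 * (49 * d * (1 / 2 ^ jmax + 2 * (expected_dynamic M T J G / real T)) + p * crude)
    + 6 * L * \<eta> * (e + 9 * real jmax * d)"
    unfolding d e_def by (rule mean_sq_gradient_bound[OF T \<eta> p])
  also have "\<dots> \<le> 4 * (f x1 - (INF y. f y)) / (\<eta> * real T)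
    + 2 * (49 * d * (2 / real T + 2 * (expected_dynamic M T J G / real T)) + p * (2 * e + 18 * l\<^sup>2 * d))
    + 6 * L * \<eta> * (e + 9 * l * d)"
    using j d0 p0 crude \<eta>(1) L_pos
    by (intro add_mono order_refl mult_left_mono mult_right_mono) auto
  also have "\<dots> = 4 * (f x1 - (INF y. f y)) / (\<eta> * real T)
    + 196 * d / real T + 196 * d * (expected_dynamic M T J G / real T)
    + 2 * (p * (2 * e + 18 * l\<^sup>2 * d)) + 6 * L * \<eta> * (e + 9 * l * d)"
    by (simp add: algebra_simps)
  finally show ?thesis .
qed

end

subsection \<open>Asymptotics\<close>

lemma log_at_top: "filterlim (\<lambda>T::nat. log 2 (real T)) at_top sequentially"
  by real_asymp

text \<open>What remains of T^(-3/4) after division by the target rate T^(-1/2). Of the four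
  logarithms one counts the levels in the union bound and three belong to the crude bias.\<close>

lemma log_power_decay: "(\<lambda>T::nat. (log 2 (real T)) ^ 4 * real T powr (- 1 / 4)) \<longlonglongrightarrow> 0"
  by real_asymp

text \<open>9/16 * log 2 y equals 9 / (16 ln 2) * ln y, and ln 2 \<le> 3/4 makes this at least 3/4 *
  ln y. Any exponent beyond 1/2 would be enough for the rate.\<close>

lemma exp_log_tail:
  assumes "1 \<le> m" "1 \<le> T"
  shows "exp (- (9 / 16 * log 2 (16 * (real m)\<^sup>2 * real T))) \<le> real T powr (- 3 / 4)"
proof -
  define y where "y = 16 * (real m)\<^sup>2 * real T"
  have "1 * 1 * real T \<le> y"
    unfolding y_def using assms by (intro mult_mono) (auto simp: one_le_power)
  then have y: "real T \<le> y" "1 \<le> y" using assms by auto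
  \<comment> \<open>1 + 3/4 + 9/32 > 2.\<close>
  have "2 \<le> exp (3 / 4 :: real)"
    using exp_lower_Taylor_quadratic[of "3 / 4"] by (simp add: power2_eq_square)
  then have "ln 2 \<le> ln (exp (3 / 4 :: real))" by (subst ln_le_cancel_iff) auto
  then have "ln 2 \<le> (3 / 4 :: real)" by simp
  moreover have "0 < ln (2 :: real)" by simp
  ultimately have "3 / 4 * ln 2 * ln y \<le> 3 / 4 * (3 / 4) * ln y"
    using y by (intro mult_right_mono) auto
  then have "3 / 4 * ln y \<le> 9 / 16 * (ln y / ln 2)"
    using \<open>0 < ln 2\<close> by (simp add: field_simps)
  then have "exp (- (9 / 16 * log 2 y)) \<le> y powr (- 3 / 4)"
    using y by (simp add: log_def powr_def)
  also have "\<dots> \<le> real T powr (- 3 / 4)"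
    using y assms by (intro powr_mono2') auto
  finally show ?thesis by (simp add: y_def)
qed

lemma Cconst_sq:
  assumes "1 \<le> m" "1 \<le> T"
  shows "(Cconst m T)\<^sup>2 = 8 * (log 2 (16 * (real m)\<^sup>2) + log 2 (real T))"
    and "0 \<le> log 2 (16 * (real m)\<^sup>2)"
proof -
  have "1 * 1 \<le> 16 * (real m)\<^sup>2"
    using assms by (intro mult_mono) (auto simp: one_le_power)
  then show nn: "0 \<le> log 2 (16 * (real m)\<^sup>2)"
    by (subst zero_le_log_cancel_iff) (use assms in auto)
  have "0 \<le> log 2 (real T)" using assms by simp
  moreover have "log 2 (16 * (real m)\<^sup>2 * real T) = log 2 (16 * (real m)\<^sup>2) + log 2 (real T)"
    using assms by (intro log_mult_pos) auto
  ultimately show "(Cconst m T)\<^sup>2 = 8 * (log 2 (16 * (real m)\<^sup>2) + log 2 (real T))"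
    unfolding Cconst_def using nn by simp
qed

text \<open>The hidden factor has more logarithms than the analysis consumes. The surplus absorbs
  every constant of the problem once \<open>log 2 T\<close> exceeds it, so that 10^5 can be a
  numerical constant.\<close>

lemma eventually_rate:
  fixes m :: nat and V \<gamma> \<kappa> L \<Delta> c e :: real
  assumes m: "1 \<le> m" and pos: "0 < V" "0 < \<gamma>" "0 < L" "0 < \<Delta>" and c: "0 \<le> c" and e: "0 \<le> e"
  defines "l \<equiv> \<lambda>T. log 2 (real T)"
    and "d \<equiv> \<lambda>T. \<gamma> * (Cconst m T)\<^sup>2 * V\<^sup>2"
    and "p \<equiv> \<lambda>T. (log 2 (real T) + 1) * c * exp (- (9 / 16 * log 2 (16 * (real m)\<^sup>2 * real T)))"
    and "\<eta> \<equiv> \<lambda>T. learning_rate L V \<gamma> \<Delta> m T"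
  shows "\<forall>\<^sub>F T in sequentially. 0 < \<eta> T \<and> L * \<eta> T \<le> 1 / 6 \<and>
    4 * \<Delta> / (\<eta> T * real T) + 196 * d T / real T + 2 * (p T * (2 * e + 18 * (l T)\<^sup>2 * d T))
      + 6 * L * \<eta> T * (e + 9 * l T * d T) \<le> hidden_factor m T * (V * sqrt (L * \<Delta> * \<gamma> / real T)) \<and>
    196 * d T \<le> hidden_factor m T * (V\<^sup>2 * \<gamma>)"
proof -
  define v where "v = V * sqrt (L * \<gamma>)"
  define k where "k = V * sqrt (L * \<Delta> * \<gamma>)"
  \<comment> \<open>288 = 18 * 16, from \<open>d T\<close> \<le> 16 \<gamma> V^2 \<open>l T\<close>;
    this w serves the crude bias and the second moment alike.\<close>
  define w where "w = 2 * e + 288 * \<gamma> * V\<^sup>2"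
  have vk: "0 < v" "0 < k" "0 \<le> w" using pos e by (auto simp: v_def k_def w_def)
  have k: "k = sqrt \<Delta> * v" by (simp add: k_def v_def real_sqrt_mult)
  \<comment> \<open>In order: 48 = 12 * 4 for the term A; the m-part of C^2, giving C^2 \<le> 16
    \<open>l T\<close>; the condition L \<eta> \<le> 1/6; 3136 = 196 * 16 for B; and the last for
    D.\<close>
  define N where "N = Max {48, log 2 (16 * (real m)\<^sup>2), 2 * L * sqrt \<Delta> / v, 3136 * \<gamma> * V\<^sup>2 / k, 2 * L * sqrt \<Delta> * w / (v * k)}"
  have ev_l: "\<forall>\<^sub>F T in sequentially. N \<le> l T"
    using log_at_top unfolding l_def filterlim_at_top by blast
  \<comment> \<open>An upper bound for sqrt T times the bad-event term, which therefore falls below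
    k.\<close>
  have "(\<lambda>T. 4 * c * w * ((l T) ^ 4 * real T powr (- 1 / 4))) \<longlonglongrightarrow> 4 * c * w * 0"
    unfolding l_def by (intro tendsto_mult_left log_power_decay)
  then have ev_q: "\<forall>\<^sub>F T in sequentially. 4 * c * w * ((l T) ^ 4 * real T powr (- 1 / 4)) < k"
    using vk by (intro order_tendstoD(2)) auto
  show ?thesis
    using ev_l ev_q eventually_ge_at_top[of 2]
  proof eventually_elim
    case (elim T)
    define C where "C = Cconst m T"
    define r where "r = sqrt (real T)"
    define s where "s = sqrt (l T)"
    have N: "48 \<le> l T" "log 2 (16 * (real m)\<^sup>2) \<le> l T" "2 * L * sqrt \<Delta> / v \<le> l T"
      "3136 * \<gamma> * V\<^sup>2 / k \<le> l T" "2 * L * sqrt \<Delta> * w / (v * k) \<le> l T"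
      using elim(1) unfolding N_def by simp_all
    have l0: "0 < l T" using N(1) by simp
    have T1: "1 \<le> T" using elim(3) by simp
    have r: "1 \<le> r" "r\<^sup>2 = real T" "r * r = real T" using T1 by (auto simp: r_def)
    have s: "0 < s" "s\<^sup>2 = l T" using l0 by (auto simp: s_def)
    have C2: "8 * l T \<le> C\<^sup>2" "C\<^sup>2 \<le> 16 * l T"
      using Cconst_sq[OF m T1] N(2) by (auto simp: C_def l_def)
    have C: "0 < C"
    proof -
      have "0 \<le> C" unfolding C_def Cconst_def
        using Cconst_sq[OF m T1] N(1) m T1 by (intro real_sqrt_ge_zero) (simp add: log_mult_pos l_def)
      moreover have "C \<noteq> 0" using C2(1) l0 by auto
      ultimately show ?thesis by simp
    qed
    \<comment> \<open>C and s both grow like the square root of \<open>l T\<close>. The lower bound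
      on their product limits \<eta> from above, the upper bound limits 1/\<eta>.\<close>
    have Cs_lower: "l T \<le> C * s"
    proof (rule power2_le_imp_le)
      have "(l T)\<^sup>2 \<le> 8 * l T * l T" using l0 by (simp add: power2_eq_square)
      also have "\<dots> \<le> C\<^sup>2 * l T" using C2(1) l0 by (intro mult_right_mono) auto
      finally show "(l T)\<^sup>2 \<le> (C * s)\<^sup>2" by (simp add: power_mult_distrib s)
    qed (use C s in simp)
    have Cs_upper: "C * s \<le> 4 * l T"
    proof (rule power2_le_imp_le)
      have "(C * s)\<^sup>2 = C\<^sup>2 * l T" by (simp add: power_mult_distrib s)
      also have "\<dots> \<le> 16 * l T * l T" using C2(2) l0 by (intro mult_right_mono) auto
      finally show "(C * s)\<^sup>2 \<le> (4 * l T)\<^sup>2" by (simp add: power2_eq_square)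
    qed (use l0 in simp)
    define den where "den = 3 * (C * s) * v * r"
    have den: "3 * C * V * sqrt (L * \<gamma> * real T * log 2 (real T)) = den"
      by (simp add: den_def v_def r_def s_def l_def real_sqrt_mult mult_ac)
    have den_lower: "3 * l T * v * r \<le> den"
      unfolding den_def using Cs_lower vk r by (intro mult_right_mono) auto
    have den0: "0 < den" using vk r C s by (simp add: den_def)
    have small: "L * (sqrt \<Delta> / den) \<le> 1 / 6"
    proof -
      have "2 * L * sqrt \<Delta> \<le> l T * v * 1" using N(3) vk by (simp add: field_simps)
      also have "\<dots> \<le> l T * v * r" using r l0 vk by (intro mult_left_mono) auto
      finally have "6 * (L * sqrt \<Delta>) \<le> den" using den_lower by linarith
      then show ?thesis using den0 by (simp add: field_simps)
    qed
    have \<eta>: "\<eta> T = sqrt \<Delta> / den"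
    proof -
      have "sqrt \<Delta> / den \<le> 1 / L" using order_trans[OF small, of 1] pos(3) by (simp add: field_simps)
      then show ?thesis
        using den0 unfolding \<eta>_def learning_rate_def Let_def C_def[symmetric] den by simp
    qed
    have \<eta>0: "0 < \<eta> T" using den0 pos by (simp add: \<eta>)
    \<comment> \<open>k / r is the target V sqrt (L \<Delta> \<gamma> / T); each of the four error
      terms will be bounded by this one g.\<close>
    define g where "g = (l T)\<^sup>2 * (k / r)"
    have d: "0 \<le> d T" "d T \<le> 16 * \<gamma> * V\<^sup>2 * l T"
    proof -
      show "0 \<le> d T" using pos by (simp add: d_def)
      have "\<gamma> * C\<^sup>2 * V\<^sup>2 \<le> \<gamma> * (16 * l T) * V\<^sup>2"
        using C2 pos by (intro mult_right_mono mult_left_mono) auto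
      then show "d T \<le> 16 * \<gamma> * V\<^sup>2 * l T" by (simp add: d_def C_def[symmetric] mult_ac)
    qed
    have l_le: "l T \<le> (l T)\<^sup>2" "1 \<le> (l T)\<^sup>2" "48 * l T \<le> (l T)\<^sup>2" "(l T)\<^sup>2 \<le> (l T) ^ 3" "1 \<le> (l T) ^ 3"
      using N(1) power_increasing[of 1 2 "l T"] power_increasing[of 2 3 "l T"]
      by (auto simp: one_le_power) (simp add: power2_eq_square)
    have A: "4 * \<Delta> / (\<eta> T * real T) \<le> g"
    proof -
      have "4 * \<Delta> / (\<eta> T * real T) = 12 * (C * s) * (k / r)"
      proof -
        have "4 * (q * q) / (q / den * (r * r)) = 4 * q * den / (r * r)" if "0 < q" for q
          using that den0 r(1) by (simp add: field_simps)
        from this[of "sqrt \<Delta>"] have "4 * \<Delta> / (\<eta> T * real T) = 4 * sqrt \<Delta> * den / (r * r)"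
          using pos by (simp add: \<eta> r(3)[symmetric])
        also have "\<dots> = 12 * (C * s) * (k / r)"
          using r(1) by (simp add: den_def k)
        finally show ?thesis .
      qed
      also have "\<dots> \<le> 12 * (4 * l T) * (k / r)"
        using Cs_upper vk r by (intro mult_right_mono mult_left_mono) auto
      also have "\<dots> \<le> g" unfolding g_def using l_le(3) vk r by (intro mult_right_mono) auto
      finally show ?thesis .
    qed
    have B: "196 * d T / real T \<le> g"
    proof -
      have "196 * d T / real T \<le> 3136 * \<gamma> * V\<^sup>2 * l T / real T"
        by (rule divide_right_mono) (use d(2) in linarith, simp)
      also have "\<dots> \<le> (l T * k) * l T / (1 * r)"
        unfolding r(3)[symmetric] using N(4) vk l0 r by (intro frac_le mult_right_mono) (auto simp: field_simps)
      finally show ?thesis by (simp add: g_def power2_eq_square mult_ac)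
    qed
    have C': "2 * (p T * (2 * e + 18 * (l T)\<^sup>2 * d T)) \<le> g"
    proof -
      have "p T \<le> (l T + 1) * c * real T powr (- 3 / 4)"
        using exp_log_tail[OF m T1] l0 c unfolding p_def l_def by (intro mult_left_mono) auto
      also have "\<dots> \<le> (2 * l T) * c * real T powr (- 3 / 4)"
        using N(1) c by (intro mult_right_mono) auto
      finally have p: "p T \<le> (2 * l T) * c * real T powr (- 3 / 4)" .
      have "18 * (l T)\<^sup>2 * d T \<le> 18 * (l T)\<^sup>2 * (16 * \<gamma> * V\<^sup>2 * l T)"
        using d by (intro mult_left_mono) auto
      moreover have "2 * e * 1 \<le> 2 * e * (l T) ^ 3" using l_le e by (intro mult_left_mono) auto
      ultimately have "2 * e + 18 * (l T)\<^sup>2 * d T \<le> w * (l T) ^ 3"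
        by (simp add: w_def power2_eq_square power3_eq_cube algebra_simps)
      then have "2 * (p T * (2 * e + 18 * (l T)\<^sup>2 * d T)) \<le> 2 * ((2 * l T) * c * real T powr (- 3 / 4) * (w * (l T) ^ 3))"
        using p l0 c e d by (intro mult_left_mono mult_mono) auto
      also have "\<dots> = 4 * c * w * ((l T) ^ 4 * real T powr (- 3 / 4))"
        by (simp add: power3_eq_cube power4_eq_xxxx mult_ac)
      also have "real T powr (- 3 / 4) = real T powr (- 1 / 4) * real T powr (- (1 / 2))"
        by (simp add: powr_add[symmetric])
      also have "real T powr (- (1 / 2)) = 1 / r"
        unfolding powr_minus_divide r_def by (simp only: powr_half_sqrt of_nat_0_le_iff)
      also have "4 * c * w * ((l T) ^ 4 * (real T powr (- 1 / 4) * (1 / r))) =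
          (4 * c * w * ((l T) ^ 4 * real T powr (- 1 / 4))) * (1 / r)"
        by (simp only: mult.assoc)
      also have "\<dots> \<le> k * (1 / r)" using elim(2) r by (intro mult_right_mono) auto
      also have "\<dots> \<le> g"
        unfolding g_def using l_le(2) vk r mult_right_mono[of 1 "(l T)\<^sup>2" "k / r"] by simp
      finally show ?thesis .
    qed
    have D: "6 * L * \<eta> T * (e + 9 * l T * d T) \<le> g"
    proof -
      have "9 * l T * d T \<le> 9 * l T * (16 * \<gamma> * V\<^sup>2 * l T)"
        using d l0 by (intro mult_left_mono) auto
      moreover have "e * 1 \<le> 2 * e * (l T)\<^sup>2" using l_le e by (intro mult_mono) auto
      moreover have "0 \<le> 144 * \<gamma> * V\<^sup>2 * (l T)\<^sup>2" using pos by simp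
      ultimately have "e + 9 * l T * d T \<le> w * (l T)\<^sup>2"
        by (simp add: w_def power2_eq_square algebra_simps)
      moreover have "\<eta> T \<le> sqrt \<Delta> / (3 * l T * v * r)"
        unfolding \<eta> using den_lower l0 vk r pos by (intro divide_left_mono) (auto intro!: mult_pos_pos den0)
      ultimately have "6 * L * \<eta> T * (e + 9 * l T * d T) \<le> 6 * L * (sqrt \<Delta> / (3 * l T * v * r)) * (w * (l T)\<^sup>2)"
        using pos e d l0 vk r(1) \<eta>0 by (intro mult_mono mult_left_mono) auto
      also have "\<dots> = (2 * L * sqrt \<Delta> * w / (v * k)) * (l T * (k / r))"
      proof -
        have "6 * L * (q / (3 * a * v * r)) * (w * a\<^sup>2) = (2 * L * q * w / (v * k)) * (a * (k / r))" if "0 < a" for a q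
          using that vk(1,2) r(1) by (simp add: power2_eq_square)
        from this[OF l0] show ?thesis .
      qed
      also have "\<dots> \<le> l T * (l T * (k / r))"
        using N(5) l0 vk r by (intro mult_right_mono) auto
      finally show ?thesis by (simp add: g_def power2_eq_square mult_ac)
    qed
    have hidden: "10 ^ 5 * (l T)\<^sup>2 \<le> hidden_factor m T"
    proof -
      have "l T \<le> log 2 (real m * real T)"
        unfolding l_def using m T1 by (subst log_le_cancel_iff) auto
      then show ?thesis unfolding hidden_factor_def using l0 by (intro mult_left_mono power_mono) auto
    qed
    have "4 * \<Delta> / (\<eta> T * real T) + 196 * d T / real T + 2 * (p T * (2 * e + 18 * (l T)\<^sup>2 * d T))
        + 6 * L * \<eta> T * (e + 9 * l T * d T) \<le> 4 * g"
      using A B C' D by linarith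
    also have "\<dots> \<le> 10 ^ 5 * (l T)\<^sup>2 * (k / r)"
    proof -
      have "0 \<le> g" using vk r by (simp add: g_def)
      then have "4 * g \<le> 10 ^ 5 * g" by simp
      then show ?thesis by (simp only: g_def mult.assoc)
    qed
    also have "\<dots> \<le> hidden_factor m T * (k / r)"
      using hidden vk r by (intro mult_right_mono) auto
    also have "k / r = V * sqrt (L * \<Delta> * \<gamma> / real T)"
      by (simp add: k_def r_def real_sqrt_divide)
    finally have main: "4 * \<Delta> / (\<eta> T * real T) + 196 * d T / real T + 2 * (p T * (2 * e + 18 * (l T)\<^sup>2 * d T))
        + 6 * L * \<eta> T * (e + 9 * l T * d T) \<le> hidden_factor m T * (V * sqrt (L * \<Delta> * \<gamma> / real T))" .
    have "196 * d T \<le> 196 * (16 * \<gamma> * V\<^sup>2 * l T)"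
      by (rule mult_left_mono[OF d(2)]) simp
    also have "\<dots> = 3136 * l T * (V\<^sup>2 * \<gamma>)" by (simp add: mult_ac)
    also have "\<dots> \<le> 10 ^ 5 * (l T)\<^sup>2 * (V\<^sup>2 * \<gamma>)"
      using l_le(1) l0 pos by (intro mult_right_mono) auto
    also have "\<dots> \<le> hidden_factor m T * (V\<^sup>2 * \<gamma>)"
      using hidden pos by (intro mult_right_mono) auto
    finally have "196 * d T \<le> hidden_factor m T * (V\<^sup>2 * \<gamma>)" .
    then show ?case using main small \<eta>0 \<eta> by simp
  qed
qed

section \<open>From the rate to the admissible number of dynamic rounds\<close>

text \<open>The budget is the break-even point: \<gamma>/T * sqrt (T/\<gamma>) = sqrt (\<gamma>/T),
  so the dynamic term is the static rate times K V / sqrt (L \<Delta>) and logarithms.\<close>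

lemma dynamic_budget_rate:
  fixes L \<Delta> \<gamma> T V h l E K ms r :: real
  assumes main: "ms \<le> h * (V * sqrt (L * \<Delta> * \<gamma> / T) + V\<^sup>2 * \<gamma> * (E / T)) + r"
    and degenerate: "V = 0 \<or> \<Delta> = 0 \<Longrightarrow> ms \<le> r"
    and pos: "0 \<le> h" "0 \<le> V" "0 < L" "0 \<le> \<Delta>" "0 < \<gamma>" "0 < T" "1 \<le> l" "0 \<le> K"
    and budget: "E \<le> K * l ^ q * sqrt (T / \<gamma>)"
  shows "ms \<le> (1 + K * V / sqrt (L * \<Delta>)) * l ^ q * h * (V * sqrt (L * \<Delta> * \<gamma> / T)) + r"
proof (cases "V = 0 \<or> \<Delta> = 0")
  \<comment> \<open>Here the static rate is 0 and cannot absorb the dynamic term (for \<Delta> = 0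
    the quotient by \<open>sqrt (L * \<Delta>)\<close> is 0 by convention), so the bound by
    \<open>r\<close> alone is used.\<close>
  case True
  then show ?thesis using degenerate by auto
next
  case False
  then have V: "0 < V" "0 < \<Delta>" using pos by auto
  define b where "b = V * sqrt (L * \<Delta> * \<gamma> / T)"
  have b: "0 \<le> b" using pos by (simp add: b_def)
  have sqrts: "sqrt (L * \<Delta> * \<gamma> / T) = sqrt (L * \<Delta>) * (sqrt \<gamma> / sqrt T)"
    by (simp add: real_sqrt_mult real_sqrt_divide)
  have "\<gamma> / T * sqrt (T / \<gamma>) = (sqrt \<gamma> * sqrt \<gamma>) / (sqrt T * sqrt T) * (sqrt T / sqrt \<gamma>)"
    using pos by (simp add: real_sqrt_divide)
  also have "\<dots> = sqrt \<gamma> / sqrt T"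
    using pos by (simp add: field_simps del: real_sqrt_mult_self)
  finally have g: "\<gamma> / T * sqrt (T / \<gamma>) = sqrt \<gamma> / sqrt T" .
  have "V\<^sup>2 * \<gamma> * (E / T) = V\<^sup>2 * (\<gamma> / T) * E" by simp
  also have "\<dots> \<le> V\<^sup>2 * (\<gamma> / T) * (K * l ^ q * sqrt (T / \<gamma>))"
    using budget pos by (intro mult_left_mono) auto
  also have "\<dots> = V\<^sup>2 * K * l ^ q * (\<gamma> / T * sqrt (T / \<gamma>))" by simp
  also have "\<dots> = K * V / sqrt (L * \<Delta>) * l ^ q * b"
    unfolding g b_def sqrts using pos V by (simp add: power2_eq_square)
  finally have dyn: "V\<^sup>2 * \<gamma> * (E / T) \<le> K * V / sqrt (L * \<Delta>) * l ^ q * b" .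
  have "b * 1 \<le> b * l ^ q" using b pos by (intro mult_left_mono one_le_power) auto
  with dyn have "b + V\<^sup>2 * \<gamma> * (E / T) \<le> (1 + K * V / sqrt (L * \<Delta>)) * l ^ q * b"
    by (simp add: algebra_simps)
  then have "h * (b + V\<^sup>2 * \<gamma> * (E / T)) \<le> h * ((1 + K * V / sqrt (L * \<Delta>)) * l ^ q * b)"
    using pos by (intro mult_left_mono) auto
  with main show ?thesis by (simp add: b_def mult_ac)
qed

lemma linear_robustness_rate:
  fixes L \<Delta> \<gamma> T V \<delta> \<kappa> K i :: real
  assumes "0 \<le> V" "0 \<le> L" "0 \<le> \<Delta>" "0 < T" "0 \<le> \<delta>" "0 \<le> i" "0 \<le> K"
    and "\<gamma> = 2 * \<kappa> + i" "\<kappa> \<le> K * \<delta>"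
  shows "V * sqrt (L * \<Delta> * \<gamma> / T) \<le> sqrt (1 + 2 * K) * (V * sqrt (L * \<Delta> * (\<delta> + i) / T))"
proof -
  have "\<gamma> \<le> (1 + 2 * K) * (\<delta> + i)"
  proof -
    have "(1 + 2 * K) * (\<delta> + i) = \<delta> + i + 2 * (K * \<delta>) + 2 * (K * i)" by (simp add: algebra_simps)
    moreover have "0 \<le> K * i" using assms by simp
    ultimately show ?thesis using assms by linarith
  qed
  then have "L * \<Delta> * \<gamma> / T \<le> L * \<Delta> * ((1 + 2 * K) * (\<delta> + i)) / T"
    using assms by (intro divide_right_mono mult_left_mono) auto
  also have "\<dots> = (1 + 2 * K) * (L * \<Delta> * (\<delta> + i) / T)" by simp
  finally have "sqrt (L * \<Delta> * \<gamma> / T) \<le> sqrt (1 + 2 * K) * sqrt (L * \<Delta> * (\<delta> + i) / T)"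
    unfolding real_sqrt_mult[symmetric] by (rule real_sqrt_le_mono)
  from mult_left_mono[OF this assms(1)] show ?thesis by (simp only: mult.left_commute)
qed

section \<open>Combination of the cases\<close>

theorem corollary4p2:
  fixes f :: "'a::euclidean_space \<Rightarrow> real"
    and gf :: "'a \<Rightarrow> 'a"
    and D :: "'x measure"
    and F :: "'a \<Rightarrow> 'x \<Rightarrow> real"
    and gF :: "'a \<Rightarrow> 'x \<Rightarrow> 'a"
    and A :: "'a ^ 'm::finite \<Rightarrow> 'a"
    and L V \<delta> \<kappa> \<gamma> \<Delta> :: real
    and x1 :: 'a
  assumes "prob_space D"
    and "\<And>x. integrable D (F x)"
    and "\<And>x. f x = (\<integral>s. F x s \<partial>D)"
    and "\<And>x. AE s in D. GDERIV (\<lambda>y. F y s) x :> gF x s"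
    and "(\<lambda>(x, s). gF x s) \<in> borel_measurable (borel \<Otimes>\<^sub>M D)"
    and "\<And>x. (\<integral>s. gF x s \<partial>D) = gf x"
    and "L > 0"
    and "smooth L f gf"
    and "bdd_below (range f)"
    and "\<And>x. AE s in D. norm (gF x s - gf x) \<le> V"
    and "robust \<delta> \<kappa> A"
    and "A \<in> borel_measurable borel"
    and "\<gamma> = 2 * \<kappa> + 1 / real CARD('m)"
    and "\<Delta> = f x1 - (INF x. f x)"
  shows "\<exists>r. lower_order V r \<and>
    (\<forall>\<^sub>F T in sequentially.
      \<forall>(M :: 'w measure) H J (\<xi> :: nat \<Rightarrow> nat \<Rightarrow> 'm \<Rightarrow> 'w \<Rightarrow> 'x) G B x.
        dynamic_run M D \<delta> T H J \<xi> G B gF A V \<gamma> (learning_rate L V \<gamma> \<Delta> CARD('m) T) x1 x \<longrightarrow>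
          (\<forall>t \<in> {1..T}. integrable M (\<lambda>\<omega>. (norm (gf (x t \<omega>)))\<^sup>2)) \<and>
          mean_sq_gradient M gf T x
            \<le> hidden_factor CARD('m) T *
                (V * sqrt (L * \<Delta> * \<gamma> / real T) + V\<^sup>2 * \<gamma> * (expected_dynamic M T J G / real T))
              + r T \<and>
          ((AE \<omega> in M. dynamic_rounds T J G \<omega> = {}) \<longrightarrow>
             mean_sq_gradient M gf T x
               \<le> hidden_factor CARD('m) T * (V * sqrt (L * \<Delta> * \<gamma> / real T)) + r T) \<and>
          (\<forall>K \<ge> 0. \<forall>q :: nat.
             expected_dynamic M T J G
               \<le> K * (log 2 (real CARD('m) * real T)) ^ q * sqrt (real T / \<gamma>) \<longrightarrow>
             mean_sq_gradient M gf T x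
               \<le> (1 + K * V / sqrt (L * \<Delta>)) * (log 2 (real CARD('m) * real T)) ^ q *
                   hidden_factor CARD('m) T * (V * sqrt (L * \<Delta> * \<gamma> / real T)) + r T \<and>
             (\<forall>K' \<ge> 0. \<kappa> \<le> K' * \<delta> \<longrightarrow>
                mean_sq_gradient M gf T x
                  \<le> sqrt (1 + 2 * K') * (1 + K * V / sqrt (L * \<Delta>)) *
                      (log 2 (real CARD('m) * real T)) ^ q * hidden_factor CARD('m) T *
                      (V * sqrt (L * \<Delta> * (\<delta> + 1 / real CARD('m)) / real T)) + r T)))"
proof -
  obtain U :: "'a set" where U: "finite U" "U \<subseteq> sphere 0 1"
    "\<And>v. \<exists>u\<in>U. 3 / 4 * norm v \<le> u \<bullet> v"
    using finite_sphere_net by blast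
  interpret D: prob_space D by fact
  have V: "0 \<le> V"
  proof -
    have "AE s in D. 0 \<le> V"
      using assms(10)[of 0] by eventually_elim (auto intro: order_trans[OF norm_ge_zero])
    then show ?thesis by simp
  qed
  have \<kappa>: "0 \<le> \<kappa>" using assms(11) by (simp add: robust_def)
  have \<gamma>: "0 < \<gamma>" using \<kappa> by (simp add: assms(13) add_nonneg_pos)
  have \<Delta>: "0 \<le> \<Delta>" using assms(9) by (simp add: assms(14) cINF_lower)
  define h where "h T = hidden_factor CARD('m) T" for T
  define \<eta> where "\<eta> T = learning_rate L V \<gamma> \<Delta> CARD('m) T" for T
  \<comment> \<open>The error of noiseless gradient descent, of lower order than 1 / sqrt T; with
    noise nothing is left over.\<close>
  define r where "r T = (if V = 0 then 2 * L * \<Delta> * (1 / real T) else 0)" for T :: nat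
  have "(\<lambda>T. 1 / real T) \<in> o(\<lambda>T. 1 / sqrt (real T))" by real_asymp
  then have "(\<lambda>T. 2 * L * \<Delta> * (1 / real T)) \<in> o(\<lambda>T. 1 / sqrt (real T))"
  proof (cases "\<Delta> = 0")
    case False
    with assms(7) have "2 * L * \<Delta> \<noteq> 0" by simp
    then show ?thesis
      using \<open>(\<lambda>T. 1 / real T) \<in> o(\<lambda>T. 1 / sqrt (real T))\<close>
      by (rule landau_o.small.cmult_in_iff[THEN iffD2])
  qed simp
  then have lower: "lower_order V r"
    by (cases "V = 0") (auto simp: lower_order_def r_def[abs_def])
  have h0: "0 \<le> h T" for T by (simp add: h_def hidden_factor_def)
  \<comment> \<open>The runs are quantified under the eventuality, so the threshold for
    \<open>T\<close> depends on the problem but not on the run or the adversary.\<close>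
  have main: "\<forall>\<^sub>F T in sequentially. \<forall>(M :: 'w measure) H J (\<xi> :: nat \<Rightarrow> nat \<Rightarrow> 'm \<Rightarrow> 'w \<Rightarrow> 'x) G B x.
      robust_run M D \<delta> T H J \<xi> G B gF A V \<gamma> (\<eta> T) x1 x f gf L \<kappa> \<longrightarrow>
        mean_sq_gradient M gf T x \<le> h T * (V * sqrt (L * \<Delta> * \<gamma> / real T)
          + V\<^sup>2 * \<gamma> * (expected_dynamic M T J G / real T)) + r T \<and>
        (V = 0 \<or> \<Delta> = 0 \<longrightarrow> mean_sq_gradient M gf T x \<le> r T)"
  proof -
    consider "V = 0" | "0 < V" "\<Delta> = 0" | "0 < V" "0 < \<Delta>" using V \<Delta> by linarith
    then show ?thesis
    proof cases
      case 1
      show ?thesis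
        using eventually_gt_at_top[of 0]
      proof (eventually_elim, intro allI impI)
        fix T :: nat and M :: "'w measure" and H J and \<xi> :: "nat \<Rightarrow> nat \<Rightarrow> 'm \<Rightarrow> 'w \<Rightarrow> 'x" and G B x
        assume T: "0 < T" and run: "robust_run M D \<delta> T H J \<xi> G B gF A V \<gamma> (\<eta> T) x1 x f gf L \<kappa>"
        have "\<eta> T = 1 / L" by (simp add: \<eta>_def learning_rate_def 1)
        with robust_run.mean_sq_gradient_noiseless[OF run T 1]
        have "mean_sq_gradient M gf T x \<le> r T" by (simp add: r_def 1 assms(14))
        then show "mean_sq_gradient M gf T x \<le> h T * (V * sqrt (L * \<Delta> * \<gamma> / real T)
            + V\<^sup>2 * \<gamma> * (expected_dynamic M T J G / real T)) + r T \<and>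
          (V = 0 \<or> \<Delta> = 0 \<longrightarrow> mean_sq_gradient M gf T x \<le> r T)"
          by (simp add: 1)
      qed
    next
      case 2
      show ?thesis
        \<comment> \<open>For T > 1 the logarithm in the denominator is nonzero, so the first term
          of the minimum is really sqrt 0 / den = 0.\<close>
        using eventually_gt_at_top[of 1]
      proof (eventually_elim, intro allI impI)
        fix T :: nat and M :: "'w measure" and H J and \<xi> :: "nat \<Rightarrow> nat \<Rightarrow> 'm \<Rightarrow> 'w \<Rightarrow> 'x" and G B x
        assume T: "1 < T" and run: "robust_run M D \<delta> T H J \<xi> G B gF A V \<gamma> (\<eta> T) x1 x f gf L \<kappa>"
        interpret robust_run M D \<delta> T H J \<xi> G B gF A V \<gamma> "\<eta> T" x1 x f gf L \<kappa> by (rule run)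
        have "0 < log 2 (real T)" using T by simp
        moreover have m1: "1 \<le> CARD('m)" "1 \<le> T" using T by auto
        ultimately have "0 < (Cconst CARD('m) T)\<^sup>2"
          unfolding Cconst_sq(1)[OF m1] using Cconst_sq(2)[OF m1]
          by (intro mult_pos_pos add_nonneg_pos) simp_all
        then have "Cconst CARD('m) T \<noteq> 0" by auto
        moreover have "log 2 (real T) \<noteq> 0" using \<open>0 < log 2 (real T)\<close> by (rule less_imp_neq[symmetric])
        ultimately have "\<eta> T = 0"
          using T 2 assms(7) \<gamma> by (simp add: \<eta>_def learning_rate_def Let_def)
        then have "mean_sq_gradient M gf T x = 0"
          using mean_sq_gradient_stationary 2 assms(14) by simp
        then show "mean_sq_gradient M gf T x \<le> h T * (V * sqrt (L * \<Delta> * \<gamma> / real T)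
            + V\<^sup>2 * \<gamma> * (expected_dynamic M T J G / real T)) + r T \<and>
          (V = 0 \<or> \<Delta> = 0 \<longrightarrow> mean_sq_gradient M gf T x \<le> r T)"
          using h0[of T] 2 \<gamma> expected_dynamic_nonneg by (simp add: r_def)
      qed
    next
      case 3
      have "\<forall>\<^sub>F T in sequentially. 0 < \<eta> T \<and> L * \<eta> T \<le> 1 / 6 \<and>
        4 * \<Delta> / (\<eta> T * real T) + 196 * (\<gamma> * (Cconst CARD('m) T)\<^sup>2 * V\<^sup>2) / real T
          + 2 * (((log 2 (real T) + 1) * (2 ^ CARD('m) * real (card U))
              * exp (- (9 / 16 * log 2 (16 * (real CARD('m))\<^sup>2 * real T))))
            * (2 * ((2 * \<kappa> + 2) * V\<^sup>2) + 18 * (log 2 (real T))\<^sup>2 * (\<gamma> * (Cconst CARD('m) T)\<^sup>2 * V\<^sup>2)))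
          + 6 * L * \<eta> T * ((2 * \<kappa> + 2) * V\<^sup>2 + 9 * log 2 (real T) * (\<gamma> * (Cconst CARD('m) T)\<^sup>2 * V\<^sup>2))
          \<le> h T * (V * sqrt (L * \<Delta> * \<gamma> / real T)) \<and>
        196 * (\<gamma> * (Cconst CARD('m) T)\<^sup>2 * V\<^sup>2) \<le> h T * (V\<^sup>2 * \<gamma>)"
        unfolding \<eta>_def h_def using 3 \<gamma> \<kappa> assms(7) by (intro eventually_rate) auto
      then show ?thesis
        using eventually_gt_at_top[of 0]
      proof (eventually_elim, intro allI impI)
        fix T :: nat and M :: "'w measure" and H J and \<xi> :: "nat \<Rightarrow> nat \<Rightarrow> 'm \<Rightarrow> 'w \<Rightarrow> 'x" and G B x
        assume T: "0 < T" and run: "robust_run M D \<delta> T H J \<xi> G B gF A V \<gamma> (\<eta> T) x1 x f gf L \<kappa>"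
        assume rate: "0 < \<eta> T \<and> L * \<eta> T \<le> 1 / 6 \<and>
        4 * \<Delta> / (\<eta> T * real T) + 196 * (\<gamma> * (Cconst CARD('m) T)\<^sup>2 * V\<^sup>2) / real T
          + 2 * (((log 2 (real T) + 1) * (2 ^ CARD('m) * real (card U))
              * exp (- (9 / 16 * log 2 (16 * (real CARD('m))\<^sup>2 * real T))))
            * (2 * ((2 * \<kappa> + 2) * V\<^sup>2) + 18 * (log 2 (real T))\<^sup>2 * (\<gamma> * (Cconst CARD('m) T)\<^sup>2 * V\<^sup>2)))
          + 6 * L * \<eta> T * ((2 * \<kappa> + 2) * V\<^sup>2 + 9 * log 2 (real T) * (\<gamma> * (Cconst CARD('m) T)\<^sup>2 * V\<^sup>2))
          \<le> h T * (V * sqrt (L * \<Delta> * \<gamma> / real T)) \<and>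
        196 * (\<gamma> * (Cconst CARD('m) T)\<^sup>2 * V\<^sup>2) \<le> h T * (V\<^sup>2 * \<gamma>)"
        interpret robust_run M D \<delta> T H J \<xi> G B gF A V \<gamma> "\<eta> T" x1 x f gf L \<kappa> by (rule run)
        define E where "E = expected_dynamic M T J G / real T"
        have E: "0 \<le> E" using expected_dynamic_nonneg by (simp add: E_def)
        have "196 * (\<gamma> * (Cconst CARD('m) T)\<^sup>2 * V\<^sup>2) * E \<le> h T * (V\<^sup>2 * \<gamma>) * E"
          using rate E by (intro mult_right_mono) auto
        moreover have "mean_sq_gradient M gf T x \<le> 4 * \<Delta> / (\<eta> T * real T) + 196 * (\<gamma> * (Cconst CARD('m) T)\<^sup>2 * V\<^sup>2) / real T
          + 196 * (\<gamma> * (Cconst CARD('m) T)\<^sup>2 * V\<^sup>2) * E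
          + 2 * (((log 2 (real T) + 1) * (2 ^ CARD('m) * real (card U))
              * exp (- (9 / 16 * log 2 (16 * (real CARD('m))\<^sup>2 * real T))))
            * (2 * ((2 * \<kappa> + 2) * V\<^sup>2) + 18 * (log 2 (real T))\<^sup>2 * (\<gamma> * (Cconst CARD('m) T)\<^sup>2 * V\<^sup>2)))
          + 6 * L * \<eta> T * ((2 * \<kappa> + 2) * V\<^sup>2 + 9 * log 2 (real T) * (\<gamma> * (Cconst CARD('m) T)\<^sup>2 * V\<^sup>2))"
          using mean_sq_gradient_explicit[OF T 3(1) _ _ U] rate
          by (simp only: E_def assms(14) mult.assoc)
        ultimately have "mean_sq_gradient M gf T x \<le> h T * (V * sqrt (L * \<Delta> * \<gamma> / real T)) + h T * (V\<^sup>2 * \<gamma>) * E"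
          using rate by linarith
        also have "\<dots> = h T * (V * sqrt (L * \<Delta> * \<gamma> / real T) + V\<^sup>2 * \<gamma> * E)"
          by (simp only: ring_distribs mult.assoc)
        finally show "mean_sq_gradient M gf T x \<le> h T * (V * sqrt (L * \<Delta> * \<gamma> / real T)
            + V\<^sup>2 * \<gamma> * (expected_dynamic M T J G / real T)) + r T \<and>
          (V = 0 \<or> \<Delta> = 0 \<longrightarrow> mean_sq_gradient M gf T x \<le> r T)"
          using 3 by (simp add: r_def E_def)
      qed
    qed
  qed
  show ?thesis
  proof (intro exI[of _ r] conjI lower)
    show "\<forall>\<^sub>F T in sequentially.
      \<forall>(M :: 'w measure) H J (\<xi> :: nat \<Rightarrow> nat \<Rightarrow> 'm \<Rightarrow> 'w \<Rightarrow> 'x) G B x.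
        dynamic_run M D \<delta> T H J \<xi> G B gF A V \<gamma> (learning_rate L V \<gamma> \<Delta> CARD('m) T) x1 x \<longrightarrow>
          (\<forall>t \<in> {1..T}. integrable M (\<lambda>\<omega>. (norm (gf (x t \<omega>)))\<^sup>2)) \<and>
          mean_sq_gradient M gf T x
            \<le> hidden_factor CARD('m) T *
                (V * sqrt (L * \<Delta> * \<gamma> / real T) + V\<^sup>2 * \<gamma> * (expected_dynamic M T J G / real T))
              + r T \<and>
          ((AE \<omega> in M. dynamic_rounds T J G \<omega> = {}) \<longrightarrow>
             mean_sq_gradient M gf T x
               \<le> hidden_factor CARD('m) T * (V * sqrt (L * \<Delta> * \<gamma> / real T)) + r T) \<and>
          (\<forall>K \<ge> 0. \<forall>q :: nat.
             expected_dynamic M T J G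
               \<le> K * (log 2 (real CARD('m) * real T)) ^ q * sqrt (real T / \<gamma>) \<longrightarrow>
             mean_sq_gradient M gf T x
               \<le> (1 + K * V / sqrt (L * \<Delta>)) * (log 2 (real CARD('m) * real T)) ^ q *
                   hidden_factor CARD('m) T * (V * sqrt (L * \<Delta> * \<gamma> / real T)) + r T \<and>
             (\<forall>K' \<ge> 0. \<kappa> \<le> K' * \<delta> \<longrightarrow>
                mean_sq_gradient M gf T x
                  \<le> sqrt (1 + 2 * K') * (1 + K * V / sqrt (L * \<Delta>)) *
                      (log 2 (real CARD('m) * real T)) ^ q * hidden_factor CARD('m) T *
                      (V * sqrt (L * \<Delta> * (\<delta> + 1 / real CARD('m)) / real T)) + r T))"
      using main eventually_ge_at_top[of 2]
    proof (eventually_elim, intro allI impI)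
      fix T :: nat and M :: "'w measure" and H J and \<xi> :: "nat \<Rightarrow> nat \<Rightarrow> 'm \<Rightarrow> 'w \<Rightarrow> 'x" and G B x
      assume bound: "\<forall>(M :: 'w measure) H J (\<xi> :: nat \<Rightarrow> nat \<Rightarrow> 'm \<Rightarrow> 'w \<Rightarrow> 'x) G B x.
        robust_run M D \<delta> T H J \<xi> G B gF A V \<gamma> (\<eta> T) x1 x f gf L \<kappa> \<longrightarrow>
          mean_sq_gradient M gf T x \<le> h T * (V * sqrt (L * \<Delta> * \<gamma> / real T)
            + V\<^sup>2 * \<gamma> * (expected_dynamic M T J G / real T)) + r T \<and>
          (V = 0 \<or> \<Delta> = 0 \<longrightarrow> mean_sq_gradient M gf T x \<le> r T)"
        and T: "2 \<le> T"
        and dyn: "dynamic_run M D \<delta> T H J \<xi> G B gF A V \<gamma> (learning_rate L V \<gamma> \<Delta> CARD('m) T) x1 x"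
      have run: "robust_run M D \<delta> T H J \<xi> G B gF A V \<gamma> (\<eta> T) x1 x f gf L \<kappa>"
        unfolding \<eta>_def by (intro robust_run.intro dyn robust_run_axioms.intro assms)
      interpret robust_run M D \<delta> T H J \<xi> G B gF A V \<gamma> "\<eta> T" x1 x f gf L \<kappa> by (rule run)
      define ms where "ms = mean_sq_gradient M gf T x"
      define E where "E = expected_dynamic M T J G"
      define l where "l = log 2 (real CARD('m) * real T)"
      have ms: "ms \<le> h T * (V * sqrt (L * \<Delta> * \<gamma> / real T) + V\<^sup>2 * \<gamma> * (E / real T)) + r T"
        and degenerate: "V = 0 \<or> \<Delta> = 0 \<Longrightarrow> ms \<le> r T"
        using bound run unfolding ms_def E_def by blast+
      \<comment> \<open>From T \<ge> 2 the logarithm is at least 1, so its powers do not shrink the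
        static part of the rate.\<close>
      have "1 * 2 \<le> real CARD('m) * real T" using T by (intro mult_mono) auto
      then have "log 2 2 \<le> l" unfolding l_def by (subst log_le_cancel_iff) auto
      then have l: "1 \<le> l" by simp
      have static: "ms \<le> h T * (V * sqrt (L * \<Delta> * \<gamma> / real T)) + r T"
        if "AE \<omega> in M. dynamic_rounds T J G \<omega> = {}"
        using ms expected_dynamic_static[OF that] by (simp add: E_def)
      have budget: "ms \<le> (1 + K * V / sqrt (L * \<Delta>)) * l ^ q * h T * (V * sqrt (L * \<Delta> * \<gamma> / real T)) + r T"
        if "0 \<le> K" "E \<le> K * l ^ q * sqrt (real T / \<gamma>)" for K q
        using dynamic_budget_rate[OF ms degenerate h0 V assms(7) \<Delta> \<gamma> _ l that] T by simp
      have linear: "ms \<le> sqrt (1 + 2 * K') * (1 + K * V / sqrt (L * \<Delta>)) * l ^ q * h T *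
          (V * sqrt (L * \<Delta> * (\<delta> + 1 / real CARD('m)) / real T)) + r T"
        if "0 \<le> K" "E \<le> K * l ^ q * sqrt (real T / \<gamma>)" "0 \<le> K'" "\<kappa> \<le> K' * \<delta>" for K q K'
      proof -
        have "V * sqrt (L * \<Delta> * \<gamma> / real T) \<le>
            sqrt (1 + 2 * K') * (V * sqrt (L * \<Delta> * (\<delta> + 1 / real CARD('m)) / real T))"
          using V assms(7,13) \<Delta> T delta_nonneg that by (intro linear_robustness_rate) auto
        moreover have "0 \<le> (1 + K * V / sqrt (L * \<Delta>)) * l ^ q * h T"
          using that V l h0 assms(7) \<Delta> by (intro mult_nonneg_nonneg add_nonneg_nonneg divide_nonneg_nonneg) auto
        ultimately have "(1 + K * V / sqrt (L * \<Delta>)) * l ^ q * h T * (V * sqrt (L * \<Delta> * \<gamma> / real T)) \<le>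
            (1 + K * V / sqrt (L * \<Delta>)) * l ^ q * h T *
              (sqrt (1 + 2 * K') * (V * sqrt (L * \<Delta> * (\<delta> + 1 / real CARD('m)) / real T)))"
          by (rule mult_left_mono)
        then show ?thesis using budget[OF that(1,2)] by (simp add: mult_ac)
      qed
      show "(\<forall>t \<in> {1..T}. integrable M (\<lambda>\<omega>. (norm (gf (x t \<omega>)))\<^sup>2)) \<and>
          mean_sq_gradient M gf T x
            \<le> hidden_factor CARD('m) T *
                (V * sqrt (L * \<Delta> * \<gamma> / real T) + V\<^sup>2 * \<gamma> * (expected_dynamic M T J G / real T))
              + r T \<and>
          ((AE \<omega> in M. dynamic_rounds T J G \<omega> = {}) \<longrightarrow>
             mean_sq_gradient M gf T x
               \<le> hidden_factor CARD('m) T * (V * sqrt (L * \<Delta> * \<gamma> / real T)) + r T) \<and>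
          (\<forall>K \<ge> 0. \<forall>q :: nat.
             expected_dynamic M T J G
               \<le> K * (log 2 (real CARD('m) * real T)) ^ q * sqrt (real T / \<gamma>) \<longrightarrow>
             mean_sq_gradient M gf T x
               \<le> (1 + K * V / sqrt (L * \<Delta>)) * (log 2 (real CARD('m) * real T)) ^ q *
                   hidden_factor CARD('m) T * (V * sqrt (L * \<Delta> * \<gamma> / real T)) + r T \<and>
             (\<forall>K' \<ge> 0. \<kappa> \<le> K' * \<delta> \<longrightarrow>
                mean_sq_gradient M gf T x
                  \<le> sqrt (1 + 2 * K') * (1 + K * V / sqrt (L * \<Delta>)) *
                      (log 2 (real CARD('m) * real T)) ^ q * hidden_factor CARD('m) T *
                      (V * sqrt (L * \<Delta> * (\<delta> + 1 / real CARD('m)) / real T)) + r T))"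
        unfolding ms_def[symmetric] E_def[symmetric] l_def[symmetric] h_def[symmetric]
        using integrable_gradient ms static budget linear by auto
    qed
  qed
qed

end
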